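(* There is a unique $\lambda$-ring structure on $\mathrm{PS}_{\mathbb Z}$ whose Adams operations are $\psi_n(g)(x_{**})=g(x_{**}^n)$; with it and its grading by degree, $\mathrm{PS}_{\mathbb Z}$ is a graded $\lambda$-ring. For every special graded $\lambda$-ring $R=\bigoplus_{d\ge0}R_d$, the map $$\mathrm{Hom}_{\text{graded }\lambda\text{-rings}}(\mathrm{PS}_{\mathbb Z},R)\to\prod_{d\ge1}R_d,\qquad\phi\mapsto(\phi(M_d))_{d\ge1},$$ is a bijection, where $M_d=\sum_{j\ge1}x_{dj}$.
   Context: $\mathrm{PS}_{\mathbb Z}$ is the ring of formal sums, of bounded degree and integer coefficients, of monomials in indeterminates $x_{ij}$ ($i,j\ge1$, $x_{ij}$ of degree $i$) that are invariant under all permutations of $\mathbb N_{>0}^2$ preserving the first coordinate; $g(x_{**}^n)$ means substituting $x_{ij}\mapsto x_{ij}^n$. A $\lambda$-ring is a commutative ring with $\lambda_t:R\to1+tR[[t]]$, $\lambda_t(r)=1+rt+O(t^2)$, $\lambda_t(r+s)=\lambda_t(r)\lambda_t(s)$; Adams operations are defined by $\sum_{n\ge1}\psi_n(r)t^n=-t\frac{d}{dt}\log\sum_n\lambda_n(r)(-t)^n$. A $\lambda$-ring is special if $\lambda_t$ is a $\lambda$-ring homomorphism to $1+tR[[t]]$ with its canonical (big Witt vector) $\lambda$-structure. A graded $\lambda$-ring is a $\lambda$-ring $R=\bigoplus_{d\ge0}R_d$ graded as a ring with $\lambda_n(R_d)\subset R_{nd}$ for all $n,d$; morphisms are degree-preserving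 ring homomorphisms commuting with all $\lambda_n$. *)

theory Defs
  imports "HOL-Algebra.Algebra" "HOL-Library.FuncSet"
begin

text \<open>A polynomial with integer coefficients in variables of type 'v is a function from
  exponent vectors ('v => nat) to int with finitely many non-zero coefficients,
  each supported on a finitely supported exponent vector.\<close>

definition is_ipoly :: "(('v \<Rightarrow> nat) \<Rightarrow> int) \<Rightarrow> bool" where
  "is_ipoly p \<longleftrightarrow> finite {m. p m \<noteq> 0} \<and> (\<forall>m. p m \<noteq> 0 \<longrightarrow> finite {v. m v \<noteq> 0})"

definition ipoly_vars :: "(('v \<Rightarrow> nat) \<Rightarrow> int) \<Rightarrow> 'v set" where
  "ipoly_vars p = {v. \<exists>m. p m \<noteq> 0 \<and> m v \<noteq> 0}"

definition ieval :: "('v \<Rightarrow> int) \<Rightarrow> (('v \<Rightarrow> nat) \<Rightarrow> int) \<Rightarrow> int" where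
  "ieval \<sigma> p = (\<Sum>m\<in>{m. p m \<noteq> 0}. p m * (\<Prod>v\<in>{v. m v \<noteq> 0}. \<sigma> v ^ m v))"

definition reval :: "('a, 'b) ring_scheme \<Rightarrow> ('v \<Rightarrow> 'a) \<Rightarrow> (('v \<Rightarrow> nat) \<Rightarrow> int) \<Rightarrow> 'a" where
  "reval R \<sigma> p = finsum R (\<lambda>m. add_pow R (p m) (finprod R (\<lambda>v. \<sigma> v [^]\<^bsub>R\<^esub> m v) {v. m v \<noteq> 0}))
                     {m. p m \<noteq> 0}"

definition esym :: "nat \<Rightarrow> 'i set \<Rightarrow> ('i \<Rightarrow> int) \<Rightarrow> int" where
  "esym k I f = (\<Sum>S\<in>{S. S \<subseteq> I \<and> card S = k}. \<Prod>i\<in>S. f i)"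

text \<open>Universal polynomial P_n(a_1..a_n; b_1..b_n): coefficient of t^n in
  prod_{i,j}(1 + x_i y_j t), expressed in a_k = e_k(x), b_k = e_k(y).
  Variable (False,k) stands for a_k, (True,k) for b_k.  Uniqueness holds because the
  e_k are algebraically independent and Z^n is Zariski dense.\<close>
definition P_mult :: "nat \<Rightarrow> ((bool \<times> nat \<Rightarrow> nat) \<Rightarrow> int)" where
  "P_mult n = (THE p. is_ipoly p \<and> ipoly_vars p \<subseteq> UNIV \<times> {1..n} \<and>
     (\<forall>x y :: nat \<Rightarrow> int.
        ieval (\<lambda>(b, k). if b then esym k {1..n} y else esym k {1..n} x) p
        = esym n ({1..n} \<times> {1..n}) (\<lambda>(i, j). x i * y j)))"

definition P_lam :: "nat \<Rightarrow> nat \<Rightarrow> ((nat \<Rightarrow> nat) \<Rightarrow> int)" where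
  "P_lam m n = (THE p. is_ipoly p \<and> ipoly_vars p \<subseteq> {1..m*n} \<and>
     (\<forall>x :: nat \<Rightarrow> int.
        ieval (\<lambda>k. esym k {1..m*n} x) p
        = esym m {S. S \<subseteq> {1..m*n} \<and> card S = n} (\<lambda>S. \<Prod>i\<in>S. x i)))"

text \<open>lam n r is lambda_n(r). lambda_t(r) = sum_n lam n r t^n; the axiom
  lambda_t(r+s) = lambda_t(r) lambda_t(s) is written coefficientwise.\<close>
definition lambda_ring :: "('a, 'b) ring_scheme \<Rightarrow> (nat \<Rightarrow> 'a \<Rightarrow> 'a) \<Rightarrow> bool" where
  "lambda_ring R lam \<longleftrightarrow> cring R \<and>
     (\<forall>r\<in>carrier R. lam 0 r = \<one>\<^bsub>R\<^esub> \<and> lam 1 r = r \<and> (\<forall>n. lam n r \<in> carrier R)) \<and>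
     (\<forall>r\<in>carrier R. \<forall>s\<in>carrier R. \<forall>n.
        lam n (r \<oplus>\<^bsub>R\<^esub> s) = finsum R (\<lambda>k. lam k r \<otimes>\<^bsub>R\<^esub> lam (n - k) s) {0..n})"

text \<open>psi are the Adams operations of lam: sum_{n>=1} psi_n(r) t^n = -t d/dt log L(t) with
  L(t) = sum_n lam_n(r) (-t)^n, i.e. (sum psi_n t^n) L(t) = -t L'(t) (L is invertible),
  written coefficientwise for every n >= 1.\<close>
definition adams_ops :: "('a, 'b) ring_scheme \<Rightarrow> (nat \<Rightarrow> 'a \<Rightarrow> 'a) \<Rightarrow> (nat \<Rightarrow> 'a \<Rightarrow> 'a) \<Rightarrow> bool" where
  "adams_ops R lam psi \<longleftrightarrow>
     (\<forall>r\<in>carrier R. \<forall>n\<ge>1. psi n r \<in> carrier R \<and>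
        finsum R (\<lambda>k. add_pow R ((-1::int) ^ k) (lam k r \<otimes>\<^bsub>R\<^esub> psi (n - k) r)) {0..<n}
        \<oplus>\<^bsub>R\<^esub> add_pow R ((-1::int) ^ n * int n) (lam n r) = \<zero>\<^bsub>R\<^esub>)"

text \<open>Elements of 1 + tR[[t]] are coefficient sequences a with a 0 = 1.
  Its addition is multiplication of power series; its multiplication, unit and
  lambda-operations are the canonical ones, given by the universal polynomials.\<close>
definition witt_mult :: "('a, 'b) ring_scheme \<Rightarrow> (nat \<Rightarrow> 'a) \<Rightarrow> (nat \<Rightarrow> 'a) \<Rightarrow> (nat \<Rightarrow> 'a)" where
  "witt_mult R a b = (\<lambda>n. if n = 0 then \<one>\<^bsub>R\<^esub>
      else reval R (\<lambda>(c, k). if c then b k else a k) (P_mult n))"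

definition witt_one :: "('a, 'b) ring_scheme \<Rightarrow> (nat \<Rightarrow> 'a)" where
  "witt_one R = (\<lambda>n. if n \<le> 1 then \<one>\<^bsub>R\<^esub> else \<zero>\<^bsub>R\<^esub>)"

definition witt_lam :: "('a, 'b) ring_scheme \<Rightarrow> nat \<Rightarrow> (nat \<Rightarrow> 'a) \<Rightarrow> (nat \<Rightarrow> 'a)" where
  "witt_lam R k a = (\<lambda>m. if m = 0 then \<one>\<^bsub>R\<^esub> else reval R a (P_lam m k))"

text \<open>Special: lambda_t : R -> 1 + tR[[t]] is a lambda-ring homomorphism (additivity is
  already an axiom of lambda-rings).\<close>
definition special_lambda_ring :: "('a, 'b) ring_scheme \<Rightarrow> (nat \<Rightarrow> 'a \<Rightarrow> 'a) \<Rightarrow> bool" where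
  "special_lambda_ring R lam \<longleftrightarrow> lambda_ring R lam \<and>
     (\<lambda>n. lam n \<one>\<^bsub>R\<^esub>) = witt_one R \<and>
     (\<forall>r\<in>carrier R. \<forall>s\<in>carrier R.
        (\<lambda>n. lam n (r \<otimes>\<^bsub>R\<^esub> s)) = witt_mult R (\<lambda>n. lam n r) (\<lambda>n. lam n s)) \<and>
     (\<forall>r\<in>carrier R. \<forall>k. (\<lambda>n. lam n (lam k r)) = witt_lam R k (\<lambda>n. lam n r))"

definition graded_ring :: "('a, 'b) ring_scheme \<Rightarrow> (nat \<Rightarrow> 'a set) \<Rightarrow> bool" where
  "graded_ring R G \<longleftrightarrow>
     (\<forall>d. G d \<subseteq> carrier R \<and> \<zero>\<^bsub>R\<^esub> \<in> G d \<and>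
          (\<forall>x\<in>G d. \<forall>y\<in>G d. x \<oplus>\<^bsub>R\<^esub> y \<in> G d \<and> \<ominus>\<^bsub>R\<^esub> x \<in> G d)) \<and>
     (\<forall>d e. \<forall>x\<in>G d. \<forall>y\<in>G e. x \<otimes>\<^bsub>R\<^esub> y \<in> G (d + e)) \<and>
     (\<forall>r\<in>carrier R. \<exists>!c. (\<forall>d. c d \<in> G d) \<and> finite {d. c d \<noteq> \<zero>\<^bsub>R\<^esub>} \<and>
                          r = finsum R c {d. c d \<noteq> \<zero>\<^bsub>R\<^esub>})"

definition graded_lambda_ring :: "('a, 'b) ring_scheme \<Rightarrow> (nat \<Rightarrow> 'a set) \<Rightarrow> (nat \<Rightarrow> 'a \<Rightarrow> 'a) \<Rightarrow> bool" where
  "graded_lambda_ring R G lam \<longleftrightarrow> lambda_ring R lam \<and> graded_ring R G \<and>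
     (\<forall>n d. \<forall>r\<in>G d. lam n r \<in> G (n * d))"

definition graded_lambda_hom ::
  "('a, 'b) ring_scheme \<Rightarrow> (nat \<Rightarrow> 'a set) \<Rightarrow> (nat \<Rightarrow> 'a \<Rightarrow> 'a) \<Rightarrow>
   ('c, 'd) ring_scheme \<Rightarrow> (nat \<Rightarrow> 'c set) \<Rightarrow> (nat \<Rightarrow> 'c \<Rightarrow> 'c) \<Rightarrow> ('a \<Rightarrow> 'c) \<Rightarrow> bool" where
  "graded_lambda_hom A GA lamA B GB lamB \<phi> \<longleftrightarrow>
     \<phi> \<in> ring_hom A B \<and> (\<forall>d. \<phi> ` GA d \<subseteq> GB d) \<and>
     (\<forall>n. \<forall>r\<in>carrier A. \<phi> (lamA n r) = lamB n (\<phi> r))"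

text \<open>A monomial in the x_ij (i,j >= 1) is an exponent function on pairs with finite support
  contained in the positive pairs; x_ij has degree i.\<close>
definition pos_idx :: "(nat \<times> nat) set" where
  "pos_idx = {(i, j). 1 \<le> i \<and> 1 \<le> j}"

definition is_mono :: "(nat \<times> nat \<Rightarrow> nat) \<Rightarrow> bool" where
  "is_mono m \<longleftrightarrow> finite {p. m p \<noteq> 0} \<and> {p. m p \<noteq> 0} \<subseteq> pos_idx"

definition mdeg :: "(nat \<times> nat \<Rightarrow> nat) \<Rightarrow> nat" where
  "mdeg m = (\<Sum>p\<in>{p. m p \<noteq> 0}. fst p * m p)"

definition mono_perm :: "(nat \<times> nat \<Rightarrow> nat \<times> nat) \<Rightarrow> (nat \<times> nat \<Rightarrow> nat) \<Rightarrow> (nat \<times> nat \<Rightarrow> nat)" where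
  "mono_perm \<tau> m = (\<lambda>p. if p \<in> pos_idx then m (\<tau> p) else 0)"

definition row_perm :: "(nat \<times> nat \<Rightarrow> nat \<times> nat) \<Rightarrow> bool" where
  "row_perm \<tau> \<longleftrightarrow> bij_betw \<tau> pos_idx pos_idx \<and> (\<forall>p\<in>pos_idx. fst (\<tau> p) = fst p)"

type_synonym ps = "(nat \<times> nat \<Rightarrow> nat) \<Rightarrow> int"

text \<open>Formal sums: coefficient functions on monomials, of bounded degree, invariant.\<close>
definition PS :: "ps set" where
  "PS = {c. (\<forall>m. \<not> is_mono m \<longrightarrow> c m = 0) \<and>
            (\<exists>N. \<forall>m. N < mdeg m \<longrightarrow> c m = 0) \<and>
            (\<forall>\<tau>. row_perm \<tau> \<longrightarrow> (\<forall>m. is_mono m \<longrightarrow> c (mono_perm \<tau> m) = c m))}"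

definition ps_add :: "ps \<Rightarrow> ps \<Rightarrow> ps" where
  "ps_add c d = (\<lambda>m. c m + d m)"

definition ps_mul :: "ps \<Rightarrow> ps \<Rightarrow> ps" where
  "ps_mul c d = (\<lambda>m. \<Sum>a\<in>{a. \<forall>p. a p \<le> m p}. c a * d (\<lambda>p. m p - a p))"

definition ps_one :: ps where
  "ps_one = (\<lambda>m. if m = (\<lambda>_. 0) then 1 else 0)"

definition ps_zero :: ps where
  "ps_zero = (\<lambda>m. 0)"

definition PS_ring :: "ps ring" where
  "PS_ring = \<lparr>carrier = PS, monoid.mult = ps_mul, one = ps_one, ring.zero = ps_zero, ring.add = ps_add\<rparr>"

definition PS_grade :: "nat \<Rightarrow> ps set" where
  "PS_grade d = {c \<in> PS. \<forall>m. c m \<noteq> 0 \<longrightarrow> mdeg m = d}"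

text \<open>psi_n(g)(x_**) = g(x_**^n), substituting x_ij |-> x_ij^n.\<close>
definition ps_psi :: "nat \<Rightarrow> ps \<Rightarrow> ps" where
  "ps_psi n c = (\<lambda>m. if (\<forall>p. n dvd m p) then c (\<lambda>p. m p div n) else 0)"

definition M :: "nat \<Rightarrow> ps" where
  "M d = (\<lambda>m. if (\<exists>j\<ge>1. m = (\<lambda>_. 0)((d, j) := 1)) then 1 else 0)"

end

theory Submission
  imports Defs "HOL-Library.Poly_Mapping" "HOL-Computational_Algebra.Formal_Power_Series"
    "HOL-Computational_Algebra.Polynomial"
begin

text \<open>Formal sums are embedded in a ring of power series with integer coefficients. There the
  Newton relation \<open>t \<lambda>\<^bsub>t\<^esub>' = (\<Sum> (-1)\<^bsup>n-1\<^esup> \<psi>\<^bsub>n\<^esub> t\<^bsup>n\<^esup>) \<lambda>\<^bsub>t\<^esub>\<close> has an integral solution, because it does for a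
  single monomial and solutions can be multiplied and inverted; as the ring is torsion-free, the
  solution is unique, and additivity and compatibility with endomorphisms commuting with the \<open>\<psi>\<^bsub>n\<^esub>\<close>
  follow. By a leading monomial argument the ring of formal sums is the polynomial ring on the
  elements \<open>e\<^bsub>ik\<^esub> = \<lambda>\<^bsub>k\<^esub>(M\<^bsub>i\<^esub>)\<close>, so ring homomorphisms out of it can be prescribed on the \<open>e\<^bsub>ik\<^esub>\<close>.
  Expressing \<open>\<lambda>\<^bsub>n\<^esub>(M\<^bsub>1\<^esub> M\<^bsub>2\<^esub>)\<close> and \<open>\<lambda>\<^bsub>m\<^esub>(\<lambda>\<^bsub>n\<^esub>(M\<^bsub>i\<^esub>))\<close> through the \<open>e\<^bsub>ik\<^esub>\<close> yields the universal
  polynomials. Given a special \<open>R\<close> and \<open>r\<^bsub>i\<^esub> \<in> R\<^bsub>i\<^esub>\<close>, let \<open>\<phi>\<close> send \<open>e\<^bsub>ik\<^esub>\<close> to \<open>\<lambda>\<^bsub>k\<^esub>(r\<^bsub>i\<^esub>)\<close>: the elements on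
  which \<open>\<phi>\<close> commutes with all \<open>\<lambda>\<^bsub>n\<^esub>\<close> form a subring containing the \<open>e\<^bsub>ik\<^esub>\<close>.\<close>

subsection \<open>Integer power series in arbitrarily many variables\<close>

text \<open>The ring \<open>R\<close> may have torsion, so there the Adams operations do not
  determine the lambda-operations and no Newton argument is available. All comparison with
  \<open>R\<close> therefore goes through polynomial identities, and the polynomials
  \<open>P_mult\<close> and \<open>P_lam\<close> in the definition of special, which are fixed only
  by their values at integer points, must be recognised as those that govern products and iterates
  in the ring of formal sums. The obstacle on the other side is that the \<open>M d\<close> are
  infinite sums. Setting all but finitely many variables to zero commutes with the
  lambda-operations, and afterwards these become elementary symmetric polynomials of finitely many
  monomials; this is the passage between formal sums and integer points. Leading coefficients of
  products of the e_ik are 1, which is why the ring of formal sums is polynomial over the integers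
  and not only after division.\<close>

abbreviation lookup :: "('a \<Rightarrow>\<^sub>0 'b::zero) \<Rightarrow> 'a \<Rightarrow> 'b" where
  "lookup \<equiv> Poly_Mapping.lookup"

abbreviation keys :: "('a \<Rightarrow>\<^sub>0 'b::zero) \<Rightarrow> 'a set" where
  "keys \<equiv> Poly_Mapping.keys"

abbreviation single :: "'a \<Rightarrow> 'b \<Rightarrow> 'a \<Rightarrow>\<^sub>0 'b::zero" where
  "single \<equiv> Poly_Mapping.single"

abbreviation map_key :: "('b \<Rightarrow> 'a) \<Rightarrow> ('a \<Rightarrow>\<^sub>0 'c::zero) \<Rightarrow> 'b \<Rightarrow>\<^sub>0 'c" where
  "map_key \<equiv> Poly_Mapping.map_key"

text \<open>No finiteness is imposed on the support, since \<open>MM\<close> below has infinitely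
  many terms. Multiplication still makes sense because an exponent has only finitely many
  decompositions into two summands.\<close>

typedef 'v mps = "UNIV :: (('v \<Rightarrow>\<^sub>0 nat) \<Rightarrow> int) set"
  morphisms cf Mps ..

lemma cf_Mps [simp]: "cf (Mps f) = f"
  by (simp add: Mps_inverse)

lemma mps_eqI: "(\<And>m. cf f m = cf g m) \<Longrightarrow> f = g"
  by (metis cf_inject ext)

definition decomp :: "('v \<Rightarrow>\<^sub>0 nat) \<Rightarrow> (('v \<Rightarrow>\<^sub>0 nat) \<times> ('v \<Rightarrow>\<^sub>0 nat)) set" where
  "decomp m = {(a, b). a + b = m}"

lemma decomp_iff [simp]: "(a, b) \<in> decomp m \<longleftrightarrow> a + b = m"
  by (simp add: decomp_def)

lemma keys_add_nat: "keys (a + b) = keys a \<union> keys (b :: 'v \<Rightarrow>\<^sub>0 nat)"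
  by (auto simp: in_keys_iff lookup_add)

lemma finite_lookup_le: "finite {a :: 'v \<Rightarrow>\<^sub>0 nat. \<forall>v. lookup a v \<le> lookup m v}"
proof -
  have "finite {f. \<forall>v. (v \<in> keys m \<longrightarrow> f v \<in> {..Max (lookup m ` keys m)}) \<and> (v \<notin> keys m \<longrightarrow> f v = 0)}"
    by (intro finite_set_of_finite_funs) auto
  moreover have "lookup ` {a. \<forall>v. lookup a v \<le> lookup m v} \<subseteq>
    {f. \<forall>v. (v \<in> keys m \<longrightarrow> f v \<in> {..Max (lookup m ` keys m)}) \<and> (v \<notin> keys m \<longrightarrow> f v = 0)}"
  proof clarsimp
    fix a v assume "\<forall>v. lookup a v \<le> lookup m v"
    then have "lookup a v \<le> lookup m v" by blast
    moreover have "lookup m v \<le> Max (lookup m ` keys m)" if "v \<in> keys m"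
      using that by simp
    ultimately show "(v \<in> keys m \<longrightarrow> lookup a v \<le> Max (lookup m ` keys m)) \<and>
           (v \<notin> keys m \<longrightarrow> lookup a v = 0)"
      by (metis in_keys_iff le_zero_eq order_trans)
  qed
  ultimately show ?thesis
    by (meson finite_imageD finite_subset inj_onI poly_mapping_eq_iff)
qed

lemma finite_decomp [simp]: "finite (decomp m)"
proof -
  have "decomp m \<subseteq> {a. \<forall>v. lookup a v \<le> lookup m v} \<times> {a. \<forall>v. lookup a v \<le> lookup m v}"
    by (auto simp: lookup_add)
  then show ?thesis
    by (rule finite_subset) (intro finite_cartesian_product finite_lookup_le)
qed

text \<open>Both sides run over the ways of writing \<open>m\<close> as a sum of three exponents;
  the reindexing only changes the bracketing.\<close>

lemma mult_assoc_aux: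
  "(\<Sum>(a, b)\<in>decomp m. (\<Sum>(c, d)\<in>decomp a. f c * g d) * h b) =
   (\<Sum>(a, b)\<in>decomp m. f a * (\<Sum>(c, d)\<in>decomp b. g c * (h d :: int)))"
proof -
  have "(\<Sum>(a, b)\<in>decomp m. (\<Sum>(c, d)\<in>decomp a. f c * g d) * h b) =
    (\<Sum>p\<in>decomp m. \<Sum>q\<in>decomp (fst p). f (fst q) * g (snd q) * h (snd p))"
    by (simp add: case_prod_unfold sum_distrib_right)
  also have "\<dots> = (\<Sum>(p, q)\<in>(SIGMA p:decomp m. decomp (fst p)). f (fst q) * g (snd q) * h (snd p))"
    by (simp add: sum.Sigma)
  also have "\<dots> = (\<Sum>(p, q)\<in>(SIGMA p:decomp m. decomp (snd p)). f (fst p) * (g (fst q) * h (snd q)))"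
    by (rule sum.reindex_bij_witness
          [where i = "\<lambda>((a, b), (c, d)). ((a + c, d), (a, c))"
             and j = "\<lambda>((a, b), (c, d)). ((c, d + b), (d, b))"])
       (auto simp: add.assoc mult.assoc)
  also have "\<dots> = (\<Sum>p\<in>decomp m. \<Sum>q\<in>decomp (snd p). f (fst p) * (g (fst q) * h (snd q)))"
    by (simp add: sum.Sigma)
  finally show ?thesis
    by (simp add: case_prod_unfold sum_distrib_left)
qed

lemma mult_comm_aux:
  "(\<Sum>(a, b)\<in>decomp m. f a * (g b :: int)) = (\<Sum>(a, b)\<in>decomp m. g a * f b)"
  by (rule sum.reindex_bij_witness[where i = "\<lambda>(a, b). (b, a)" and j = "\<lambda>(a, b). (b, a)"])
     (auto simp: add.commute mult.commute)

lemma mult_one_aux: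
  "(\<Sum>(a, b)\<in>decomp m. (if a = 0 then 1 else 0) * (g b :: int)) = g m"
proof -
  have "(\<Sum>(a, b)\<in>decomp m. (if a = 0 then 1 else 0) * g b) = (\<Sum>p\<in>decomp m. if p = (0, m) then g m else 0)"
    by (rule sum.cong) (auto split: if_splits)
  then show ?thesis by simp
qed

instantiation mps :: (type) comm_ring_1
begin

definition "0 = Mps (\<lambda>_. 0)"
definition "1 = Mps (\<lambda>m. if m = 0 then 1 else 0)"
definition "f + g = Mps (\<lambda>m. cf f m + cf g m)"
definition "f - g = Mps (\<lambda>m. cf f m - cf g m)"
definition "- f = Mps (\<lambda>m. - cf f m)"
definition "f * g = Mps (\<lambda>m. \<Sum>(a, b)\<in>decomp m. cf f a * cf g b)"

instance
proof
  fix a b c :: "'a mps"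
  show "a * b * c = a * (b * c)"
    by (rule mps_eqI) (simp only: times_mps_def cf_Mps, rule mult_assoc_aux)
  show "a * b = b * a"
    by (rule mps_eqI) (simp only: times_mps_def cf_Mps, rule mult_comm_aux)
  show "1 * a = a"
    by (rule mps_eqI) (simp add: times_mps_def one_mps_def mult_one_aux)
  show "(a + b) * c = a * c + b * c"
    by (rule mps_eqI) (simp add: times_mps_def plus_mps_def case_prod_unfold ring_distribs sum.distrib)
  show "(0 :: 'a mps) \<noteq> 1"
  proof
    assume "(0 :: 'a mps) = 1"
    then have "cf (0 :: 'a mps) 0 = cf 1 0" by simp
    then show False by (simp add: zero_mps_def one_mps_def)
  qed
qed ((rule mps_eqI, simp add: zero_mps_def plus_mps_def minus_mps_def uminus_mps_def)+)

end

lemma cf_zero [simp]: "cf 0 m = 0"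
  and cf_add [simp]: "cf (f + g) m = cf f m + cf g m"
  and cf_diff [simp]: "cf (f - g) m = cf f m - cf g m"
  and cf_uminus [simp]: "cf (- f) m = - cf f m"
  and cf_one: "cf 1 m = (if m = 0 then 1 else 0)"
  and cf_mult: "cf (f * g) m = (\<Sum>(a, b)\<in>decomp m. cf f a * cf g b)"
  by (simp_all add: zero_mps_def plus_mps_def minus_mps_def uminus_mps_def one_mps_def times_mps_def)

lemma cf_sum [simp]: "cf (sum f A) m = (\<Sum>x\<in>A. cf (f x) m)"
  by (induction A rule: infinite_finite_induct) auto

lemma cf_of_nat_mult [simp]: "cf (of_nat n * f) m = int n * cf f m"
proof (induction n)
  case (Suc n)
  have "of_nat (Suc n) * f = f + of_nat n * f" by (simp add: distrib_right)
  then show ?case using Suc by (simp only: cf_add) (simp add: distrib_right)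
qed simp

lemma cf_of_int_mult [simp]: "cf (of_int n * f) m = n * cf f m"
proof (cases n rule: int_cases2)
  case (nonpos k)
  have "of_int n * f = - (of_nat k * f)" using nonpos by simp
  then show ?thesis using nonpos by (simp only: cf_uminus cf_of_nat_mult)
qed simp

lemma cf_minus_one_power_mult [simp]: "cf ((-1) ^ n * f) m = (-1) ^ n * cf f m"
  by (cases "even n") auto

text \<open>Torsion-freeness is what allows lambda_n to be recovered from the Adams operations, as
  the Newton relation only gives n times lambda_n.\<close>

lemma of_nat_mult_mps_cancel:
  fixes f g :: "'v mps"
  assumes "n \<noteq> 0" "of_nat n * f = of_nat n * g"
  shows "f = g"
proof (rule mps_eqI)
  fix m
  have "cf (of_nat n * f) m = cf (of_nat n * g) m" using assms by simp
  then show "cf f m = cf g m" using assms(1) by simp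
qed

section \<open>Monomials and the substitution of n-th powers\<close>

definition xmon :: "('v \<Rightarrow>\<^sub>0 nat) \<Rightarrow> 'v mps" where
  "xmon u = Mps (\<lambda>m. if m = u then 1 else 0)"

lemma cf_xmon: "cf (xmon u) m = (if m = u then 1 else 0)"
  by (simp add: xmon_def)

lemma xmon_zero [simp]: "xmon 0 = 1"
  by (rule mps_eqI) (simp add: cf_xmon cf_one)

lemma xmon_mult: "xmon u * xmon w = xmon (u + w)"
proof (rule mps_eqI)
  fix m
  have "cf (xmon u * xmon w) m = (\<Sum>p\<in>decomp m. if p = (u, w) then 1 else 0)"
    unfolding cf_mult by (rule sum.cong) (auto simp: cf_xmon)
  also have "\<dots> = cf (xmon (u + w)) m"
    by (subst sum.delta) (auto simp: cf_xmon)
  finally show "cf (xmon u * xmon w) m = cf (xmon (u + w)) m" .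
qed

definition divm :: "nat \<Rightarrow> ('v \<Rightarrow>\<^sub>0 nat) \<Rightarrow> ('v \<Rightarrow>\<^sub>0 nat)" where
  "divm n m = Abs_poly_mapping (\<lambda>v. lookup m v div n)"

lemma lookup_divm [simp]: "lookup (divm n m) v = lookup m v div n"
proof -
  have "finite {v. lookup m v div n \<noteq> 0}"
    by (rule finite_subset[OF _ finite_keys[of m]]) (auto simp: in_keys_iff div_greater_zero_iff)
  then show ?thesis by (simp add: divm_def)
qed

definition mulm :: "nat \<Rightarrow> ('v \<Rightarrow>\<^sub>0 nat) \<Rightarrow> ('v \<Rightarrow>\<^sub>0 nat)" where
  "mulm n = Poly_Mapping.map ((*) n)"

lemma lookup_mulm [simp]: "lookup (mulm n u) v = n * lookup u v"
  by (simp add: mulm_def map.rep_eq when_def)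

lemma divm_mulm: "n \<ge> 1 \<Longrightarrow> divm n (mulm n u) = u"
  by (intro poly_mapping_eqI) simp

lemma mulm_divm: "\<forall>v. n dvd lookup u v \<Longrightarrow> mulm n (divm n u) = u"
  by (intro poly_mapping_eqI) simp

lemma mulm_plus: "mulm n (a + b) = mulm n a + mulm n b"
  by (intro poly_mapping_eqI) (simp add: lookup_add distrib_left)

definition psi :: "nat \<Rightarrow> 'v mps \<Rightarrow> 'v mps" where
  "psi n f = Mps (\<lambda>m. if \<forall>v. n dvd lookup m v then cf f (divm n m) else 0)"

lemma cf_psi: "cf (psi n f) m = (if \<forall>v. n dvd lookup m v then cf f (divm n m) else 0)"
  by (simp add: psi_def)

lemma psi_add: "psi n (f + g) = psi n f + psi n g"
  by (rule mps_eqI) (simp add: cf_psi)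

lemma psi_uminus: "psi n (- f) = - psi n f"
  by (rule mps_eqI) (simp add: cf_psi)

lemma psi_zero [simp]: "psi n 0 = 0"
  by (rule mps_eqI) (simp add: cf_psi)

text \<open>A decomposition of \<open>m\<close> contributes on the right only if \<open>n\<close>
  divides all exponents of both summands; division by \<open>n\<close> matches these with the
  decompositions of \<open>divm n m\<close>. If some exponent of \<open>m\<close> is not divisible
  by \<open>n\<close>, there are none.\<close>

lemma psi_mult: assumes n: "n \<ge> 1" shows "psi n (f * g) = psi n f * psi n g"
proof (rule mps_eqI)
  fix m :: "'a \<Rightarrow>\<^sub>0 nat"
  let ?D = "{p \<in> decomp m. (\<forall>v. n dvd lookup (fst p) v) \<and> (\<forall>v. n dvd lookup (snd p) v)}"
  have R: "cf (psi n f * psi n g) m = (\<Sum>p\<in>?D. cf f (divm n (fst p)) * cf g (divm n (snd p)))"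
    unfolding cf_mult by (rule sum.mono_neutral_cong_right) (auto simp: cf_psi split: if_splits)
  show "cf (psi n (f * g)) m = cf (psi n f * psi n g) m"
  proof (cases "\<forall>v. n dvd lookup m v")
    case True
    have "(\<Sum>(a, b)\<in>decomp (divm n m). cf f a * cf g b) =
      (\<Sum>p\<in>?D. cf f (divm n (fst p)) * cf g (divm n (snd p)))"
    proof (rule sum.reindex_bij_witness
        [where i = "\<lambda>p. (divm n (fst p), divm n (snd p))"
           and j = "\<lambda>p. (mulm n (fst p), mulm n (snd p))"])
      fix p assume "p \<in> decomp (divm n m)"
      then have "mulm n (fst p + snd p) = m" using True by (cases p) (simp add: mulm_divm)
      then show "(mulm n (fst p), mulm n (snd p)) \<in> ?D" by (simp add: mulm_plus)
    next
      fix p assume p: "p \<in> ?D"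
      then have "mulm n (divm n (fst p) + divm n (snd p)) = m"
        by (cases p) (simp add: mulm_plus mulm_divm)
      then show "(divm n (fst p), divm n (snd p)) \<in> decomp (divm n m)"
        using n by (auto simp: divm_mulm dest: arg_cong[of _ _ "divm n"])
      show "(mulm n (fst (divm n (fst p), divm n (snd p))), mulm n (snd (divm n (fst p), divm n (snd p)))) = p"
        using p by (cases p) (simp add: mulm_divm)
    qed (use n in \<open>auto simp: divm_mulm\<close>)
    then show ?thesis using True R by (simp add: cf_psi cf_mult)
  next
    case False
    then have "?D = {}" using dvd_add by (fastforce simp: lookup_add)
    then show ?thesis unfolding R using False by (simp only: cf_psi sum.empty if_False)
  qed
qed


lemma xmon_power: "xmon u ^ n = xmon (mulm n u)"
proof (induction n)
  case 0
  have "mulm 0 u = 0" by (intro poly_mapping_eqI) simp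
  then show ?case by simp
next
  case (Suc n)
  have "u + mulm n u = mulm (Suc n) u" by (intro poly_mapping_eqI) (simp add: lookup_add)
  then show ?case by (simp add: Suc xmon_mult)
qed

lemma psi_xmon: assumes "n \<ge> 1" shows "psi n (xmon u) = xmon u ^ n"
  unfolding xmon_power
proof (rule mps_eqI)
  fix m
  have "(\<forall>v. n dvd lookup m v) \<and> divm n m = u \<longleftrightarrow> m = mulm n u"
    using assms by (auto simp: poly_mapping_eq_iff fun_eq_iff) (metis dvd_mult_div_cancel)
  then show "cf (psi n (xmon u)) m = cf (xmon (mulm n u)) m"
    by (auto simp: cf_psi cf_xmon)
qed

section \<open>Ring homomorphisms and the Newton relation\<close>

unbundle fps_syntax

definition rhom :: "('a::comm_ring_1 \<Rightarrow> 'b::comm_ring_1) \<Rightarrow> bool" where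
  "rhom F \<longleftrightarrow> (\<forall>x y. F (x + y) = F x + F y) \<and> (\<forall>x y. F (x * y) = F x * F y) \<and> F 1 = 1"

lemma rhomI: "(\<And>x y. F (x + y) = F x + F y) \<Longrightarrow> (\<And>x y. F (x * y) = F x * F y) \<Longrightarrow> F 1 = 1 \<Longrightarrow> rhom F"
  by (simp add: rhom_def)

lemma rhom_add: "rhom F \<Longrightarrow> F (x + y) = F x + F y"
  and rhom_mult: "rhom F \<Longrightarrow> F (x * y) = F x * F y"
  and rhom_one: "rhom F \<Longrightarrow> F 1 = 1"
  by (simp_all add: rhom_def)

lemma rhom_zero: "rhom F \<Longrightarrow> F 0 = 0"
  using rhom_add[of F 0 0] by simp

lemma rhom_uminus: "rhom F \<Longrightarrow> F (- x) = - F x"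
  using rhom_add[of F x "- x"] by (simp add: rhom_zero eq_neg_iff_add_eq_0 add.commute)

lemma rhom_diff: "rhom F \<Longrightarrow> F (x - y) = F x - F y"
  using rhom_add[of F x "- y"] by (simp add: rhom_uminus)

lemma rhom_of_nat: "rhom F \<Longrightarrow> F (of_nat n) = of_nat n"
  by (induction n) (simp_all add: rhom_zero rhom_add rhom_one)

lemma rhom_of_int: "rhom F \<Longrightarrow> F (of_int n) = of_int n"
  by (cases n) (simp_all add: rhom_of_nat rhom_diff rhom_uminus rhom_one)

lemma rhom_sum: "rhom F \<Longrightarrow> F (sum f A) = (\<Sum>x\<in>A. F (f x))"
  by (induction A rule: infinite_finite_induct) (simp_all add: rhom_zero rhom_add)

lemma rhom_prod: "rhom F \<Longrightarrow> F (prod f A) = (\<Prod>x\<in>A. F (f x))"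
  by (induction A rule: infinite_finite_induct) (simp_all add: rhom_one rhom_mult)

lemma rhom_power: "rhom F \<Longrightarrow> F (x ^ n) = F x ^ n"
  by (induction n) (simp_all add: rhom_one rhom_mult)

lemmas rhom_simps = rhom_add rhom_mult rhom_one rhom_zero rhom_uminus rhom_diff
  rhom_of_nat rhom_of_int rhom_sum rhom_prod rhom_power

text \<open>In terms of series: \<open>newton a p\<close> is the relation between the coefficients of \<open>\<lambda>\<^bsub>t\<^esub>(r)\<close> and the
  Adams operations \<open>\<psi>\<^bsub>n\<^esub>(r)\<close>.\<close>

definition newton :: "(nat \<Rightarrow> 'a::comm_ring_1) \<Rightarrow> (nat \<Rightarrow> 'a) \<Rightarrow> bool" where
  "newton a p \<longleftrightarrow> (\<forall>n\<ge>1. (\<Sum>k<n. (-1) ^ k * (a k * p (n - k))) + (-1) ^ n * (of_nat n * a n) = 0)"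

lemma newtonD:
  "newton a p \<Longrightarrow> n \<ge> 1 \<Longrightarrow> (\<Sum>k<n. (-1) ^ k * (a k * p (n - k))) + (-1) ^ n * (of_nat n * a n) = 0"
  by (simp add: newton_def)

lemma newton_rhom:
  assumes F: "rhom F" and "newton a p"
  shows "newton (\<lambda>n. F (a n)) (\<lambda>n. F (p n))"
  unfolding newton_def
proof (intro allI impI)
  fix n :: nat assume "1 \<le> n"
  from arg_cong[OF newtonD[OF assms(2) this], of F]
  show "(\<Sum>k<n. (- 1) ^ k * (F (a k) * F (p (n - k)))) + (- 1) ^ n * (of_nat n * F (a n)) = 0"
    by (simp add: rhom_simps[OF F])
qed

text \<open>This is the sum of (-1)^(n-1) p_n t^n over n \<ge> 1, which \<open>newton\<close>
  equates with the logarithmic derivative t a'/a. Index 0 is set to 0 because \<open>newton\<close>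
  never reads \<open>p 0\<close>.\<close>

definition pser :: "(nat \<Rightarrow> 'a::comm_ring_1) \<Rightarrow> 'a fps" where
  "pser p = Abs_fps (\<lambda>n. if n = 0 then 0 else - ((-1) ^ n * p n))"

text \<open>Once the relation says that \<open>p\<close> is a logarithmic derivative, products of
  series add the \<open>p\<close> and inverses negate them.\<close>

lemma newton_iff:
  "newton a p \<longleftrightarrow> fps_X * fps_deriv (Abs_fps a) = Abs_fps a * pser p"
proof -
  have *: "(fps_X * fps_deriv (Abs_fps a)) $ n = of_nat n * a n" for n
    by (cases n) auto
  have **: "(Abs_fps a * pser p) $ n = - ((-1) ^ n * (\<Sum>k<n. (-1) ^ k * (a k * p (n - k))))" for n
  proof -
    have "(Abs_fps a * pser p) $ n = (\<Sum>k<n. a k * (pser p $ (n - k)))"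
      unfolding fps_mult_nth
      by (rule sum.mono_neutral_cong_right) (auto simp: pser_def)
    also have "\<dots> = (\<Sum>k<n. - ((-1) ^ n * ((-1) ^ k * (a k * p (n - k)))))"
    proof (rule sum.cong)
      fix k assume "k \<in> {..<n}"
      then have "k \<le> n" "n - k \<noteq> 0" by auto
      then have "(-1 :: 'a) ^ (n - k) = (-1) ^ n * (-1) ^ k"
        by (metis (no_types, opaque_lifting) left_minus_one_mult_self mult.commute power_add le_add_diff_inverse)
      then show "a k * (pser p $ (n - k)) = - ((-1) ^ n * ((-1) ^ k * (a k * p (n - k))))"
        using \<open>n - k \<noteq> 0\<close> by (simp add: pser_def mult_ac)
    qed simp
    finally show ?thesis by (simp add: sum_negf sum_distrib_left)
  qed
  have ***: "of_nat n * a n = - ((-1) ^ n * S) \<longleftrightarrow> S + (-1) ^ n * (of_nat n * a n) = 0" for n S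
    by (cases "even n") (auto simp: eq_neg_iff_add_eq_0 add.commute neg_eq_iff_add_eq_0)
  have "(fps_X * fps_deriv (Abs_fps a) = Abs_fps a * pser p) \<longleftrightarrow>
    (\<forall>n. (\<Sum>k<n. (-1) ^ k * (a k * p (n - k))) + (-1) ^ n * (of_nat n * a n) = 0)"
    by (simp only: fps_eq_iff * ** ***)
  \<comment> \<open>The instance n = 0, present on one side only, reads 0 = 0.\<close>
  also have "\<dots> \<longleftrightarrow> newton a p"
    unfolding newton_def by (metis (no_types, lifting) One_nat_def add.right_neutral lessThan_0 mult_zero_left mult_zero_right not_less_eq_eq of_nat_0 sum.empty zero_order(2) le0 less_one not_le)
  finally show ?thesis by simp
qed

lemma newton_mult:
  assumes "newton a p" "newton b q"
  shows "newton (\<lambda>n. \<Sum>k=0..n. a k * b (n - k)) (\<lambda>n. p n + q n)"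
proof -
  have [simp]: "Abs_fps (\<lambda>n. \<Sum>k=0..n. a k * b (n - k)) = Abs_fps a * Abs_fps b"
    by (simp add: fps_eq_iff fps_mult_nth)
  have [simp]: "pser (\<lambda>n. p n + q n) = pser p + pser q"
    by (simp add: fps_eq_iff pser_def distrib_left)
  have "fps_X * fps_deriv (Abs_fps a * Abs_fps b) =
    (fps_X * fps_deriv (Abs_fps a)) * Abs_fps b + Abs_fps a * (fps_X * fps_deriv (Abs_fps b))"
    by (simp add: algebra_simps)
  also have "\<dots> = Abs_fps a * Abs_fps b * (pser p + pser q)"
    using assms by (simp add: newton_iff algebra_simps)
  finally show ?thesis by (simp add: newton_iff)
qed

lemma newton_inverse:
  fixes a :: "nat \<Rightarrow> 'a::comm_ring_1"
  assumes "newton a p" "a 0 = 1"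
  shows "\<exists>b. b 0 = 1 \<and> newton b (\<lambda>n. - p n)"
proof -
  define G where "G = fps_right_inverse (Abs_fps a) 1"
  have FG: "Abs_fps a * G = 1"
    unfolding G_def by (rule fps_right_inverse) (simp add: assms)
  have [simp]: "pser (\<lambda>n. - p n) = - pser p"
    by (simp add: fps_eq_iff pser_def)
  \<comment> \<open>Differentiating the product of the series and its inverse gives the relation for
    \<open>G\<close> multiplied by \<open>Abs_fps a\<close>; a further factor \<open>G\<close>
    removes that multiple.\<close>
  have "0 = fps_X * fps_deriv (Abs_fps a * G)" by (simp add: FG)
  also have "\<dots> = fps_X * fps_deriv (Abs_fps a) * G + Abs_fps a * (fps_X * fps_deriv G)"
    by (simp add: algebra_simps)
  also have "\<dots> = pser p * (Abs_fps a * G) + Abs_fps a * (fps_X * fps_deriv G)"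
    using assms(1) by (simp add: newton_iff mult_ac)
  finally have "Abs_fps a * (fps_X * fps_deriv G) = - pser p"
    by (simp add: FG eq_neg_iff_add_eq_0 add.commute)
  then have "(Abs_fps a * G) * (fps_X * fps_deriv G) = G * (- pser p)"
    by (metis mult.assoc mult.commute)
  then have "fps_X * fps_deriv G = G * (- pser p)" by (simp add: FG)
  moreover have "Abs_fps (fps_nth G) = G" by (simp add: fps_nth_inverse)
  moreover have "G $ 0 = 1" by (simp add: G_def)
  ultimately show ?thesis by (intro exI[of _ "fps_nth G"]) (simp add: newton_iff)
qed

lemma newton_unique:
  fixes a b :: "nat \<Rightarrow> 'v mps"
  assumes "newton a p" "newton b p" "a 0 = b 0"
  shows "a n = b n"
proof (induction n rule: less_induct)
  case (less n)
  show ?case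
  proof (cases "n = 0")
    case False
    have "(\<Sum>k<n. (-1) ^ k * (a k * p (n - k))) = (\<Sum>k<n. (-1) ^ k * (b k * p (n - k)))"
      using less by simp
    with newtonD[OF assms(1), of n] newtonD[OF assms(2), of n] False
    have "(-1) ^ n * (of_nat n * a n) = (-1) ^ n * (of_nat n * b n)"
      by (simp add: add_eq_0_iff)
    then have "of_nat n * a n = of_nat n * b n" by (cases "even n") auto
    then show ?thesis using False of_nat_mult_mps_cancel by blast
  qed (use assms in simp)
qed

subsection \<open>The operations on power series\<close>

text \<open>The Newton relation is solved for its last term. Integer \<open>div\<close> makes the
  recursion total on all series; that the division leaves no remainder is established only in
  \<open>newton_lam\<close>.\<close>

function lam :: "nat \<Rightarrow> 'v mps \<Rightarrow> 'v mps" where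
  "lam 0 f = 1"
| "lam (Suc n) f =
     Mps (\<lambda>m. ((-1) ^ n * cf (\<Sum>k<Suc n. (-1) ^ k * (lam k f * psi (Suc n - k) f)) m) div int (Suc n))"
  by pat_completeness auto
termination by (relation "measure fst") auto

text \<open>If some sequence starting with 1 solves the relation, it shows by induction that every
  division in the recursion is exact. Formulas for \<open>lam\<close> are mostly obtained below by
  exhibiting such a solution.\<close>

lemma lam_eqI:
  assumes "a 0 = 1" "newton a (\<lambda>n. psi n f)"
  shows "lam n f = a n"
proof (induction n rule: less_induct)
  case (less n)
  show ?case
  proof (cases n)
    case (Suc k)
    define S where "S = (\<Sum>k<n. (-1) ^ k * (a k * psi (n - k) f))"
    have S: "(\<Sum>k<n. (-1) ^ k * (lam k f * psi (n - k) f)) = S"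
      unfolding S_def by (rule sum.cong) (use less in auto)
    have "S + (-1) ^ n * (of_nat n * a n) = 0"
      unfolding S_def using newtonD[OF assms(2), of n] Suc by simp
    then have "cf (S + (-1) ^ n * (of_nat n * a n)) m = 0" for m by simp
    then have "cf S m + (-1) ^ n * (int n * cf (a n) m) = 0" for m
      by (simp only: cf_add cf_minus_one_power_mult cf_of_nat_mult)
    moreover have "(-1 :: int) ^ n = - ((-1) ^ k)" by (simp add: Suc)
    ultimately have "cf S m = (-1) ^ k * (int n * cf (a n) m)" for m
      by (metis add.commute add_cancel_right_right diff_add_cancel mult_minus_left uminus_add_conv_diff)
    then have *: "(-1) ^ k * cf S m = int n * cf (a n) m" for m by simp
    have "lam n f = Mps (\<lambda>m. ((-1) ^ k * cf S m) div int n)"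
      unfolding Suc lam.simps(2) using S[unfolded Suc] by simp
    also have "\<dots> = a n" unfolding * using Suc by (intro mps_eqI) simp
    finally show ?thesis .
  qed (use assms in simp)
qed

text \<open>The coefficient of \<open>lam n f\<close> at \<open>m\<close> only depends on the finitely many coefficients of \<open>f\<close> at
  divisors of \<open>m\<close>, so exactness of the division reduces to finite sums of monomials.\<close>

definition agree :: "('v \<Rightarrow>\<^sub>0 nat) \<Rightarrow> 'v mps \<Rightarrow> 'v mps \<Rightarrow> bool" where
  "agree m f g \<longleftrightarrow> (\<forall>u. (\<forall>v. lookup u v \<le> lookup m v) \<longrightarrow> cf f u = cf g u)"

lemma agreeD: "agree m f g \<Longrightarrow> (\<And>v. lookup u v \<le> lookup m v) \<Longrightarrow> cf f u = cf g u"
  by (simp add: agree_def)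

lemma agree_mult:
  assumes "agree m f g" "agree m f' g'"
  shows "agree m (f * f') (g * g')"
  unfolding agree_def
proof (intro allI impI)
  fix u assume u: "\<forall>v. lookup u v \<le> lookup m v"
  have "lookup a v \<le> lookup m v" "lookup b v \<le> lookup m v" if "a + b = u" for a b v
    using u[rule_format, of v] that[symmetric] by (auto simp: lookup_add)
  then show "cf (f * f') u = cf (g * g') u"
    unfolding cf_mult using assms by (intro sum.cong) (auto simp: agree_def)
qed

text \<open>Division of exponents by \<open>n\<close> does not increase them, so a divisor of
  \<open>m\<close> is sent to a divisor of \<open>m\<close>.\<close>

lemma agree_psi:
  assumes "agree m f g"
  shows "agree m (psi n f) (psi n g)"
proof -
  have "lookup (divm n u) v \<le> lookup m v" if "\<forall>v. lookup u v \<le> lookup m v" for u v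
    using that[rule_format, of v] by (simp add: div_le_dividend order_trans[OF div_le_dividend])
  then show ?thesis using assms by (auto simp: agree_def cf_psi)
qed

lemma agree_lam: "agree m f g \<Longrightarrow> agree m (lam n f) (lam n g)"
proof (induction n rule: less_induct)
  case (less n)
  show ?case
  proof (cases n)
    case (Suc k)
    have "agree m (lam i f * psi (n - i) f) (lam i g * psi (n - i) g)" if "i < n" for i
      using less that by (intro agree_mult agree_psi) auto
    then have "cf (\<Sum>i<n. (-1) ^ i * (lam i f * psi (n - i) f)) u =
      cf (\<Sum>i<n. (-1) ^ i * (lam i g * psi (n - i) g)) u"
      if "\<forall>v. lookup u v \<le> lookup m v" for u
      unfolding cf_sum cf_minus_one_power_mult using that
      by (intro sum.cong) (auto simp: agree_def)
    then show ?thesis unfolding Suc agree_def lam.simps(2) cf_Mps by simp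
  qed (simp add: agree_def)
qed

lemma psi_1 [simp]: "psi (Suc 0) f = f"
proof (rule mps_eqI)
  fix m :: "'a \<Rightarrow>\<^sub>0 nat"
  have "divm (Suc 0) m = m" by (intro poly_mapping_eqI) simp
  then show "cf (psi (Suc 0) f) m = cf f m" by (simp add: cf_psi)
qed

text \<open>For n \<ge> 2 only k = 0 and k = 1 contribute, namely u^n - u u^(n-1) = 0; so lambda_t
  of a monomial u is 1 + ut.\<close>

lemma newton_xmon:
  "newton (\<lambda>n. if n = 0 then 1 else if n = 1 then xmon u else 0) (\<lambda>n. psi n (xmon u))"
  unfolding newton_def
proof (intro allI impI)
  fix n :: nat assume "1 \<le> n"
  define a :: "nat \<Rightarrow> 'a mps" where "a = (\<lambda>n. if n = 0 then 1 else if n = 1 then xmon u else 0)"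
  have "(\<Sum>k<n. (-1) ^ k * (a k * psi (n - k) (xmon u))) + (-1) ^ n * (of_nat n * a n) = 0"
  proof (cases "n = 1")
    case False
    then obtain k where n: "n = Suc (Suc k)" using \<open>1 \<le> n\<close> by (cases n; cases "n - 1") auto
    show ?thesis unfolding n
      by (simp only: sum.lessThan_Suc_shift) (simp add: a_def psi_xmon)
  qed (simp add: a_def)
  then show "(\<Sum>k<n. (-1) ^ k * ((if k = 0 then 1 else if k = 1 then xmon u else 0) * psi (n - k) (xmon u))) +
      (-1) ^ n * (of_nat n * (if n = 0 then 1 else if n = 1 then xmon u else 0)) = 0"
    unfolding a_def .
qed

lemma newton_solvable_finite:
  fixes f :: "'v mps"
  assumes "finite {m. cf f m \<noteq> 0}"
  shows "\<exists>a. a 0 = 1 \<and> newton a (\<lambda>n. psi n f)"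
proof -
  define E where "E = {f :: 'v mps. \<exists>a. a 0 = 1 \<and> newton a (\<lambda>n. psi n f)}"
  have add: "f + g \<in> E" if "f \<in> E" "g \<in> E" for f g
  proof -
    from that obtain a b where "a 0 = 1" "b 0 = 1" "newton a (\<lambda>n. psi n f)" "newton b (\<lambda>n. psi n g)"
      by (auto simp: E_def)
    then show ?thesis
      unfolding E_def using newton_mult[of a "\<lambda>n. psi n f" b "\<lambda>n. psi n g"]
      by (auto simp: psi_add intro!: exI[of _ "\<lambda>n. \<Sum>k=0..n. a k * b (n - k)"])
  qed
  have uminus: "- f \<in> E" if "f \<in> E" for f
    using that newton_inverse by (fastforce simp: E_def psi_uminus)
  have zero: "0 \<in> E"
  proof -
    have "newton (\<lambda>n. if n = 0 then 1 else 0 :: 'v mps) (\<lambda>n. 0)"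
      by (simp add: newton_def)
    then show ?thesis
      by (auto simp: E_def intro!: exI[of _ "\<lambda>n. if n = 0 then 1 else 0"])
  qed
  have mon: "xmon u \<in> E" for u
    using newton_xmon[of u] unfolding E_def
    by (auto intro!: exI[of _ "\<lambda>n. if n = 0 then 1 else if n = 1 then xmon u else 0"])
  have nat: "of_nat k * f \<in> E" if "f \<in> E" for k f
    by (induction k) (use zero add that in \<open>auto simp: distrib_right\<close>)
  have int: "of_int k * f \<in> E" if "f \<in> E" for k f
    by (cases k rule: int_cases2) (use nat uminus that in auto)
  have "(\<Sum>u\<in>A. of_int (cf f u) * xmon u) \<in> E" if "finite A" for A
    using that by (induction A rule: finite_induct) (use zero add int mon in auto)
  moreover have "(\<Sum>u\<in>{m. cf f m \<noteq> 0}. of_int (cf f u) * xmon u) = f"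
    using assms by (intro mps_eqI) (auto simp: cf_xmon if_distrib[of "(*) _"] cong: if_cong)
  ultimately show ?thesis using assms unfolding E_def by fastforce
qed

theorem newton_lam: "newton (\<lambda>n. lam n f) (\<lambda>n. psi n f)"
proof -
  have "cf ((\<Sum>k<n. (-1) ^ k * (lam k f * psi (n - k) f)) + (-1) ^ n * (of_nat n * lam n f)) m = 0"
    if "n \<ge> 1" for n m
  proof -
    \<comment> \<open>\<open>g\<close> keeps the finitely many terms of \<open>f\<close> whose
      monomials divide \<open>m\<close>, so that the finite case applies and nothing changes at
      \<open>m\<close>.\<close>
    define g where "g = Mps (\<lambda>u. if \<forall>v. lookup u v \<le> lookup m v then cf f u else 0)"
    have "finite {u. cf g u \<noteq> 0}"
      by (rule finite_subset[OF _ finite_lookup_le[of m]]) (auto simp: g_def split: if_splits)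
    then obtain a where a: "a 0 = 1" "newton a (\<lambda>n. psi n g)"
      using newton_solvable_finite by blast
    then have "newton (\<lambda>n. lam n g) (\<lambda>n. psi n g)"
      using lam_eqI[OF a] by simp
    then have "cf ((\<Sum>k<n. (-1) ^ k * (lam k g * psi (n - k) g)) + (-1) ^ n * (of_nat n * lam n g)) m = 0"
      using newtonD[OF _ that, of "\<lambda>n. lam n g" "\<lambda>n. psi n g"] by simp
    moreover have ag: "agree m f g" by (simp add: agree_def g_def)
    have "cf (lam k f * psi (n - k) f) m = cf (lam k g * psi (n - k) g) m" for k
      by (rule agreeD[OF agree_mult[OF agree_lam[OF ag] agree_psi[OF ag]]]) simp
    moreover have "cf (lam n f) m = cf (lam n g) m"
      by (rule agreeD[OF agree_lam[OF ag]]) simp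
    ultimately show ?thesis by (simp only: cf_add cf_sum cf_minus_one_power_mult cf_of_nat_mult)
  qed
  then show ?thesis unfolding newton_def by (intro allI impI mps_eqI) (simp only: cf_zero)
qed

lemma lam_1 [simp]: "lam (Suc 0) f = f"
  using newtonD[OF newton_lam[of f], of 1] by simp

lemma lam_add: "lam n (f + g) = (\<Sum>k=0..n. lam k f * lam (n - k) g)"
  by (rule lam_eqI) (use newton_mult[OF newton_lam newton_lam, of f g] in \<open>simp_all add: psi_add\<close>)

text \<open>\<open>F\<close> turns the solution for \<open>f\<close> into one for
  \<open>F f\<close>. This is applied to two kinds of endomorphism, restriction to some of the
  variables and permutation of the variables.\<close>

lemma lam_rhom:
  assumes "rhom F" "\<And>n. n \<ge> 1 \<Longrightarrow> F (psi n f) = psi n (F f)"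
  shows "lam n (F f) = F (lam n f)"
proof (rule lam_eqI)
  show "newton (\<lambda>n. F (lam n f)) (\<lambda>n. psi n (F f))"
    using newton_rhom[OF assms(1) newton_lam[of f]] assms(2) by (simp add: newton_def)
qed (simp add: rhom_one assms)

subsection \<open>Evaluation of integer polynomials\<close>

type_synonym 'v zp = "('v \<Rightarrow>\<^sub>0 nat) \<Rightarrow>\<^sub>0 int"

definition mev :: "('v \<Rightarrow> 'a::comm_ring_1) \<Rightarrow> ('v \<Rightarrow>\<^sub>0 nat) \<Rightarrow> 'a" where
  "mev \<sigma> u = (\<Prod>v\<in>keys u. \<sigma> v ^ lookup u v)"

definition pev :: "('v \<Rightarrow> 'a::comm_ring_1) \<Rightarrow> 'v zp \<Rightarrow> 'a" where
  "pev \<sigma> p = (\<Sum>u\<in>keys p. of_int (lookup p u) * mev \<sigma> u)"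

definition Var :: "'v \<Rightarrow> 'v zp" where
  "Var v = single (single v 1) 1"

lemma sum_single: "(\<Sum>u\<in>keys p. single u (lookup p u)) = p"
  by (intro poly_mapping_eqI) (auto simp: lookup_sum lookup_single when_def in_keys_iff)

lemma zp_induct [case_names single add]:
  assumes "\<And>u c. P (single u c)" "\<And>p q. P p \<Longrightarrow> P q \<Longrightarrow> P (p + q)"
  shows "P (p :: 'v zp)"
proof -
  have "P (\<Sum>u\<in>A. single u (lookup p u))" if "finite A" for A
    using that by (induction A rule: finite_induct) (use assms assms(1)[of _ 0] in auto)
  from this[OF finite_keys[of p]] show ?thesis by (simp add: sum_single)
qed

lemma mev_superset:
  "finite A \<Longrightarrow> keys u \<subseteq> A \<Longrightarrow> mev \<sigma> u = (\<Prod>v\<in>A. \<sigma> v ^ lookup u v)"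
  unfolding mev_def by (rule prod.mono_neutral_left) (auto simp: in_keys_iff)

lemma pev_superset:
  "finite A \<Longrightarrow> keys p \<subseteq> A \<Longrightarrow> pev \<sigma> p = (\<Sum>u\<in>A. of_int (lookup p u) * mev \<sigma> u)"
  unfolding pev_def by (rule sum.mono_neutral_left) (auto simp: in_keys_iff)

lemma mev_zero [simp]: "mev \<sigma> 0 = 1"
  by (simp add: mev_def)

lemma mev_add: "mev \<sigma> (u + w) = mev \<sigma> u * mev \<sigma> w"
  by (subst (1 2 3) mev_superset[of "keys u \<union> keys w"])
     (auto simp: keys_add_nat lookup_add power_add prod.distrib)

lemma mev_single: "mev \<sigma> (single v n) = \<sigma> v ^ n"
  by (subst mev_superset[of "{v}"]) auto

lemma mev_cong: "(\<And>v. v \<in> keys u \<Longrightarrow> \<sigma> v = \<tau> v) \<Longrightarrow> mev \<sigma> u = mev \<tau> u"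
  by (simp add: mev_def)

lemma mev_rhom:
  assumes "rhom F"
  shows "F (mev \<sigma> u) = mev (\<lambda>v. F (\<sigma> v)) u"
  by (simp add: mev_def rhom_simps[OF assms])

lemma pev_single [simp]: "pev \<sigma> (single u c) = of_int c * mev \<sigma> u"
  by (subst pev_superset[of "{u}"]) auto

lemma pev_add: "pev \<sigma> (p + q) = pev \<sigma> p + pev \<sigma> q"
proof -
  have "keys (p + q) \<subseteq> keys p \<union> keys q" by (rule Poly_Mapping.keys_add)
  then show ?thesis
    by (subst (1 2 3) pev_superset[of "keys p \<union> keys q"])
       (auto simp: lookup_add distrib_right sum.distrib)
qed

lemma rhom_pev: "rhom (pev \<sigma>)"
proof (rule rhomI)
  show "pev \<sigma> (p * q) = pev \<sigma> p * pev \<sigma> q" for p q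
  proof (induction p rule: zp_induct)
    case (single u c)
    show ?case
      by (induction q rule: zp_induct)
         (auto simp: mult_single mev_add pev_add algebra_simps)
  qed (simp add: distrib_right pev_add)
  show "pev \<sigma> 1 = 1"
    by (simp flip: single_one)
qed (rule pev_add)

lemma pev_Var [simp]: "pev \<sigma> (Var v) = \<sigma> v"
  by (simp add: Var_def mev_single)

lemma mulm_0 [simp]: "mulm 0 u = 0"
  by (intro poly_mapping_eqI) simp

lemma sum_mulm_single: "(\<Sum>v\<in>keys u. mulm (lookup u v) (single v 1)) = u"
  by (intro poly_mapping_eqI)
     (simp add: lookup_sum lookup_single when_def in_keys_iff if_distrib[of "(*) _"] cong: if_cong)

lemma single_power: "single u 1 ^ n = (single (mulm n u) 1 :: 'v zp)"
proof (induction n)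
  case (Suc n)
  have "u + mulm n u = mulm (Suc n) u" by (intro poly_mapping_eqI) (simp add: lookup_add)
  then show ?case by (simp add: Suc mult_single)
qed simp

lemma mev_Var: "mev Var u = single u 1"
proof -
  have "(\<Prod>v\<in>A. single (f v) 1) = (single (\<Sum>v\<in>A. f v) 1 :: 'v zp)" if "finite A" for A and f :: "'v \<Rightarrow> _"
    using that by (induction A rule: finite_induct) (auto simp: mult_single)
  from this[OF finite_keys[of u], of "\<lambda>v. mulm (lookup u v) (single v 1)"] show ?thesis
    unfolding mev_def Var_def single_power sum_mulm_single .
qed

lemma of_int_zp: "of_int c * single u 1 = (single u c :: 'v zp)"
  by (simp flip: single_of_int add: mult_single)

lemma rhom_eq_pev:
  assumes "rhom F"
  shows "F p = pev (\<lambda>v. F (Var v)) p"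
proof (induction p rule: zp_induct)
  case (single u c)
  have "F (single u c) = F (of_int c * mev Var u)"
    by (simp only: mev_Var of_int_zp)
  also have "\<dots> = of_int c * F (mev Var u)"
    by (simp only: rhom_mult[OF assms] rhom_of_int[OF assms])
  finally have "F (single u c) = of_int c * F (mev Var u)" .
  then show ?case by (simp add: mev_rhom[OF assms])
qed (simp add: pev_add rhom_add[OF assms])

lemma rhom_pev_comp:
  assumes "rhom F"
  shows "F (pev \<sigma> p) = pev (\<lambda>v. F (\<sigma> v)) p"
  by (simp add: pev_def rhom_simps[OF assms] mev_rhom[OF assms])

lemma pev_cong: "(\<And>u v. u \<in> keys p \<Longrightarrow> v \<in> keys u \<Longrightarrow> \<sigma> v = \<tau> v) \<Longrightarrow> pev \<sigma> p = pev \<tau> p"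
  unfolding pev_def by (intro sum.cong refl arg_cong2[of _ _ _ _ "(*)"] mev_cong) auto

text \<open>The inclusion of polynomials into series. Its injectivity brings identities between
  truncated series back to polynomials, which can be evaluated at integer points.\<close>

definition iota :: "'v zp \<Rightarrow> 'v mps" where
  "iota = pev (\<lambda>v. xmon (single v 1))"

lemma mev_xmon: "mev (\<lambda>v. xmon (single v 1)) u = xmon u"
proof -
  have "(\<Prod>v\<in>A. xmon (f v)) = xmon (\<Sum>v\<in>A. f v)" if "finite A" for A and f :: "'v \<Rightarrow> _"
    using that by (induction A rule: finite_induct) (auto simp: xmon_mult)
  from this[OF finite_keys[of u], of "\<lambda>v. mulm (lookup u v) (single v 1)"] show ?thesis
    unfolding mev_def xmon_power sum_mulm_single .
qed

lemma rhom_iota: "rhom iota"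
  unfolding iota_def by (rule rhom_pev)

lemma cf_iota: "cf (iota p) m = lookup p m"
proof -
  have "cf (iota p) m = (\<Sum>u\<in>keys p. lookup p u * (if m = u then 1 else 0))"
    unfolding iota_def pev_def mev_xmon by (simp add: cf_xmon)
  also have "\<dots> = lookup p m"
    by (auto simp: if_distrib[of "(*) _"] in_keys_iff cong: if_cong)
  finally show ?thesis .
qed

subsection \<open>Operations on finite sums of monomials\<close>

text \<open>\<open>esym\<close> with values in any commutative ring, because elementary symmetric
  functions are taken of monomials, inside rings of series and of polynomials, before integers are
  substituted.\<close>

definition gesym :: "nat \<Rightarrow> 'i set \<Rightarrow> ('i \<Rightarrow> 'a::comm_ring_1) \<Rightarrow> 'a" where
  "gesym n I f = (\<Sum>S\<in>{S. S \<subseteq> I \<and> card S = n}. \<Prod>i\<in>S. f i)"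

lemma gesym_0: "finite I \<Longrightarrow> gesym 0 I f = 1"
proof -
  assume "finite I"
  then have "{S. S \<subseteq> I \<and> card S = 0} = {{}}" by (auto dest: finite_subset)
  then show ?thesis by (simp add: gesym_def)
qed

lemma gesym_Suc_empty: "gesym (Suc n) {} f = 0"
  unfolding gesym_def by (rule sum.neutral) auto

text \<open>Subsets are split by whether they contain \<open>i\<close>; on generating series this is
  multiplication by 1 + f_i t.\<close>

lemma gesym_Suc_insert:
  assumes "finite I" "i \<notin> I"
  shows "gesym (Suc n) (insert i I) f = gesym (Suc n) I f + f i * gesym n I f"
proof -
  let ?A = "{S. S \<subseteq> I \<and> card S = Suc n}" and ?B = "{S. S \<subseteq> I \<and> card S = n}"
  have fin: "finite ?A" "finite ?B" using assms by auto
  have "{S. S \<subseteq> insert i I \<and> card S = Suc n} = ?A \<union> insert i ` ?B"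
  proof (intro subset_antisym subsetI)
    fix S assume "S \<in> {S. S \<subseteq> insert i I \<and> card S = Suc n}"
    then have S: "S \<subseteq> insert i I" "card S = Suc n" by auto
    show "S \<in> ?A \<union> insert i ` ?B"
    proof (cases "i \<in> S")
      case True
      then have "S = insert i (S - {i})" "S - {i} \<subseteq> I" "card (S - {i}) = n" using S by auto
      then show ?thesis by blast
    qed (use S in auto)
  next
    fix S assume "S \<in> ?A \<union> insert i ` ?B"
    moreover have "card (insert i T) = Suc (card T)" if "T \<subseteq> I" for T
      using that assms finite_subset by (metis card_insert_disjoint subsetD)
    ultimately show "S \<in> {S. S \<subseteq> insert i I \<and> card S = Suc n}" by auto
  qed
  moreover have "?A \<inter> insert i ` ?B = {}" using assms(2) by auto
  moreover have "inj_on (insert i) ?B" using assms(2) by (auto simp: inj_on_def)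
  moreover have "(\<Prod>j\<in>insert i S. f j) = f i * (\<Prod>j\<in>S. f j)" if "S \<in> ?B" for S
    using that assms by (subst prod.insert) (auto dest: finite_subset)
  ultimately show ?thesis
    unfolding gesym_def using fin
    by (simp add: sum.union_disjoint sum.reindex sum_distrib_left)
qed

lemma gesym_rhom:
  assumes "rhom F"
  shows "F (gesym n I f) = gesym n I (\<lambda>i. F (f i))"
  by (simp add: gesym_def rhom_simps[OF assms])

lemma gesym_cong: "(\<And>i. i \<in> I \<Longrightarrow> f i = g i) \<Longrightarrow> gesym n I f = gesym n I g"
  unfolding gesym_def by (intro sum.cong prod.cong refl) auto

lemma gesym_reindex:
  assumes "inj_on h I"
  shows "gesym n (h ` I) f = gesym n I (\<lambda>i. f (h i))"
proof -
  have card: "card (h ` S) = card S" if "S \<subseteq> I" for S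
    using that assms by (meson card_image inj_on_subset)
  have "{T. T \<subseteq> h ` I \<and> card T = n} = (`) h ` {S. S \<subseteq> I \<and> card S = n}"
  proof (intro subset_antisym subsetI)
    fix T assume "T \<in> {T. T \<subseteq> h ` I \<and> card T = n}"
    moreover then obtain S where "S \<subseteq> I" "T = h ` S" by (auto simp: subset_image_iff)
    ultimately show "T \<in> (`) h ` {S. S \<subseteq> I \<and> card S = n}" using card by auto
  qed (use card in auto)
  moreover have "inj_on ((`) h) {S. S \<subseteq> I \<and> card S = n}"
    using inj_on_image_Pow[OF assms] by (rule inj_on_subset) auto
  moreover have "(\<Prod>i\<in>h ` S. f i) = (\<Prod>i\<in>S. f (h i))" if "S \<subseteq> I" for S
    using inj_on_subset[OF assms that] by (simp add: prod.reindex)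
  ultimately show ?thesis
    unfolding gesym_def by (simp add: sum.reindex)
qed

lemma esym_eq_gesym: "esym n I f = gesym n I f"
  by (simp add: esym_def gesym_def)

lemma lam_zero: "lam (Suc n) 0 = 0"
proof -
  have "lam (Suc n) 0 = (\<lambda>n. if n = 0 then 1 else 0) (Suc n)"
    by (rule lam_eqI) (auto simp: newton_def)
  then show ?thesis by simp
qed

lemma lam_xmon_Suc_Suc: "lam (Suc (Suc n)) (xmon u) = 0"
  by (subst lam_eqI[OF _ newton_xmon]) simp_all

lemma lam_add_xmon: "lam (Suc n) (xmon u + f) = lam (Suc n) f + xmon u * lam n f"
proof -
  have "lam (Suc n) (xmon u + f) = (\<Sum>k\<le>Suc n. lam k (xmon u) * lam (Suc n - k) f)"
    unfolding lam_add by (simp add: atLeast0AtMost)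
  also have "\<dots> = (\<Sum>k\<in>{0, 1}. lam k (xmon u) * lam (Suc n - k) f)"
  proof (rule sum.mono_neutral_right)
    show "\<forall>k\<in>{..Suc n} - {0, 1}. lam k (xmon u) * lam (Suc n - k) f = 0"
    proof
      fix k assume "k \<in> {..Suc n} - {0, 1}"
      then obtain j where "k = Suc (Suc j)" by (cases k; cases "k - 1") auto
      then show "lam k (xmon u) * lam (Suc n - k) f = 0" by (simp only: lam_xmon_Suc_Suc mult_zero_left)
    qed
  qed auto
  also have "\<dots> = lam (Suc n) f + xmon u * lam n f"
    by (simp del: lam.simps(2))
  finally show ?thesis .
qed

text \<open>Adding a monomial u multiplies lambda_t by 1 + ut, which is the recursion that builds up
  the elementary symmetric functions.\<close>

lemma lam_sum_xmon:
  assumes "finite I"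
  shows "lam n (\<Sum>i\<in>I. xmon (u i)) = gesym n I (\<lambda>i. xmon (u i))"
  using assms
proof (induction I arbitrary: n rule: finite_induct)
  case empty
  show ?case by (cases n) (simp_all add: gesym_0 gesym_Suc_empty lam_zero del: lam.simps(2))
next
  case (insert i I)
  show ?case
  proof (cases n)
    case 0
    then show ?thesis using insert by (simp add: gesym_0)
  next
    case (Suc k)
    then show ?thesis using insert
      by (simp add: gesym_Suc_insert lam_add_xmon del: lam.simps(2))
  qed
qed

subsection \<open>Endomorphisms commuting with the Adams operations\<close>

text \<open>All variables outside \<open>V\<close> are set to zero. For finite \<open>V\<close> this
  turns the infinite sum \<open>MM i\<close> into a finite one, and since it commutes with
  \<open>lam\<close>, coefficients can be computed there.\<close>

definition resv :: "'v set \<Rightarrow> 'v mps \<Rightarrow> 'v mps" where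
  "resv V f = Mps (\<lambda>m. if keys m \<subseteq> V then cf f m else 0)"

lemma cf_resv: "cf (resv V f) m = (if keys m \<subseteq> V then cf f m else 0)"
  by (simp add: resv_def)

lemma rhom_resv: "rhom (resv V)"
proof (rule rhomI)
  show "resv V (f * g) = resv V f * resv V g" for f g
  proof (rule mps_eqI)
    fix m
    show "cf (resv V (f * g)) m = cf (resv V f * resv V g) m"
    proof (cases "keys m \<subseteq> V")
      case True
      have "(\<Sum>(a, b)\<in>decomp m. cf f a * cf g b) =
          (\<Sum>(a, b)\<in>decomp m. cf (resv V f) a * cf (resv V g) b)"
      proof (rule sum.cong, simp, clarify)
        fix a b assume "(a, b) \<in> decomp m"
        then have "keys a \<subseteq> V" "keys b \<subseteq> V" using True by (auto simp: keys_add_nat)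
        then show "cf f a * cf g b = cf (resv V f) a * cf (resv V g) b" by (simp only: cf_resv if_True)
      qed
      then show ?thesis using True by (simp add: cf_resv cf_mult)
    next
      case False
      have "(\<Sum>(a, b)\<in>decomp m. cf (resv V f) a * cf (resv V g) b) = 0"
      proof (rule sum.neutral, clarify)
        fix a b assume "(a, b) \<in> decomp m"
        then have "\<not> keys a \<subseteq> V \<or> \<not> keys b \<subseteq> V" using False by (auto simp: keys_add_nat)
        then show "cf (resv V f) a * cf (resv V g) b = 0" by (elim disjE) (simp_all only: cf_resv if_False mult_zero_left mult_zero_right)
      qed
      then show ?thesis using False by (simp add: cf_resv cf_mult)
    qed
  qed
qed (auto intro!: mps_eqI simp: cf_resv cf_one)

lemma psi_resv:
  assumes "n \<ge> 1"
  shows "resv V (psi n f) = psi n (resv V f)"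
proof (rule mps_eqI)
  fix m :: "'a \<Rightarrow>\<^sub>0 nat"
  have "keys (divm n m) = keys m" if "\<forall>v. n dvd lookup m v"
    using that assms by (auto simp: in_keys_iff dvd_div_eq_0_iff)
  then show "cf (resv V (psi n f)) m = cf (psi n (resv V f)) m"
    by (auto simp: cf_resv cf_psi)
qed

lemma lam_resv: "lam n (resv V f) = resv V (lam n f)"
  by (rule lam_rhom[OF rhom_resv psi_resv])

text \<open>Exponents are precomposed with \<pi>, the same convention as in
  \<open>mono_perm\<close>.\<close>

definition permv :: "('v \<Rightarrow> 'v) \<Rightarrow> 'v mps \<Rightarrow> 'v mps" where
  "permv \<pi> f = Mps (\<lambda>m. cf f (map_key \<pi> m))"

lemma cf_permv: "cf (permv \<pi> f) m = cf f (map_key \<pi> m)"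
  by (simp add: permv_def)

lemma lookup_map_key: "inj \<pi> \<Longrightarrow> lookup (map_key \<pi> m) v = lookup m (\<pi> v)"
  by (simp add: map_key.rep_eq)

lemma map_key_inv:
  assumes "bij \<pi>"
  shows "map_key \<pi> (map_key (inv_into UNIV \<pi>) m) = m"
    and "map_key (inv_into UNIV \<pi>) (map_key \<pi> m) = m"
  using assms bij_imp_bij_inv[OF assms]
  by (auto intro!: poly_mapping_eqI simp: lookup_map_key bij_is_inj inv_f_f bij_is_surj surj_f_inv_f)

lemma rhom_permv:
  assumes "bij \<pi>"
  shows "rhom (permv \<pi>)"
proof (rule rhomI)
  note inj = bij_is_inj[OF assms] bij_is_inj[OF bij_imp_bij_inv[OF assms]]
  show "permv \<pi> (f * g) = permv \<pi> f * permv \<pi> g" for f g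
  proof (rule mps_eqI)
    fix m
    show "cf (permv \<pi> (f * g)) m = cf (permv \<pi> f * permv \<pi> g) m"
      unfolding cf_mult cf_permv
      by (rule sum.reindex_bij_witness
          [where j = "\<lambda>(a, b). (map_key (inv_into UNIV \<pi>) a, map_key (inv_into UNIV \<pi>) b)"
             and i = "\<lambda>(a, b). (map_key \<pi> a, map_key \<pi> b)"])
         (auto simp: map_key_inv[OF assms] simp flip: map_key_plus[OF inj(1)] map_key_plus[OF inj(2)])
  qed
  have "map_key \<pi> m = 0 \<longleftrightarrow> m = 0" for m :: "'a \<Rightarrow>\<^sub>0 nat"
    using map_key_inv(2)[OF assms, of m] map_key_zero[OF inj(1)] map_key_zero[OF inj(2)] by metis
  then show "permv \<pi> 1 = 1" by (intro mps_eqI) (simp add: cf_permv cf_one)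
qed (auto intro!: mps_eqI simp: cf_permv)

lemma psi_permv:
  assumes "bij \<pi>"
  shows "permv \<pi> (psi n f) = psi n (permv \<pi> f)"
proof (rule mps_eqI)
  fix m :: "'a \<Rightarrow>\<^sub>0 nat"
  note inj = bij_is_inj[OF assms]
  have "divm n (map_key \<pi> m) = map_key \<pi> (divm n m)"
    by (intro poly_mapping_eqI) (simp add: lookup_map_key inj)
  moreover have "(\<forall>v. n dvd lookup m (\<pi> v)) \<longleftrightarrow> (\<forall>v. n dvd lookup m v)"
    by (metis assms bij_pointE)
  ultimately show "cf (permv \<pi> (psi n f)) m = cf (psi n (permv \<pi> f)) m"
    by (simp add: cf_permv cf_psi lookup_map_key inj)
qed

lemma lam_permv: "bij \<pi> \<Longrightarrow> lam n (permv \<pi> f) = permv \<pi> (lam n f)"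
  by (rule lam_rhom[OF rhom_permv psi_permv])

declare lam.simps(2) [simp del]

subsection \<open>Weights of monomials\<close>

text \<open>One additive weight serves for total degree (\<open>wdeg\<close>), for the degree in
  each row of variables (\<open>rdeg\<close>) and for the sum of column indices
  (\<open>cwt\<close>).\<close>

definition wt :: "('v \<Rightarrow> nat) \<Rightarrow> ('v \<Rightarrow>\<^sub>0 nat) \<Rightarrow> nat" where
  "wt w m = (\<Sum>p\<in>keys m. w p * lookup m p)"

lemma wt_superset: "finite A \<Longrightarrow> keys m \<subseteq> A \<Longrightarrow> wt w m = (\<Sum>p\<in>A. w p * lookup m p)"
  unfolding wt_def by (rule sum.mono_neutral_left) (auto simp: in_keys_iff)

lemma wt_zero [simp]: "wt w 0 = 0"
  by (simp add: wt_def)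

lemma wt_add: "wt w (a + b) = wt w a + wt w b"
  by (subst (1 2 3) wt_superset[of "keys a \<union> keys b"])
     (auto simp: keys_add_nat lookup_add distrib_left sum.distrib)

lemma wt_single [simp]: "wt w (single v n) = w v * n"
  by (subst wt_superset[of "{v}"]) auto

lemma wt_sum: "wt w (sum f A) = (\<Sum>x\<in>A. wt w (f x))"
  by (induction A rule: infinite_finite_induct) (auto simp: wt_add)

lemma supp_mult:
  assumes "cf (f * g) m \<noteq> 0"
  obtains a b where "m = a + b" "cf f a \<noteq> 0" "cf g b \<noteq> 0"
proof -
  obtain p where "p \<in> decomp m" "(case p of (a, b) \<Rightarrow> cf f a * cf g b) \<noteq> 0"
    using assms unfolding cf_mult by (metis (no_types, lifting) sum.neutral)
  then show thesis using that by (cases p) auto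
qed

lemma supp_psi:
  assumes "cf (psi n f) m \<noteq> 0" "n \<ge> 1"
  obtains u where "m = mulm n u" "cf f u \<noteq> 0"
proof (rule that)
  show "m = mulm n (divm n m)"
    using assms by (intro poly_mapping_eqI) (auto simp: cf_psi split: if_splits)
  show "cf f (divm n m) \<noteq> 0"
    using assms by (auto simp: cf_psi split: if_splits)
qed

lemma mulm_Suc: "mulm (Suc n) u = u + mulm n u"
  by (intro poly_mapping_eqI) (simp add: lookup_add)

text \<open>Every term \<open>lam i f * psi (n - i) f\<close> of the recursion has order n in
  \<open>f\<close>, an Adams operation counting with its index. \<open>A\<close> abstracts what is
  additive in this order; homogeneity and degree bounds are the instances.\<close>

lemma supp_lam:
  assumes zero: "0 \<in> A 0" and add: "\<And>i j a b. a \<in> A i \<Longrightarrow> b \<in> A j \<Longrightarrow> a + b \<in> A (i + j)"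
    and f: "\<And>m. cf f m \<noteq> 0 \<Longrightarrow> m \<in> A 1"
    and "cf (lam n f) m \<noteq> 0"
  shows "m \<in> A n"
  using assms(4)
proof (induction n arbitrary: m rule: less_induct)
  case (less n)
  show ?case
  proof (cases n)
    case 0
    then show ?thesis using less.prems zero by (auto simp: cf_one split: if_splits)
  next
    case (Suc k)
    have "cf (\<Sum>i<Suc k. (-1) ^ i * (lam i f * psi (Suc k - i) f)) m \<noteq> 0"
      using less.prems unfolding Suc lam.simps(2) by (auto simp del: cf_sum)
    then obtain i where i: "i < n" "cf (lam i f * psi (n - i) f) m \<noteq> 0"
      unfolding cf_sum cf_minus_one_power_mult Suc
      by (metis (no_types, lifting) lessThan_iff mult_zero_right sum.neutral)
    obtain a b where ab: "m = a + b" "cf (lam i f) a \<noteq> 0" "cf (psi (n - i) f) b \<noteq> 0"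
      using i(2) by (rule supp_mult)
    obtain u where u: "b = mulm (n - i) u" "cf f u \<noteq> 0"
      using ab(3) by (rule supp_psi) (use i in auto)
    have "mulm j u \<in> A j" for j
    proof (induction j)
      case (Suc j)
      then show ?case using add[OF f[OF u(2)] Suc] by (simp add: mulm_Suc)
    qed (simp add: zero)
    then have "a + b \<in> A (i + (n - i))"
      using add less.IH[OF i(1) ab(2)] u(1) by blast
    then show ?thesis using i ab by simp
  qed
qed

lemma supp_lam_wt:
  assumes "\<And>m. cf f m \<noteq> 0 \<Longrightarrow> wt w m = d" "cf (lam n f) m \<noteq> 0"
  shows "wt w m = n * d"
  using supp_lam[of "\<lambda>n. {m. wt w m = n * d}" f n m] assms by (auto simp: wt_add distrib_right)

lemma supp_lam_wt_le:
  assumes "\<And>m. cf f m \<noteq> 0 \<Longrightarrow> wt w m \<le> d" "cf (lam n f) m \<noteq> 0"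
  shows "wt w m \<le> n * d"
  using supp_lam[of "\<lambda>n. {m. wt w m \<le> n * d}" f n m] assms by (auto simp: wt_add distrib_right)

subsection \<open>Elementary symmetric functions\<close>

type_synonym idx = "nat \<times> nat"

text \<open>Rows and columns are numbered from 0: \<open>MM i\<close> stands for M_(i+1), and
  \<open>ee (i, k)\<close> below for lambda_(k+1)(M_(i+1)), so that no index denotes the constant
  lambda_0 = 1.\<close>

definition MM :: "nat \<Rightarrow> idx mps" where
  "MM i = Mps (\<lambda>m. if \<exists>j. m = single (i, j) 1 then 1 else 0)"

definition ee :: "idx \<Rightarrow> idx mps" where
  "ee p = lam (Suc (snd p)) (MM (fst p))"

definition sq :: "nat \<Rightarrow> nat set \<Rightarrow> idx \<Rightarrow>\<^sub>0 nat" where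
  "sq i S = (\<Sum>j\<in>S. single (i, j) 1)"

lemma cf_MM: "cf (MM i) m = (if \<exists>j. m = single (i, j) 1 then 1 else 0)"
  by (simp add: MM_def)

lemma lookup_sq: "finite S \<Longrightarrow> lookup (sq i S) p = (if fst p = i \<and> snd p \<in> S then 1 else 0)"
  by (cases p) (auto simp: sq_def lookup_sum lookup_single when_def)

lemma sq_inj: "finite S \<Longrightarrow> finite T \<Longrightarrow> sq i S = sq i T \<Longrightarrow> S = T"
proof (rule Set.set_eqI)
  fix x assume "finite S" "finite T" "sq i S = sq i T"
  then have "lookup (sq i S) (i, x) = lookup (sq i T) (i, x)" by simp
  then have "(if x \<in> S then 1 else 0 :: nat) = (if x \<in> T then 1 else 0)"
    using \<open>finite S\<close> \<open>finite T\<close> by (simp only: lookup_sq fst_conv snd_conv simp_thms)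
  then show "x \<in> S \<longleftrightarrow> x \<in> T" by (cases "x \<in> S"; cases "x \<in> T") simp_all
qed

lemma single_nat_eq_iff: "single a (1::nat) = single b 1 \<longleftrightarrow> a = b"
proof
  assume "single a (1::nat) = single b 1"
  then have "lookup (single a (1::nat)) a = lookup (single b 1) a" by (rule arg_cong)
  then show "a = b" by (simp add: lookup_single when_def split: if_splits)
qed simp

lemma finite_section: "finite V \<Longrightarrow> finite {j. (i, j) \<in> V}"
  by (rule finite_subset[of _ "snd ` V"]) force+

lemma resv_MM:
  assumes "finite V"
  shows "resv V (MM i) = (\<Sum>j\<in>{j. (i, j) \<in> V}. xmon (single (i, j) 1))"
proof (rule mps_eqI)
  fix m
  have fin: "finite {j. (i, j) \<in> V}"
    using assms by (rule finite_section)
  show "cf (resv V (MM i)) m = cf (\<Sum>j\<in>{j. (i, j) \<in> V}. xmon (single (i, j) 1)) m"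
  proof (cases "\<exists>j. m = single (i, j) 1")
    case True
    then obtain j where m: "m = single (i, j) 1" by blast
    have "cf (\<Sum>j\<in>{j. (i, j) \<in> V}. xmon (single (i, j) 1)) m = (if (i, j) \<in> V then 1 else 0)"
      using fin by (simp add: m cf_xmon single_nat_eq_iff[simplified])
    then show ?thesis by (auto simp: cf_resv cf_MM m)
  next
    case False
    then have "cf (\<Sum>j\<in>{j. (i, j) \<in> V}. xmon (single (i, j) 1)) m = 0"
      by (simp add: cf_xmon)
    then show ?thesis using False by (simp add: cf_resv cf_MM)
  qed
qed

lemma prod_xmon_sq: "finite S \<Longrightarrow> (\<Prod>j\<in>S. xmon (single (i, j) 1)) = xmon (sq i S)"
  unfolding sq_def by (induction S rule: finite_induct) (auto simp: xmon_mult)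

lemma resv_ee:
  assumes "finite V"
  shows "resv V (lam n (MM i)) = gesym n {j. (i, j) \<in> V} (\<lambda>j. xmon (single (i, j) 1))"
proof -
  have fin: "finite {j. (i, j) \<in> V}"
    using assms by (rule finite_section)
  show ?thesis
    by (simp only: lam_resv[symmetric] resv_MM[OF assms] lam_sum_xmon[OF fin])
qed

text \<open>Only the variables occurring in \<open>m\<close> matter for its coefficient, and after
  restriction to them lambda_n is the n-th elementary symmetric polynomial of one row. Its
  squarefree monomials \<open>sq i S\<close> are distinct, whence the coefficient 1.\<close>

lemma cf_lam_MM:
  "cf (lam n (MM i)) m = (if \<exists>S. finite S \<and> card S = n \<and> m = sq i S then 1 else 0)"
proof -
  let ?V = "keys m" and ?J = "{j. (i, j) \<in> keys m}"
  let ?X = "{S. S \<subseteq> ?J \<and> card S = n}"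
  have fin: "finite ?J"
    by (rule finite_section) simp
  have "cf (lam n (MM i)) m = cf (resv ?V (lam n (MM i))) m" by (simp add: cf_resv)
  also have "\<dots> = (\<Sum>S\<in>?X. cf (\<Prod>j\<in>S. xmon (single (i, j) 1)) m)"
    unfolding resv_ee[OF finite_keys] gesym_def cf_sum ..
  also have "\<dots> = (\<Sum>S\<in>?X. if m = sq i S then 1 else 0)"
    by (rule sum.cong) (use fin in \<open>auto simp: prod_xmon_sq[simplified] cf_xmon dest: finite_subset\<close>)
  also have "\<dots> = (if \<exists>S. finite S \<and> card S = n \<and> m = sq i S then 1 else 0)"
  proof (cases "\<exists>S. finite S \<and> card S = n \<and> m = sq i S")
    case True
    then obtain S where S: "finite S" "card S = n" "m = sq i S" by blast
    then have "?J = S" by (auto simp: in_keys_iff lookup_sq)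
    have "(\<Sum>S\<in>?X. if m = sq i S then 1 else 0) = (\<Sum>T\<in>?X. if T = S then 1 else (0::int))"
    proof (rule sum.cong)
      fix T assume "T \<in> ?X"
      then have "finite T" using fin finite_subset by auto
      then show "(if m = sq i T then 1 else 0) = (if T = S then 1 else (0::int))"
        using S sq_inj by auto
    qed simp
    also have "\<dots> = 1" using S fin \<open>?J = S\<close> by simp
    finally show ?thesis using True by simp
  next
    case False
    have "(\<Sum>S\<in>?X. if m = sq i S then 1 else (0::int)) = 0"
      by (rule sum.neutral) (use False fin finite_subset in auto)
    then show ?thesis using False by simp
  qed
  finally show ?thesis .
qed

subsection \<open>Leading monomials\<close>

definition rdeg :: "(idx \<Rightarrow>\<^sub>0 nat) \<Rightarrow> nat \<Rightarrow> nat" where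
  "rdeg m i = wt (\<lambda>p. if fst p = i then 1 else 0) m"

text \<open>Each \<open>ee (i, k)\<close> has a unique monomial of least column weight \<^term>\<open>wt snd\<close>; this stands in
  for the leading monomial of the usual lexicographic argument.\<close>

abbreviation cwt :: "(idx \<Rightarrow>\<^sub>0 nat) \<Rightarrow> nat" where
  "cwt \<equiv> wt snd"

text \<open>\<open>cwt\<close> need not separate monomials, so uniqueness of the minimum is part of
  the definition. The coefficient 1 lets leading terms be cancelled over the integers, and the
  common \<open>rdeg\<close> records that products of the \<open>ee\<close> are homogeneous in each
  row.\<close>

definition Lead :: "idx mps \<Rightarrow> (idx \<Rightarrow>\<^sub>0 nat) \<Rightarrow> bool" where
  "Lead f l \<longleftrightarrow> cf f l = 1 \<and>
    (\<forall>m. cf f m \<noteq> 0 \<longrightarrow> rdeg m = rdeg l \<and> cwt l \<le> cwt m \<and> (cwt m = cwt l \<longrightarrow> m = l))"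

lemma LeadI:
  "cf f l = 1 \<Longrightarrow> (\<And>m. cf f m \<noteq> 0 \<Longrightarrow> rdeg m = rdeg l \<and> cwt l \<le> cwt m \<and> (cwt m = cwt l \<longrightarrow> m = l))
    \<Longrightarrow> Lead f l"
  unfolding Lead_def by blast

lemma LeadD:
  assumes "Lead f l"
  shows "cf f l = 1"
    and "cf f m \<noteq> 0 \<Longrightarrow> rdeg m = rdeg l"
    and "cf f m \<noteq> 0 \<Longrightarrow> cwt l \<le> cwt m"
    and "cf f m \<noteq> 0 \<Longrightarrow> cwt m = cwt l \<Longrightarrow> m = l"
  using assms unfolding Lead_def by blast+

lemma rdeg_add: "rdeg (a + b) i = rdeg a i + rdeg b i"
  by (simp add: rdeg_def wt_add)

lemma rdeg_zero [simp]: "rdeg 0 i = 0"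
  by (simp add: rdeg_def)

lemma rdeg_sum: "rdeg (sum f A) i = (\<Sum>x\<in>A. rdeg (f x) i)"
  by (simp add: rdeg_def wt_sum)

lemma rdeg_sq: "finite S \<Longrightarrow> rdeg (sq i S) = (\<lambda>j. if j = i then card S else 0)"
  by (auto simp: sq_def rdeg_def wt_sum)

lemma cwt_sq: "cwt (sq i S) = \<Sum> S"
  by (simp add: sq_def wt_sum)

text \<open>The induction removes the maximum, which is at least n in a set of n + 1 naturals. For
  \<open>ee\<close> this singles out the monomial in the initial columns.\<close>

lemma sum_lessThan_le:
  assumes "finite S" "card S = n"
  shows "\<Sum>{..<n} \<le> \<Sum> S \<and> (\<Sum> S = \<Sum>{..<n} \<longrightarrow> S = {..<n})"
  using assms
proof (induction n arbitrary: S)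
  case (Suc n)
  let ?x = "Max S"
  have ne: "S \<noteq> {}" using Suc.prems by auto
  then have x: "?x \<in> S" using Suc.prems by auto
  have "S \<subseteq> {..?x}" using Suc.prems by auto
  then have "card S \<le> card {..?x}" by (intro card_mono) auto
  then have "Suc n \<le> Suc ?x" using Suc.prems by simp
  then have nx: "n \<le> ?x" by simp
  have IH: "\<Sum>{..<n} \<le> \<Sum>(S - {?x}) \<and> (\<Sum>(S - {?x}) = \<Sum>{..<n} \<longrightarrow> S - {?x} = {..<n})"
    by (rule Suc.IH) (use Suc.prems x in auto)
  have sum: "\<Sum> S = ?x + \<Sum>(S - {?x})"
    using Suc.prems x by (simp add: sum.remove)
  have Suc_n: "\<Sum>{..<Suc n} = \<Sum>{..<n} + n" by simp
  show ?case
  proof (intro conjI impI)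
    show "\<Sum>{..<Suc n} \<le> \<Sum> S" using IH sum nx Suc_n by linarith
    assume eq: "\<Sum> S = \<Sum>{..<Suc n}"
    have "?x = n" "\<Sum>(S - {?x}) = \<Sum>{..<n}" using IH sum nx eq Suc_n by linarith+
    with IH have "S = insert n {..<n}" using x by blast
    then show "S = {..<Suc n}" by (simp only: lessThan_Suc)
  qed
qed simp

lemma Lead_ee: "Lead (ee (i, k)) (sq i {..k})"
proof -
  have 1: "cf (ee (i, k)) (sq i {..k}) = 1"
    unfolding ee_def cf_lam_MM by (auto intro!: exI[of _ "{..k}"])
  have "rdeg m = rdeg (sq i {..k}) \<and> cwt (sq i {..k}) \<le> cwt m \<and> (cwt m = cwt (sq i {..k}) \<longrightarrow> m = sq i {..k})"
    if "cf (ee (i, k)) m \<noteq> 0" for m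
  proof -
    obtain S where S: "finite S" "card S = Suc k" "m = sq i S"
      using \<open>cf (ee (i, k)) m \<noteq> 0\<close> unfolding ee_def cf_lam_MM fst_conv snd_conv
      by (metis (no_types, lifting))
    have "\<Sum>{..k} \<le> \<Sum> S \<and> (\<Sum> S = \<Sum>{..k} \<longrightarrow> S = {..k})"
      by (rule sum_lessThan_le[OF S(1,2), unfolded lessThan_Suc_atMost])
    moreover have "rdeg (sq i S) = rdeg (sq i {..k})"
      unfolding rdeg_sq[OF S(1)] rdeg_sq[OF finite_atMost] S(2) card_atMost ..
    ultimately show ?thesis unfolding S(3) cwt_sq by metis
  qed
  with 1 show ?thesis by (rule LeadI)
qed

lemma Lead_one: "Lead 1 0"
  by (auto simp: Lead_def cf_one split: if_splits)

text \<open>Column weights add, and the sum attains its minimum only if both summands do; hence a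
  single decomposition contributes at \<open>l + l'\<close>.\<close>

lemma Lead_mult:
  assumes "Lead f l" "Lead g l'"
  shows "Lead (f * g) (l + l')"
proof -
  have key: "a = l \<and> b = l'" if "cf f a \<noteq> 0" "cf g b \<noteq> 0" "cwt a + cwt b = cwt l + cwt l'" for a b
  proof -
    have "cwt l \<le> cwt a" "cwt l' \<le> cwt b"
      by (rule LeadD(3)[OF assms(1) that(1)], rule LeadD(3)[OF assms(2) that(2)])
    then show ?thesis using that LeadD(4)[OF assms(1) that(1)] LeadD(4)[OF assms(2) that(2)] by linarith
  qed
  have "cf (f * g) (l + l') = (\<Sum>p\<in>decomp (l + l'). if p = (l, l') then 1 else 0)"
    unfolding cf_mult
  proof (rule sum.cong)
    fix p assume p: "p \<in> decomp (l + l')"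
    obtain a b where ab: "p = (a, b)" by (cases p)
    then have "cwt a + cwt b = cwt l + cwt l'" using p by (metis decomp_iff wt_add)
    then show "(case p of (a, b) \<Rightarrow> cf f a * cf g b) = (if p = (l, l') then 1 else 0)"
    proof (cases "cf f a = 0 \<or> cf g b = 0")
      case True
      then have "(a, b) \<noteq> (l, l')" using LeadD(1)[OF assms(1)] LeadD(1)[OF assms(2)] by auto
      then show ?thesis using True by (auto simp: ab)
    next
      case False
      then have "a = l" "b = l'" using key \<open>cwt a + cwt b = cwt l + cwt l'\<close> by blast+
      then show ?thesis using LeadD(1)[OF assms(1)] LeadD(1)[OF assms(2)] by (simp add: ab)
    qed
  qed simp
  also have "\<dots> = 1" by (simp add: sum.delta')
  finally have 1: "cf (f * g) (l + l') = 1" .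
  have "rdeg m = rdeg (l + l') \<and> cwt (l + l') \<le> cwt m \<and> (cwt m = cwt (l + l') \<longrightarrow> m = l + l')"
    if "cf (f * g) m \<noteq> 0" for m
  proof -
    obtain a b where ab: "m = a + b" "cf f a \<noteq> 0" "cf g b \<noteq> 0" using \<open>cf (f * g) m \<noteq> 0\<close> by (rule supp_mult)
    note a = LeadD(2,3)[OF assms(1) ab(2)] and b = LeadD(2,3)[OF assms(2) ab(3)]
    show ?thesis
    proof (intro conjI impI)
      show "rdeg m = rdeg (l + l')" using a(1) b(1) by (simp add: ab(1) rdeg_add fun_eq_iff)
      show "cwt (l + l') \<le> cwt m" using a(2) b(2) by (simp add: ab(1) wt_add)
    qed (use key[OF ab(2,3)] in \<open>simp add: ab(1) wt_add\<close>)
  qed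
  then show ?thesis using 1 by (intro LeadI)
qed

lemma Lead_power: "Lead f l \<Longrightarrow> Lead (f ^ n) (mulm n l)"
  by (induction n) (auto simp: Lead_one mulm_Suc intro: Lead_mult)

lemma Lead_prod: "finite A \<Longrightarrow> (\<And>x. x \<in> A \<Longrightarrow> Lead (f x) (l x)) \<Longrightarrow> Lead (prod f A) (sum l A)"
  by (induction A rule: finite_induct) (auto simp: Lead_one intro: Lead_mult)

text \<open>In row i this is a partition: entry j counts, with multiplicity, the factors
  \<open>ee (i, k)\<close> with k \<ge> j. It is the conjugate of the partition whose parts are the
  k + 1.\<close>

definition lead :: "(idx \<Rightarrow>\<^sub>0 nat) \<Rightarrow> (idx \<Rightarrow>\<^sub>0 nat)" where
  "lead \<mu> = (\<Sum>p\<in>keys \<mu>. mulm (lookup \<mu> p) (sq (fst p) {..snd p}))"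

lemma Lead_mev: "Lead (mev ee \<mu>) (lead \<mu>)"
  unfolding mev_def lead_def by (intro Lead_prod finite_keys Lead_power) (auto simp: Lead_ee split: prod.splits)

lemma lookup_lead:
  "lookup (lead \<mu>) (i, j) = (\<Sum>p\<in>keys \<mu>. if fst p = i \<and> j \<le> snd p then lookup \<mu> p else 0)"
  by (auto simp: lead_def lookup_sum lookup_sq intro!: sum.cong)

text \<open>Consecutive differences along a row return \<mu>, which gives both the injectivity of
  \<open>lead\<close> and its inverse on weakly decreasing rows.\<close>

lemma lookup_lead_Suc: "lookup (lead \<mu>) (i, j) = lookup (lead \<mu>) (i, Suc j) + lookup \<mu> (i, j)"
proof -
  have "lookup (lead \<mu>) (i, j) = (\<Sum>p\<in>keys \<mu>. (if fst p = i \<and> Suc j \<le> snd p then lookup \<mu> p else 0)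
      + (if p = (i, j) then lookup \<mu> p else 0))"
    unfolding lookup_lead by (rule sum.cong) (auto simp: prod_eq_iff)
  also have "\<dots> = lookup (lead \<mu>) (i, Suc j) + lookup \<mu> (i, j)"
    by (simp add: sum.distrib lookup_lead in_keys_iff)
  finally show ?thesis .
qed

lemma lead_inj: "lead \<mu> = lead \<nu> \<Longrightarrow> \<mu> = \<nu>"
proof (rule poly_mapping_eqI)
  fix p assume "lead \<mu> = lead \<nu>"
  then show "lookup \<mu> p = lookup \<nu> p"
    using lookup_lead_Suc[of \<mu> "fst p" "snd p"] lookup_lead_Suc[of \<nu> "fst p" "snd p"] by simp
qed

definition dominant :: "(idx \<Rightarrow>\<^sub>0 nat) \<Rightarrow> bool" where
  "dominant d \<longleftrightarrow> (\<forall>i j. lookup d (i, Suc j) \<le> lookup d (i, j))"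

lemma dominant_lead: "dominant d \<Longrightarrow> \<exists>\<mu>. lead \<mu> = d"
proof -
  assume dom: "dominant d"
  define \<mu> where "\<mu> = Abs_poly_mapping (\<lambda>(i, j). lookup d (i, j) - lookup d (i, Suc j))"
  have "finite {p. (case p of (i, j) \<Rightarrow> lookup d (i, j) - lookup d (i, Suc j)) \<noteq> 0}"
    by (rule finite_subset[OF _ finite_keys[of d]]) (auto simp: in_keys_iff)
  then have mu: "lookup \<mu> (i, j) = lookup d (i, j) - lookup d (i, Suc j)" for i j
    by (simp add: \<mu>_def)
  define N where "N = Suc (Max (insert 0 (snd ` (keys \<mu> \<union> keys d))))"
  have N: "snd p < N" if "p \<in> keys \<mu> \<union> keys d" for p
    unfolding N_def using that by (intro le_imp_less_Suc Max_ge) auto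
  have large: "lookup (lead \<mu>) (i, j) = lookup d (i, j)" if "j \<ge> N" for i j
  proof -
    have "lookup (lead \<mu>) (i, j) = 0"
      unfolding lookup_lead by (rule sum.neutral) (use N that in fastforce)
    moreover have "lookup d (i, j) = 0"
      using N[of "(i, j)"] that by (auto simp: in_keys_iff)
    ultimately show ?thesis by simp
  qed
  \<comment> \<open>Downward induction on the column, starting where both sides vanish; for k beyond
    \<open>N\<close> truncated subtraction stays at column 0.\<close>
  have "lookup (lead \<mu>) (i, N - k) = lookup d (i, N - k)" for i k
  proof (induction k)
    case 0
    then show ?case by (simp add: large)
  next
    case (Suc k)
    show ?case
    proof (cases "Suc k \<le> N")
      case True
      then have "N - k = Suc (N - Suc k)" by simp
      then show ?thesis using Suc dom[unfolded dominant_def, rule_format, of i "N - Suc k"]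
        by (subst lookup_lead_Suc) (simp add: mu)
    qed (use Suc in simp)
  qed
  then have "lookup (lead \<mu>) (i, j) = lookup d (i, j)" for i j
    using large by (metis diff_diff_cancel nle_le)
  then show ?thesis by (intro exI[of _ \<mu>] poly_mapping_eqI) (auto split: prod.splits)
qed

section \<open>Algebraic independence of the elementary functions\<close>

abbreviation Phi :: "idx zp \<Rightarrow> idx mps" where
  "Phi \<equiv> pev ee"

lemma cf_Phi: "cf (Phi p) m = (\<Sum>\<mu>\<in>keys p. lookup p \<mu> * cf (mev ee \<mu>) m)"
  by (simp add: pev_def)

text \<open>Among the leading monomials of the terms of \<open>p\<close>, one of least column weight
  occurs in no other term, so it cannot cancel. The monomial is exhibited because a later truncation
  of the variables must be seen to keep it.\<close>

lemma Phi_lead: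
  assumes "p \<noteq> 0"
  shows "\<exists>\<mu>\<in>keys p. cf (Phi p) (lead \<mu>) \<noteq> 0"
proof -
  have ne: "keys p \<noteq> {}" using assms by simp
  define \<mu> where "\<mu> = arg_min_on (\<lambda>\<mu>. cwt (lead \<mu>)) (keys p)"
  have mu: "\<mu> \<in> keys p" unfolding \<mu>_def using ne by (intro arg_min_if_finite) auto
  have min: "cwt (lead \<mu>) \<le> cwt (lead \<nu>)" if "\<nu> \<in> keys p" for \<nu>
    unfolding \<mu>_def using ne that by (intro arg_min_least) auto
  have "cf (Phi p) (lead \<mu>) = (\<Sum>\<nu>\<in>keys p. if \<nu> = \<mu> then lookup p \<mu> else 0)"
    unfolding cf_Phi
  proof (rule sum.cong)
    fix \<nu> assume "\<nu> \<in> keys p"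
    then show "lookup p \<nu> * cf (mev ee \<nu>) (lead \<mu>) = (if \<nu> = \<mu> then lookup p \<mu> else 0)"
      using LeadD(2-4)[OF Lead_mev[of \<nu>], of "lead \<mu>"] LeadD(1)[OF Lead_mev[of \<mu>]] min[of \<nu>] lead_inj[of \<mu> \<nu>]
      by (cases "cf (mev ee \<nu>) (lead \<mu>) = 0") auto
  qed simp
  also have "\<dots> = lookup p \<mu>" using mu by simp
  finally show ?thesis using mu by (auto simp: in_keys_iff intro!: bexI[of _ \<mu>])
qed

lemma Phi_inj: "Phi p = Phi q \<Longrightarrow> p = q"
proof (rule ccontr)
  assume "Phi p = Phi q" "p \<noteq> q"
  then have "Phi (p - q) = 0" "p - q \<noteq> 0"
    by (simp_all add: rhom_diff[OF rhom_pev])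
  then show False using Phi_lead[of "p - q"] by simp
qed

subsection \<open>Symmetric functions are polynomials in the elementary ones\<close>

definition rowp :: "(idx \<Rightarrow> idx) \<Rightarrow> bool" where
  "rowp \<pi> \<longleftrightarrow> bij \<pi> \<and> (\<forall>p. fst (\<pi> p) = fst p)"

abbreviation wdeg :: "(idx \<Rightarrow>\<^sub>0 nat) \<Rightarrow> nat" where
  "wdeg \<equiv> wt (\<lambda>p. Suc (fst p))"

lemma rowpD:
  assumes "rowp \<pi>"
  shows "bij \<pi>" and "inj \<pi>" and "fst (\<pi> p) = fst p"
  using assms bij_is_inj unfolding rowp_def by blast+

definition row_sym :: "idx mps \<Rightarrow> bool" where
  "row_sym f \<longleftrightarrow> (\<forall>\<pi>. rowp \<pi> \<longrightarrow> permv \<pi> f = f)"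

lemma row_symD: "row_sym f \<Longrightarrow> rowp \<pi> \<Longrightarrow> permv \<pi> f = f"
  by (simp add: row_sym_def)

lemma rdeg_eq: "rdeg m i = (\<Sum>p\<in>{p \<in> keys m. fst p = i}. lookup m p)"
  unfolding rdeg_def wt_def by (rule sum.mono_neutral_cong_right) auto

lemma rdeg_nonzero: "{i. rdeg m i \<noteq> 0} = fst ` keys m"
proof -
  have "rdeg m i = 0 \<longleftrightarrow> (\<forall>p\<in>keys m. fst p \<noteq> i)" for i
  proof -
    have "rdeg m i = 0 \<longleftrightarrow> (\<forall>p\<in>{p \<in> keys m. fst p = i}. lookup m p = 0)"
      unfolding rdeg_eq by (rule sum_eq_0_iff) simp
    also have "\<dots> \<longleftrightarrow> (\<forall>p\<in>keys m. fst p \<noteq> i)"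
      by (metis (mono_tags, lifting) in_keys_iff mem_Collect_eq)
    finally show ?thesis .
  qed
  then show ?thesis by (auto simp: image_iff)
qed

lemma finite_rdeg_nonzero: "finite {i. rdeg m i \<noteq> 0}"
  unfolding rdeg_nonzero by simp

lemma wdeg_rdeg: "wdeg m = (\<Sum>i | rdeg m i \<noteq> 0. Suc i * rdeg m i)"
proof -
  have "wdeg m = (\<Sum>i\<in>fst ` keys m. \<Sum>p\<in>{p \<in> keys m. fst p = i}. Suc (fst p) * lookup m p)"
    unfolding wt_def by (rule sum.image_gen) simp
  moreover have "(\<Sum>p\<in>{p \<in> keys m. fst p = i}. Suc (fst p) * lookup m p) = Suc i * rdeg m i" for i
    unfolding rdeg_eq sum_distrib_left by (rule sum.cong) auto
  ultimately show ?thesis by (simp only: rdeg_nonzero)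
qed

text \<open>Bounded degree leaves finitely many row-degree vectors; they form the finite set that
  \<open>Phi_surj\<close> asks for.\<close>

lemma finite_rdeg: "finite (rdeg ` {m. wdeg m \<le> N})"
proof (rule finite_subset)
  show "rdeg ` {m. wdeg m \<le> N} \<subseteq> {v. \<forall>i. (i \<in> {..N} \<longrightarrow> v i \<in> {..N}) \<and> (i \<notin> {..N} \<longrightarrow> v i = 0)}"
  proof clarify
    fix m i assume m: "wdeg m \<le> N"
    have "Suc i * rdeg m i \<le> N" if "rdeg m i \<noteq> 0"
    proof -
      have "Suc i * rdeg m i \<le> wdeg m"
        unfolding wdeg_rdeg by (rule member_le_sum) (use that finite_rdeg_nonzero in auto)
      then show ?thesis using m by simp
    qed
    then show "(i \<in> {..N} \<longrightarrow> rdeg m i \<in> {..N}) \<and> (i \<notin> {..N} \<longrightarrow> rdeg m i = 0)"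
      by (cases "rdeg m i") auto
  qed
  show "finite {v :: nat \<Rightarrow> nat. \<forall>i. (i \<in> {..N} \<longrightarrow> v i \<in> {..N}) \<and> (i \<notin> {..N} \<longrightarrow> v i = 0)}"
    by (rule finite_set_of_finite_funs) auto
qed

lemma sum_le_rdeg:
  assumes "finite B" "\<And>p. p \<in> B \<Longrightarrow> fst p = i"
  shows "(\<Sum>p\<in>B. lookup d p) \<le> rdeg d i"
proof -
  have "rdeg d i = (\<Sum>p\<in>keys d \<union> B. (if fst p = i then 1 else 0) * lookup d p)"
    unfolding rdeg_def by (rule wt_superset) (use assms in auto)
  moreover have "(\<Sum>p\<in>B. lookup d p) = (\<Sum>p\<in>B. (if fst p = i then 1 else 0) * lookup d p)"
    by (rule sum.cong) (use assms in auto)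
  moreover have "\<dots> \<le> (\<Sum>p\<in>keys d \<union> B. (if fst p = i then 1 else 0) * lookup d p)"
    by (rule sum_mono2) (use assms in auto)
  ultimately show ?thesis by simp
qed

lemma dominant_mono: "dominant d \<Longrightarrow> j' \<le> j \<Longrightarrow> lookup d (i, j) \<le> lookup d (i, j')"
  by (rule lift_Suc_antimono_le[of "\<lambda>j. lookup d (i, j)"]) (auto simp: dominant_def)

text \<open>If entry \<open>j\<close> of a weakly decreasing row is positive, so are all j + 1
  entries up to it, and their sum is at most the row degree.\<close>

lemma dominant_bound:
  assumes "dominant d"
  shows "lookup d (i, j) \<le> (if j < rdeg d i then rdeg d i else 0)"
proof (cases "lookup d (i, j) = 0")
  case False
  have "(\<Sum>p\<in>{(i, j)}. lookup d p) \<le> rdeg d i" by (rule sum_le_rdeg) auto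
  then have 1: "lookup d (i, j) \<le> rdeg d i" by simp
  have "Suc j = (\<Sum>k\<le>j. 1)" by simp
  also have "\<dots> \<le> (\<Sum>k\<le>j. lookup d (i, k))"
  proof (rule sum_mono)
    fix k assume "k \<in> {..j}"
    then show "1 \<le> lookup d (i, k)" using dominant_mono[OF assms, of k j i] False by simp
  qed
  also have "\<dots> = (\<Sum>p\<in>Pair i ` {..j}. lookup d p)" by (simp add: sum.reindex inj_on_def)
  also have "\<dots> \<le> rdeg d i" by (rule sum_le_rdeg) auto
  finally show ?thesis using 1 by simp
qed simp

lemma finite_dominant: "finite {d. dominant d \<and> rdeg d = v}"
proof (cases "\<exists>d0. rdeg d0 = v")
  case True
  then have "finite {i. v i \<noteq> 0}" using finite_rdeg_nonzero by blast
  then have "finite (Sigma {i. v i \<noteq> 0} (\<lambda>i. {..<v i}))" by simp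
  then have "finite {p. (if snd p < v (fst p) then v (fst p) else 0) \<noteq> 0}"
    by (rule rev_finite_subset) (auto split: if_splits)
  moreover define U where "U = Abs_poly_mapping (\<lambda>p. if snd p < v (fst p) then v (fst p) else 0)"
  ultimately have U: "lookup U p = (if snd p < v (fst p) then v (fst p) else 0)" for p
    by (simp add: U_def)
  have "{d. dominant d \<and> rdeg d = v} \<subseteq> {d. \<forall>p. lookup d p \<le> lookup U p}"
  proof clarify
    fix d p assume "dominant d" "v = rdeg d"
    then show "lookup d p \<le> lookup U p"
      using dominant_bound[of d "fst p" "snd p"] by (simp only: U prod.collapse)
  qed
  then show ?thesis using finite_lookup_le finite_subset by blast
next
  case False
  then have "{d. dominant d \<and> rdeg d = v} = {}" by blast
  then show ?thesis by (simp only: finite.emptyI)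
qed

text \<open>Sorting of the rows is done by minimality: for a row permutation of least resulting
  column weight, exchanging two adjacent increasing entries would lower the weight further.\<close>

lemma ex_dominant: "\<exists>\<pi>. rowp \<pi> \<and> dominant (map_key \<pi> m)"
proof -
  have "rowp (\<lambda>p. p)" by (simp add: rowp_def bij_def)
  then obtain \<pi> where \<pi>: "rowp \<pi>"
    and least: "\<And>\<rho>. rowp \<rho> \<Longrightarrow> cwt (map_key \<pi> m) \<le> cwt (map_key \<rho> m)"
    using ex_has_least_nat[of rowp "\<lambda>p. p" "\<lambda>\<pi>. cwt (map_key \<pi> m)"] by blast
  define d where "d = map_key \<pi> m"
  have "lookup d (i, Suc j) \<le> lookup d (i, j)" for i j
  proof (rule ccontr)
    assume less: "\<not> lookup d (i, Suc j) \<le> lookup d (i, j)"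
    define x y where "x = (i, j)" and "y = (i, Suc j)"
    define \<tau> where "\<tau> = (\<lambda>p. if p = x then y else if p = y then x else p)"
    have xy: "x \<noteq> y" by (simp add: x_def y_def)
    have "\<tau> (\<tau> p) = p" for p by (simp add: \<tau>_def)
    then have \<tau>: "bij \<tau>" by (intro bij_betw_byWitness[where f' = \<tau>]) auto
    have "fst (\<tau> p) = fst p" for p by (simp add: \<tau>_def x_def y_def)
    then have "rowp (\<lambda>p. \<pi> (\<tau> p))"
      using rowpD(3)[OF \<pi>] bij_comp[OF \<tau> rowpD(1)[OF \<pi>]] unfolding rowp_def o_def by metis
    from least[OF this] have le: "cwt d \<le> cwt (map_key (\<lambda>p. \<pi> (\<tau> p)) m)"
      by (simp add: d_def)
    define e where "e = map_key (\<lambda>p. \<pi> (\<tau> p)) m"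
    have e: "lookup e p = lookup d (\<tau> p)" for p
      unfolding e_def d_def
      by (simp only: lookup_map_key[OF rowpD(2)[OF \<pi>]] lookup_map_key[OF rowpD(2)[OF \<open>rowp (\<lambda>p. \<pi> (\<tau> p))\<close>]])
    let ?C = "keys d - {x, y}"
    have "keys e \<subseteq> insert x (insert y ?C)"
      by (auto simp: in_keys_iff e \<tau>_def split: if_splits)
    then have "cwt e = (\<Sum>p\<in>insert x (insert y ?C). snd p * lookup e p)"
      by (intro wt_superset) auto
    also have "\<dots> = snd x * lookup d y + (snd y * lookup d x + (\<Sum>p\<in>?C. snd p * lookup e p))"
      using xy by (simp add: e \<tau>_def)
    also have "(\<Sum>p\<in>?C. snd p * lookup e p) = (\<Sum>p\<in>?C. snd p * lookup d p)"
      by (rule sum.cong) (auto simp: e \<tau>_def)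
    finally have "cwt e = snd x * lookup d y + (snd y * lookup d x + (\<Sum>p\<in>?C. snd p * lookup d p))" .
    moreover have "cwt d = (\<Sum>p\<in>insert x (insert y ?C). snd p * lookup d p)"
      by (intro wt_superset) auto
    then have "cwt d = snd x * lookup d x + (snd y * lookup d y + (\<Sum>p\<in>?C. snd p * lookup d p))"
      using xy by simp
    ultimately show False using le less by (simp add: e_def x_def y_def)
  qed
  then show ?thesis using \<pi> by (auto simp: dominant_def d_def)
qed

lemma row_sym_eq_0:
  assumes "row_sym f" "\<And>d. dominant d \<Longrightarrow> cf f d = 0"
  shows "f = 0"
proof (rule mps_eqI)
  fix m
  obtain \<pi> where "rowp \<pi>" "dominant (map_key \<pi> m)" using ex_dominant by blast
  then show "cf f m = cf 0 m"
    using row_symD[OF assms(1)] assms(2) by (metis cf_permv cf_zero)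
qed

lemma row_sym_MM: "row_sym (MM i)"
  unfolding row_sym_def
proof (intro allI impI mps_eqI)
  fix \<pi> :: "idx \<Rightarrow> idx" and m :: "idx \<Rightarrow>\<^sub>0 nat"
  assume "rowp \<pi>"
  note \<pi> = rowpD(1,2)[OF this] and fst = rowpD(3)[OF this]
  have single: "map_key \<pi> (single (\<pi> p) 1) = single p (1 :: nat)" for p
    by (rule map_key_single[OF \<pi>(2)])
  have "(\<exists>j. map_key \<pi> m = single (i, j) 1) \<longleftrightarrow> (\<exists>j. m = single (i, j) 1)"
  proof
    assume "\<exists>j. map_key \<pi> m = single (i, j) 1"
    then obtain j where "map_key \<pi> m = map_key \<pi> (single (\<pi> (i, j)) 1)"
      by (metis single)
    then have "m = single (\<pi> (i, j)) 1" using map_key_inv(2)[OF \<pi>(1)] by metis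
    moreover have "\<pi> (i, j) = (i, snd (\<pi> (i, j)))" using fst[of "(i, j)"] by (simp add: prod_eq_iff)
    ultimately show "\<exists>j. m = single (i, j) 1" by metis
  next
    assume "\<exists>j. m = single (i, j) 1"
    then obtain j where m: "m = single (i, j) 1" by blast
    obtain p where p: "\<pi> p = (i, j)" using \<pi>(1) by (metis bij_pointE)
    then have "p = (i, snd p)" using fst[of p] by (simp add: prod_eq_iff)
    then show "\<exists>j. map_key \<pi> m = single (i, j) 1" using single[of p] p m by metis
  qed
  then show "cf (permv \<pi> (MM i)) m = cf (MM i) m" by (simp add: cf_permv cf_MM)
qed

lemma row_sym_lam: "row_sym f \<Longrightarrow> row_sym (lam n f)"
  unfolding row_sym_def rowp_def by (metis lam_permv)

lemma row_sym_mult: "row_sym f \<Longrightarrow> row_sym g \<Longrightarrow> row_sym (f * g)"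
  unfolding row_sym_def rowp_def by (metis rhom_mult rhom_permv)

lemma row_sym_diff: "row_sym f \<Longrightarrow> row_sym g \<Longrightarrow> row_sym (f - g)"
  unfolding row_sym_def rowp_def by (metis rhom_diff rhom_permv)

lemma row_sym_Phi: "row_sym (Phi p)"
  unfolding row_sym_def
proof (intro allI impI)
  fix \<pi> assume \<pi>: "rowp \<pi>"
  then have "rhom (permv \<pi>)" by (simp add: rowp_def rhom_permv)
  then have "permv \<pi> (Phi p) = pev (\<lambda>v. permv \<pi> (ee v)) p" by (rule rhom_pev_comp)
  also have "(\<lambda>v. permv \<pi> (ee v)) = ee"
    using row_symD[OF row_sym_lam[OF row_sym_MM] \<pi>] by (simp add: ee_def fun_eq_iff)
  finally show "permv \<pi> (Phi p) = Phi p" .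
qed

lemma rdeg_Phi:
  assumes "cf (Phi p) m \<noteq> 0"
  shows "\<exists>\<mu>\<in>keys p. rdeg m = rdeg (lead \<mu>)"
proof -
  obtain \<mu> where "\<mu> \<in> keys p" "cf (mev ee \<mu>) m \<noteq> 0"
    using assms unfolding cf_Phi by (metis (no_types, lifting) mult_zero_right sum.neutral)
  then show ?thesis using LeadD(2)[OF Lead_mev] by blast
qed

lemma wdeg_Phi: "\<exists>N. \<forall>m. cf (Phi p) m \<noteq> 0 \<longrightarrow> wdeg m \<le> N"
proof -
  have "wdeg m \<le> (\<Sum>\<mu>\<in>keys p. wdeg (lead \<mu>))" if "cf (Phi p) m \<noteq> 0" for m
  proof -
    obtain \<mu> where \<mu>: "\<mu> \<in> keys p" "rdeg m = rdeg (lead \<mu>)" using rdeg_Phi \<open>cf (Phi p) m \<noteq> 0\<close> by blast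
    then have "wdeg m = wdeg (lead \<mu>)" by (simp add: wdeg_rdeg)
    also have "\<dots> \<le> (\<Sum>\<mu>\<in>keys p. wdeg (lead \<mu>))"
      by (rule member_le_sum) (use \<mu> in auto)
    finally show ?thesis .
  qed
  then show ?thesis by blast
qed

text \<open>Greedy elimination from low to high column weight: the coefficients at dominant
  exponents of the lowest remaining weight are removed by subtracting products of the
  \<open>ee\<close> with these leading monomials. Row degrees stay in \<open>A\<close>, so only the
  finite set \<open>D\<close> of dominant exponents matters, and by symmetry vanishing on it is
  enough.\<close>

theorem Phi_surj:
  assumes "row_sym f" "finite A" "\<And>m. cf f m \<noteq> 0 \<Longrightarrow> rdeg m \<in> A"
  obtains p where "Phi p = f" "\<And>\<mu>. \<mu> \<in> keys p \<Longrightarrow> rdeg (lead \<mu>) \<in> A"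
proof -
  define D where "D = {d. dominant d \<and> rdeg d \<in> A}"
  have "D = (\<Union>v\<in>A. {d. dominant d \<and> rdeg d = v})" by (auto simp: D_def)
  then have finD: "finite D" using assms(2) finite_dominant by simp
  define K where "K = Suc (\<Sum>d\<in>D. cwt d)"
  have K: "cwt d < K" if "d \<in> D" for d
    unfolding K_def by (intro le_imp_less_Suc member_le_sum) (use that finD in auto)
  obtain mu where mu: "\<And>d. dominant d \<Longrightarrow> lead (mu d) = d" using dominant_lead by metis
  \<comment> \<open>\<open>b\<close> counts the weights still to be treated: nonzero coefficients on
    \<open>D\<close> have weight at least K - b, while all weights in \<open>D\<close> are below
    \<open>K\<close>.\<close>
  have "\<exists>p. Phi p = f \<and> (\<forall>\<mu>\<in>keys p. rdeg (lead \<mu>) \<in> A)"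
    if "row_sym f" "\<And>m. cf f m \<noteq> 0 \<Longrightarrow> rdeg m \<in> A" "\<And>d. d \<in> D \<Longrightarrow> cf f d \<noteq> 0 \<Longrightarrow> K \<le> cwt d + b" for b f
    using that
  proof (induction b arbitrary: f)
    case 0
    have "f = 0"
    proof (rule row_sym_eq_0[OF 0(1)])
      fix d assume "dominant d"
      then show "cf f d = 0" using 0(2)[of d] 0(3)[of d] K[of d] by (fastforce simp: D_def)
    qed
    then show ?case by (intro exI[of _ 0]) (simp add: rhom_zero[OF rhom_pev])
  next
    case (Suc b)
    define D' where "D' = {d \<in> D. cwt d + Suc b = K}"
    have finD': "finite D'" using finD by (simp add: D'_def)
    define q where "q = (\<Sum>d\<in>D'. single (mu d) (cf f d))"
    have Phi_q: "Phi q = (\<Sum>d\<in>D'. of_int (cf f d) * mev ee (mu d))"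
      by (simp add: q_def rhom_sum[OF rhom_pev])
    have Lead: "Lead (mev ee (mu d)) d" if "d \<in> D'" for d
      using Lead_mev[of "mu d"] mu that by (simp add: D'_def D_def)
    have keys_q: "rdeg (lead \<mu>) \<in> A" if "\<mu> \<in> keys q" for \<mu>
    proof -
      have "\<mu> \<in> (\<Union>d\<in>D'. keys (single (mu d) (cf f d)))"
        by (rule subsetD[OF keys_sum that[unfolded q_def]])
      then obtain d where "d \<in> D'" "\<mu> = mu d" by (auto split: if_splits)
      then show ?thesis using mu by (simp add: D'_def D_def)
    qed
    have "\<exists>p. Phi p = f - Phi q \<and> (\<forall>\<mu>\<in>keys p. rdeg (lead \<mu>) \<in> A)"
    proof (rule Suc.IH)
      show "row_sym (f - Phi q)" by (intro row_sym_diff Suc.prems(1) row_sym_Phi)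
      show "rdeg m \<in> A" if "cf (f - Phi q) m \<noteq> 0" for m
        using that Suc.prems(2)[of m] rdeg_Phi[of q m] keys_q by fastforce
      show "K \<le> cwt d + b" if d: "d \<in> D" "cf (f - Phi q) d \<noteq> 0" for d
      proof (rule ccontr)
        assume *: "\<not> K \<le> cwt d + b"
        \<comment> \<open>The weight of \<open>d\<close> is at most the common weight of
          \<open>D'\<close>, so a product with leading monomial d' can contain \<open>d\<close> only
          if d' = d.\<close>
        have "cf (Phi q) d = (\<Sum>d'\<in>D'. if d' = d then cf f d else 0)"
          unfolding Phi_q cf_sum cf_of_int_mult
        proof (rule sum.cong)
          fix d' assume d': "d' \<in> D'"
          then have le: "cwt d \<le> cwt d'" using * by (simp add: D'_def)
          have "d' = d" if "cf (mev ee (mu d')) d \<noteq> 0"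
          proof -
            have "cwt d' \<le> cwt d" by (rule LeadD(3)[OF Lead[OF d'] that])
            then have "cwt d = cwt d'" using le by linarith
            then show ?thesis by (rule LeadD(4)[OF Lead[OF d'] that, symmetric])
          qed
          then show "cf f d' * cf (mev ee (mu d')) d = (if d' = d then cf f d else 0)"
            using LeadD(1)[OF Lead[OF d']] by (cases "d' = d") auto
        qed simp
        also have "\<dots> = (if d \<in> D' then cf f d else 0)" using finD' by simp
        also have "\<dots> = cf f d"
        proof (cases "cf f d = 0")
          case False
          then have "K \<le> cwt d + Suc b" using Suc.prems(3) d(1) by blast
          then have "d \<in> D'" using * d(1) by (simp add: D'_def)
          then show ?thesis by simp
        qed simp
        finally show False using d(2) by simp
      qed
    qed
    then obtain p where p: "Phi p = f - Phi q" "\<forall>\<mu>\<in>keys p. rdeg (lead \<mu>) \<in> A" by blast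
    have "Phi (p + q) = f" using p(1) by (simp add: pev_add)
    moreover have "rdeg (lead \<mu>) \<in> A" if "\<mu> \<in> keys (p + q)" for \<mu>
      using that p(2) keys_q Poly_Mapping.keys_add[of p q] by blast
    ultimately show ?case by blast
  qed
  from this[OF assms(1,3), of K] show thesis using that by auto
qed

subsection \<open>Universal polynomials\<close>

text \<open>Solving for \<open>p\<close> instead of \<open>a\<close> requires no division, since
  \<open>p n\<close> occurs with the factor \<open>a 0\<close> = 1. Hence a series with constant
  term 1 has Newton sums over any commutative ring, in particular over the polynomial ring.\<close>

lemma newton_ex:
  fixes a :: "nat \<Rightarrow> 'a::comm_ring_1"
  assumes "a 0 = 1"
  shows "\<exists>p. newton a p"
proof -
  define p :: "nat \<Rightarrow> 'a" where "p = wfrec less_than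
    (\<lambda>f n. - (\<Sum>k\<in>{1..<n}. (-1) ^ k * (a k * f (n - k))) - (-1) ^ n * (of_nat n * a n))"
  have p: "p n = - (\<Sum>k\<in>{1..<n}. (-1) ^ k * (a k * p (n - k))) - (-1) ^ n * (of_nat n * a n)" for n
  proof -
    have "p n = - (\<Sum>k\<in>{1..<n}. (-1) ^ k * (a k * cut p less_than n (n - k))) - (-1) ^ n * (of_nat n * a n)"
      unfolding p_def by (subst wfrec) auto
    also have "(\<Sum>k\<in>{1..<n}. (-1) ^ k * (a k * cut p less_than n (n - k))) =
       (\<Sum>k\<in>{1..<n}. (-1) ^ k * (a k * p (n - k)))"
      by (rule sum.cong) (auto simp: cut_def)
    finally show ?thesis .
  qed
  have "newton a p"
    unfolding newton_def
  proof (intro allI impI)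
    fix n :: nat assume "1 \<le> n"
    then have "{..<n} = insert 0 {1..<n}" by auto
    then have "(\<Sum>k<n. (-1) ^ k * (a k * p (n - k))) = p n + (\<Sum>k\<in>{1..<n}. (-1) ^ k * (a k * p (n - k)))"
      using assms by simp
    then show "(\<Sum>k<n. (-1) ^ k * (a k * p (n - k))) + (-1) ^ n * (of_nat n * a n) = 0"
      using p[of n] by simp
  qed
  then show ?thesis by blast
qed

lemma newton_psum_unique:
  assumes "newton a p" "newton a q" "a 0 = 1" "n \<ge> 1"
  shows "p n = q n"
  using assms(4)
proof (induction n rule: less_induct)
  case (less n)
  have "{..<n} = insert 0 {1..<n}" using less.prems by auto
  then have s: "(\<Sum>k<n. (-1) ^ k * (a k * r (n - k))) = r n + (\<Sum>k\<in>{1..<n}. (-1) ^ k * (a k * r (n - k)))" for r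
    using assms(3) by simp
  have "(\<Sum>k\<in>{1..<n}. (-1) ^ k * (a k * p (n - k))) = (\<Sum>k\<in>{1..<n}. (-1) ^ k * (a k * q (n - k)))"
    by (rule sum.cong) (use less.IH in auto)
  then show ?case
    using newtonD[OF assms(1) less.prems] newtonD[OF assms(2) less.prems] unfolding s
    by (simp add: add.assoc) (simp add: add_eq_0_iff2)
qed

text \<open>A factor \<open>ee (i, k)\<close> contributes k + 1 to the degree in row i; row degrees
  thus bound which variables a universal polynomial can contain.\<close>

lemma lead_bound:
  assumes "v \<in> keys \<mu>"
  shows "snd v < rdeg (lead \<mu>) (fst v)"
proof -
  have r: "rdeg (mulm n u) i = n * rdeg u i" for n u i
    by (induction n) (auto simp: mulm_Suc rdeg_add)
  have "rdeg (lead \<mu>) i = (\<Sum>p\<in>keys \<mu>. lookup \<mu> p * (if i = fst p then Suc (snd p) else 0))" for i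
    unfolding lead_def rdeg_sum r rdeg_sq[OF finite_atMost] card_atMost ..
  moreover have "lookup \<mu> v * (if fst v = fst v then Suc (snd v) else 0) \<le>
      (\<Sum>p\<in>keys \<mu>. lookup \<mu> p * (if fst v = fst p then Suc (snd p) else 0))"
    by (rule member_le_sum) (use assms in auto)
  moreover have "Suc (snd v) \<le> lookup \<mu> v * Suc (snd v)"
    using assms mult_le_mono1[of 1 "lookup \<mu> v" "Suc (snd v)"] by (simp add: in_keys_iff)
  ultimately show ?thesis by simp
qed

lemma ex_poly:
  assumes "row_sym f" "\<And>m. cf f m \<noteq> 0 \<Longrightarrow> rdeg m = r"
  shows "\<exists>p. Phi p = f \<and> (\<forall>\<mu>\<in>keys p. \<forall>v\<in>keys \<mu>. snd v < r (fst v))"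
proof -
  obtain p where "Phi p = f" "\<And>\<mu>. \<mu> \<in> keys p \<Longrightarrow> rdeg (lead \<mu>) \<in> {r}"
    using Phi_surj[OF assms(1), of "{r}"] assms(2) by blast
  then show ?thesis using lead_bound by (intro exI[of _ p]) (metis singletonD)
qed

lemma rdeg_MM:
  assumes "cf (MM i) m \<noteq> 0"
  shows "rdeg m j = (if j = i then 1 else 0)"
proof -
  obtain k where "m = single (i, k) 1" using assms by (auto simp: cf_MM split: if_splits)
  then show ?thesis by (simp add: rdeg_def)
qed

lemma rdeg_lam:
  assumes "\<And>m i. cf f m \<noteq> 0 \<Longrightarrow> rdeg m i = r i" "cf (lam n f) m \<noteq> 0"
  shows "rdeg m i = n * r i"
  using supp_lam_wt[of f "\<lambda>p. if fst p = i then 1 else 0" "r i" n m] assms by (simp add: rdeg_def)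

text \<open>The product is homogeneous of degree 1 in each of the first two rows, so lambda_n of it
  has degree n there and degree 0 in all other rows.\<close>

lemma ex_qm:
  "\<exists>q. Phi q = lam n (MM 0 * MM 1) \<and> (\<forall>\<mu>\<in>keys q. \<forall>v\<in>keys \<mu>. fst v < 2 \<and> snd v < n)"
proof -
  define r :: "nat \<Rightarrow> nat" where "r = (\<lambda>i. if i < 2 then 1 else 0)"
  have "rdeg m i = r i" if nz: "cf (MM 0 * MM 1) m \<noteq> 0" for m i
  proof -
    obtain a b where "m = a + b" "cf (MM 0) a \<noteq> 0" "cf (MM 1) b \<noteq> 0"
      using nz by (rule supp_mult)
    then show ?thesis using rdeg_MM[of 0 a i] rdeg_MM[of 1 b i] by (auto simp: rdeg_add r_def)
  qed
  then have "rdeg m = (\<lambda>i. n * r i)" if "cf (lam n (MM 0 * MM 1)) m \<noteq> 0" for m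
    using rdeg_lam[OF _ that] by (auto simp: fun_eq_iff)
  moreover have "row_sym (lam n (MM 0 * MM 1))"
    by (intro row_sym_lam row_sym_mult row_sym_MM)
  ultimately obtain q where q: "Phi q = lam n (MM 0 * MM 1)" "\<forall>\<mu>\<in>keys q. \<forall>v\<in>keys \<mu>. snd v < n * r (fst v)"
    using ex_poly[of "lam n (MM 0 * MM 1)" "\<lambda>i. n * r i"] by blast
  have "fst v < 2 \<and> snd v < n" if "snd v < n * r (fst v)" for v :: idx
    using that by (auto simp: r_def split: if_splits)
  then show ?thesis using q by (intro exI[of _ q]) blast
qed

lemma ex_ql:
  "\<exists>q. Phi q = lam m (lam n (MM i)) \<and> (\<forall>\<mu>\<in>keys q. \<forall>v\<in>keys \<mu>. fst v = i \<and> snd v < m * n)"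
proof -
  define r :: "nat \<Rightarrow> nat" where "r = (\<lambda>j. if j = i then 1 else 0)"
  have "rdeg u j = n * r j" if "cf (lam n (MM i)) u \<noteq> 0" for u j
    by (rule rdeg_lam[OF _ that]) (simp add: rdeg_MM r_def)
  then have "rdeg u = (\<lambda>j. m * (n * r j))" if "cf (lam m (lam n (MM i))) u \<noteq> 0" for u
    using rdeg_lam[OF _ that, of "\<lambda>j. n * r j"] by (auto simp: fun_eq_iff)
  moreover have "row_sym (lam m (lam n (MM i)))"
    by (intro row_sym_lam row_sym_MM)
  ultimately obtain q where q: "Phi q = lam m (lam n (MM i))" "\<forall>\<mu>\<in>keys q. \<forall>v\<in>keys \<mu>. snd v < m * (n * r (fst v))"
    using ex_poly[of "lam m (lam n (MM i))" "\<lambda>j. m * (n * r j)"] by blast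
  have "fst v = i \<and> snd v < m * n" if "snd v < m * (n * r (fst v))" for v :: idx
    using that by (auto simp: r_def split: if_splits)
  then show ?thesis using q by (intro exI[of _ q]) blast
qed

text \<open>The universal product polynomial before its identification with \<open>P_mult\<close>:
  variable (0, k) plays the role of a_(k+1) and (1, k) that of b_(k+1).\<close>

definition qm :: "nat \<Rightarrow> idx zp" where
  "qm n = (SOME q. Phi q = lam n (MM 0 * MM 1) \<and> (\<forall>\<mu>\<in>keys q. \<forall>v\<in>keys \<mu>. fst v < 2 \<and> snd v < n))"

text \<open>The counterpart of \<open>P_lam m n\<close>, written in the variables of row
  \<open>i\<close> so that it directly expresses an iterated operation on M_(i+1).\<close>

definition ql :: "nat \<Rightarrow> nat \<Rightarrow> nat \<Rightarrow> idx zp" where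
  "ql i m n = (SOME q. Phi q = lam m (lam n (MM i)) \<and> (\<forall>\<mu>\<in>keys q. \<forall>v\<in>keys \<mu>. fst v = i \<and> snd v < m * n))"

lemma Phi_qm: "Phi (qm n) = lam n (MM 0 * MM 1)"
  and vars_qm: "\<mu> \<in> keys (qm n) \<Longrightarrow> v \<in> keys \<mu> \<Longrightarrow> fst v < 2 \<and> snd v < n"
  using someI_ex[OF ex_qm[of n]] unfolding qm_def by blast+

lemma Phi_ql: "Phi (ql i m n) = lam m (lam n (MM i))"
  and vars_ql: "\<mu> \<in> keys (ql i m n) \<Longrightarrow> v \<in> keys \<mu> \<Longrightarrow> fst v = i \<and> snd v < m * n"
  using someI_ex[OF ex_ql[of m n i]] unfolding ql_def by blast+

text \<open>A polynomial identity between Newton sums that holds for the algebraically independent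
  coefficients of \<open>lam\<^sub>t (MM 0)\<close> and \<open>lam\<^sub>t (MM 1)\<close> holds universally, and a series is
  determined by its Newton sums in a torsion-free ring.\<close>
theorem lam_mult:
  "lam n (g * h) = pev (\<lambda>v. lam (Suc (snd v)) (if fst v = 0 then g else h)) (qm n)"
proof -
  \<comment> \<open>\<open>y i\<close> is the generic series of row i, with constant term 1;
    \<open>u i\<close> and \<open>w\<close> below are the Newton sums of \<open>y i\<close> and of
    \<open>qm\<close>, formed in the polynomial ring.\<close>
  define y :: "nat \<Rightarrow> nat \<Rightarrow> idx zp" where "y i n = (if n = 0 then 1 else Var (i, n - 1))" for i n
  have Phi_y: "Phi (y i n) = lam n (MM i)" for i n
    by (cases n) (simp_all add: y_def ee_def rhom_one[OF rhom_pev])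
  have Phi1: "Phi 1 = 1" by (rule rhom_one[OF rhom_pev])
  have qm0: "qm 0 = 1"
    by (rule Phi_inj) (simp add: Phi_qm Phi1)
  obtain w where w: "newton qm w" using newton_ex[of qm] qm0 by blast
  obtain u where u: "\<And>i. newton (y i) (u i)" using newton_ex[of "y i" for i] by (metis y_def)
  have "Phi (w n) = psi n (MM 0 * MM 1)" if "n \<ge> 1" for n
    using newton_psum_unique[OF newton_rhom[OF rhom_pev[of ee] w, unfolded Phi_qm] newton_lam _ that] by simp
  moreover have "Phi (u i n) = psi n (MM i)" if "n \<ge> 1" for i n
    using newton_psum_unique[OF newton_rhom[OF rhom_pev[of ee] u[of i], unfolded Phi_y] newton_lam _ that] by simp
  \<comment> \<open>As \<open>Phi\<close> is injective, multiplicativity of the Adams operations on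
    \<open>MM 0\<close> and \<open>MM 1\<close> becomes a polynomial identity, which
    \<open>E\<close> specialises to \<open>g\<close> and \<open>h\<close>.\<close>
  ultimately have wu: "w n = u 0 n * u 1 n" if "n \<ge> 1" for n
    using that by (intro Phi_inj) (simp add: psi_mult rhom_mult[OF rhom_pev])
  define E where "E = pev (\<lambda>v. lam (Suc (snd v)) (if fst v = (0::nat) then g else h))"
  have E: "rhom E" unfolding E_def by (rule rhom_pev)
  have E_y: "E (y i n) = lam n (if i = 0 then g else h)" for i n
    by (cases n) (simp_all add: y_def E_def rhom_one[OF rhom_pev])
  have "E (u i n) = psi n (if i = 0 then g else h)" if "n \<ge> 1" for i n
    using newton_psum_unique[OF newton_rhom[OF E u[of i], unfolded E_y] newton_lam _ that] by simp
  then have "E (w n) = psi n (g * h)" if "n \<ge> 1" for n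
    using that by (simp add: wu psi_mult rhom_mult[OF E])
  then have "newton (\<lambda>n. E (qm n)) (\<lambda>n. psi n (g * h))"
    using newton_rhom[OF E w] by (simp add: newton_def)
  moreover have "E (qm 0) = 1" by (simp add: qm0 rhom_one[OF E])
  ultimately show ?thesis by (subst lam_eqI[of "\<lambda>n. E (qm n)"]) (simp_all add: E_def)
qed

subsection \<open>Integer points\<close>

text \<open>With all variables but \<open>v\<close> fixed the sum is a polynomial in one variable
  that is zero at every integer. So the coefficient of each power of \<open>v\<close> vanishes at
  all integer points, and it involves one variable fewer.\<close>

lemma vanishing_aux:
  assumes "finite V"
  shows "finite K \<Longrightarrow> (\<And>u. u \<in> K \<Longrightarrow> keys u \<subseteq> V) \<Longrightarrow>
    (\<And>pt :: 'v \<Rightarrow> int. (\<Sum>u\<in>K. c u * mev pt u) = 0) \<Longrightarrow> u \<in> K \<Longrightarrow> c u = 0"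
  using assms
proof (induction V arbitrary: K c u rule: finite_induct)
  case empty
  then have K: "K = {0}" by auto
  then show ?case using empty.prems(3)[of "\<lambda>_. 0"] empty.prems(4) by simp
next
  case (insert v V)
  define r where "r u = u - single v (lookup u v)" for u :: "'v \<Rightarrow>\<^sub>0 nat"
  have lr: "lookup (r u) x = (if x = v then 0 else lookup u x)" for u x
    by (auto simp: r_def lookup_minus lookup_single when_def)
  have ru: "r u + single v (lookup u v) = u" for u
    by (intro poly_mapping_eqI) (auto simp: lookup_add lr lookup_single when_def)
  define k where "k = lookup u v"
  define L where "L = {u \<in> K. lookup u v = k}"
  have inj: "inj_on r L"
    by (rule inj_onI) (metis (mono_tags, lifting) L_def mem_Collect_eq ru)
  have sub: "(\<Sum>w\<in>r ` L. c (w + single v k) * mev pt w) = 0" for pt :: "'v \<Rightarrow> int"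
  proof -
    define P where "P = (\<Sum>u\<in>K. Polynomial.monom (c u * mev pt (r u)) (lookup u v))"
    have "poly P t = 0" for t
    proof -
      have m: "mev (pt(v := t)) u = t ^ lookup u v * mev pt (r u)" for u
      proof -
        have "mev (pt(v := t)) u = mev (pt(v := t)) (r u) * t ^ lookup u v"
          by (subst ru[of u, symmetric]) (simp only: mev_add mev_single fun_upd_same)
        also have "mev (pt(v := t)) (r u) = mev pt (r u)"
          by (rule mev_cong) (auto simp: in_keys_iff lr)
        finally show ?thesis by (simp only: mult.commute)
      qed
      have "poly P t = (\<Sum>u\<in>K. c u * mev (pt(v := t)) u)"
        by (simp add: P_def poly_sum poly_monom m mult_ac)
      then show ?thesis using insert.prems(3) by simp
    qed
    then have "P = 0" using poly_all_0_iff_0 by blast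
    then have "coeff P k = 0" by simp
    then have "(\<Sum>u\<in>K. if lookup u v = k then c u * mev pt (r u) else 0) = 0"
      by (simp add: P_def coeff_sum)
    then have "(\<Sum>u\<in>L. c u * mev pt (r u)) = 0"
      unfolding L_def using insert.prems(1) by (simp add: sum.inter_filter)
    moreover have "(\<Sum>w\<in>r ` L. c (w + single v k) * mev pt w) = (\<Sum>u\<in>L. c u * mev pt (r u))"
      unfolding sum.reindex[OF inj] by (rule sum.cong) (auto simp: L_def ru)
    ultimately show ?thesis by simp
  qed
  have "c (r u + single v k) = 0"
  proof (rule insert.IH[of "r ` L" "\<lambda>w. c (w + single v k)"])
    show "finite (r ` L)" using insert.prems(1) by (simp add: L_def)
    show "keys w \<subseteq> V" if "w \<in> r ` L" for w
    proof -
      obtain u' where u': "u' \<in> K" "w = r u'" using \<open>w \<in> r ` L\<close> by (auto simp: L_def)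
      have "x \<noteq> v \<and> x \<in> keys u'" if "x \<in> keys (r u')" for x
        using that unfolding in_keys_iff lr by metis
      then show ?thesis using insert.prems(2)[OF u'(1)] u'(2) by blast
    qed
    show "r u \<in> r ` L" using insert.prems(4) by (simp add: L_def k_def)
  qed (rule sub)
  then show ?case by (simp add: k_def ru)
qed

lemma zp_vanishing:
  assumes "\<And>pt :: 'v \<Rightarrow> int. pev pt Q = 0"
  shows "Q = 0"
proof (rule ccontr)
  assume "Q \<noteq> 0"
  then obtain u where u: "u \<in> keys Q" by (metis all_not_in_conv keys_eq_empty)
  have "lookup Q u = 0"
    by (rule vanishing_aux[of "\<Union>(keys ` keys Q)" "keys Q"])
       (use assms u in \<open>auto simp: pev_def\<close>)
  then show False using u by (simp add: in_keys_iff)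
qed

section \<open>Truncation to finitely many variables\<close>

definition eN :: "nat \<Rightarrow> idx \<Rightarrow> idx zp" where
  "eN N v = gesym (Suc (snd v)) {..<N} (\<lambda>j. Var (fst v, j))"

lemma iota_Var: "iota (Var v) = xmon (single v 1)"
  by (simp add: iota_def)

lemma iota_inj: "iota p = iota q \<Longrightarrow> p = q"
  by (metis cf_iota poly_mapping_eqI)

abbreviation box :: "nat \<Rightarrow> nat \<Rightarrow> idx set" where
  "box R N \<equiv> {..<R} \<times> {..<N}"

lemma resv_lam_MM:
  assumes "i < R"
  shows "resv (box R N) (lam n (MM i)) = iota (gesym n {..<N} (\<lambda>j. Var (i, j)))"
proof -
  have "{j. (i, j) \<in> box R N} = {..<N}" using assms by auto
  then show ?thesis
    by (subst resv_ee) (simp_all add: gesym_rhom[OF rhom_iota] iota_Var)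
qed

text \<open>The bridge from series to integer points: in a box each \<open>ee\<close> becomes the
  elementary symmetric polynomial \<open>eN\<close>, so the truncated series is the image of a
  polynomial.\<close>

lemma resv_Phi:
  assumes "\<And>\<mu> v. \<mu> \<in> keys p \<Longrightarrow> v \<in> keys \<mu> \<Longrightarrow> fst v < R"
  shows "resv (box R N) (Phi p) = iota (pev (eN N) p)"
proof -
  have "resv (box R N) (Phi p) = pev (\<lambda>v. resv (box R N) (ee v)) p"
    by (rule rhom_pev_comp[OF rhom_resv])
  also have "\<dots> = pev (\<lambda>v. iota (eN N v)) p"
    by (rule pev_cong) (simp add: ee_def eN_def resv_lam_MM assms)
  also have "\<dots> = iota (pev (eN N) p)"
    by (rule rhom_pev_comp[OF rhom_iota, symmetric])
  finally show ?thesis .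
qed

lemma pev_pev_eN: "pev pt (pev (eN N) p) = pev (\<lambda>v. gesym (Suc (snd v)) {..<N} (\<lambda>j. pt (fst v, j))) p"
  by (simp add: rhom_pev_comp[OF rhom_pev] eN_def gesym_rhom[OF rhom_pev])

text \<open>This is the algebraic independence of the first \<open>N\<close> elementary symmetric
  polynomials in \<open>N\<close> variables per row. The leading monomial from
  \<open>Phi_lead\<close> has no column beyond those of the variables of \<open>p\<close>, so it
  lies in the box and survives truncation.\<close>

lemma poly_eq_0_by_points:
  assumes "\<And>\<mu> v. \<mu> \<in> keys p \<Longrightarrow> v \<in> keys \<mu> \<Longrightarrow> fst v < R \<and> snd v < N"
    and "\<And>pt :: idx \<Rightarrow> int. pev (\<lambda>v. gesym (Suc (snd v)) {..<N} (\<lambda>j. pt (fst v, j))) p = 0"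
  shows "p = 0"
proof (rule ccontr)
  assume "p \<noteq> 0"
  then obtain \<mu> where \<mu>: "\<mu> \<in> keys p" "cf (Phi p) (lead \<mu>) \<noteq> 0" using Phi_lead by blast
  have "keys (lead \<mu>) \<subseteq> box R N"
  proof
    fix x assume x: "x \<in> keys (lead \<mu>)"
    obtain i j where ij: "x = (i, j)" by (cases x)
    have nz: "(\<Sum>p\<in>keys \<mu>. if fst p = i \<and> j \<le> snd p then lookup \<mu> p else 0) \<noteq> 0"
      using x by (simp add: ij in_keys_iff lookup_lead)
    have "\<exists>v\<in>keys \<mu>. fst v = i \<and> j \<le> snd v"
    proof (rule ccontr)
      assume "\<not> (\<exists>v\<in>keys \<mu>. fst v = i \<and> j \<le> snd v)"
      then have "(\<Sum>p\<in>keys \<mu>. if fst p = i \<and> j \<le> snd p then lookup \<mu> p else 0) = 0"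
        by (intro sum.neutral ballI if_not_P) blast
      with nz show False by contradiction
    qed
    then obtain v where "v \<in> keys \<mu>" "fst v = i" "j \<le> snd v" by blast
    then show "x \<in> box R N" using assms(1)[OF \<mu>(1)] by (fastforce simp: ij)
  qed
  then have "cf (resv (box R N) (Phi p)) (lead \<mu>) \<noteq> 0" using \<mu>(2) by (simp add: cf_resv)
  moreover have "pev (eN N) p = 0"
    by (rule zp_vanishing) (simp add: pev_pev_eN assms(2))
  ultimately show False
    using resv_Phi[of p R N] assms(1) by (simp add: rhom_zero[OF rhom_iota])
qed

text \<open>Restricted to two rows of \<open>n\<close> columns, the product of \<open>MM 0\<close>
  and \<open>MM 1\<close> is a sum of n^2 monomials, on which lambda_n is an elementary symmetric
  polynomial.\<close>

lemma qm_points: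
  fixes pt :: "idx \<Rightarrow> int"
  shows "pev (\<lambda>v. gesym (Suc (snd v)) {..<n} (\<lambda>j. pt (fst v, j))) (qm n) =
    gesym n ({..<n} \<times> {..<n}) (\<lambda>(j, k). pt (0, j) * pt (1, k))"
proof -
  let ?V = "box 2 n"
  have "iota (pev (eN n) (qm n)) = resv ?V (lam n (MM 0 * MM 1))"
    using resv_Phi[of "qm n" 2 n] vars_qm by (simp add: Phi_qm)
  also have "\<dots> = lam n (resv ?V (lam 1 (MM 0)) * resv ?V (lam 1 (MM 1)))"
    by (simp add: lam_resv[symmetric] rhom_mult[OF rhom_resv])
  also have "resv ?V (lam 1 (MM 0)) * resv ?V (lam 1 (MM 1)) =
     (\<Sum>j<n. xmon (single (0, j) 1)) * (\<Sum>k<n. xmon (single (1, k) 1))"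
  proof -
    have "{j. (0, j) \<in> ?V} = {..<n}" "{j. (1, j) \<in> ?V} = {..<n}" by auto
    then show ?thesis by (simp add: resv_MM)
  qed
  also have "\<dots> = (\<Sum>p\<in>{..<n} \<times> {..<n}. xmon (single (0, fst p) 1 + single (1, snd p) 1))"
    unfolding sum_product by (simp add: sum.cartesian_product xmon_mult case_prod_unfold)
  also have "lam n \<dots> = gesym n ({..<n} \<times> {..<n}) (\<lambda>p. xmon (single (0, fst p) 1 + single (1, snd p) 1))"
    by (rule lam_sum_xmon) simp
  also have "\<dots> = iota (gesym n ({..<n} \<times> {..<n}) (\<lambda>p. Var (0, fst p) * Var (1, snd p)))"
    by (simp add: gesym_rhom[OF rhom_iota] rhom_mult[OF rhom_iota] iota_Var xmon_mult)
  finally have "pev (eN n) (qm n) = gesym n ({..<n} \<times> {..<n}) (\<lambda>p. Var (0, fst p) * Var (1, snd p))"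
    by (rule iota_inj)
  then have "pev pt (pev (eN n) (qm n)) =
      gesym n ({..<n} \<times> {..<n}) (\<lambda>p. pt (0, fst p) * pt (1, snd p))"
    by (simp add: gesym_rhom[OF rhom_pev] rhom_mult[OF rhom_pev])
  then show ?thesis by (simp add: pev_pev_eN case_prod_unfold)
qed

text \<open>After truncation lambda_n of \<open>MM i\<close> is a sum of squarefree monomials
  indexed by the n-subsets of the columns, so lambda_m of it is an elementary symmetric polynomial
  of these.\<close>

lemma ql_points:
  fixes pt :: "idx \<Rightarrow> int"
  shows "pev (\<lambda>v. gesym (Suc (snd v)) {..<N} (\<lambda>j. pt (fst v, j))) (ql i m n) =
    gesym m {S. S \<subseteq> {..<N} \<and> card S = n} (\<lambda>S. \<Prod>j\<in>S. pt (i, j))"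
proof -
  let ?V = "box (Suc i) N" and ?W = "{S. S \<subseteq> {..<N} \<and> card S = n}"
  have fin: "finite S" if "S \<in> ?W" for S using that finite_subset by auto
  have xm: "iota (\<Prod>j\<in>S. Var (i, j)) = xmon (sq i S)" if "S \<in> ?W" for S
    using prod_xmon_sq[OF fin[OF that], of i] by (simp add: rhom_prod[OF rhom_iota] iota_Var)
  have "iota (pev (eN N) (ql i m n)) = resv ?V (lam m (lam n (MM i)))"
    using resv_Phi[of "ql i m n" "Suc i" N] vars_ql by (simp add: Phi_ql)
  also have "\<dots> = lam m (iota (gesym n {..<N} (\<lambda>j. Var (i, j))))"
    by (simp add: lam_resv[symmetric] resv_lam_MM[symmetric, of i "Suc i"])
  also have "iota (gesym n {..<N} (\<lambda>j. Var (i, j))) = (\<Sum>S\<in>?W. xmon (sq i S))"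
    unfolding gesym_def rhom_sum[OF rhom_iota] by (rule sum.cong) (simp_all add: xm)
  also have "lam m \<dots> = gesym m ?W (\<lambda>S. xmon (sq i S))"
    by (rule lam_sum_xmon) simp
  also have "\<dots> = iota (gesym m ?W (\<lambda>S. \<Prod>j\<in>S. Var (i, j)))"
    unfolding gesym_rhom[OF rhom_iota] by (rule gesym_cong) (simp add: xm)
  finally have "pev (eN N) (ql i m n) = gesym m ?W (\<lambda>S. \<Prod>j\<in>S. Var (i, j))"
    by (rule iota_inj)
  then have "pev pt (pev (eN N) (ql i m n)) = gesym m ?W (\<lambda>S. \<Prod>j\<in>S. pt (i, j))"
    by (simp add: gesym_rhom[OF rhom_pev] rhom_prod[OF rhom_pev])
  then show ?thesis by (simp add: pev_pev_eN)
qed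

subsection \<open>Evaluation in rings given by a carrier\<close>

text \<open>\<open>cev\<close>, \<open>cpev\<close> and \<open>chom\<close> repeat
  \<open>mev\<close>, \<open>pev\<close> and \<open>rhom\<close> for rings given by a carrier, the
  form in which \<open>R\<close> and \<open>PS_ring\<close> appear.\<close>

definition cev :: "('a, 'b) ring_scheme \<Rightarrow> ('v \<Rightarrow> 'a) \<Rightarrow> ('v \<Rightarrow>\<^sub>0 nat) \<Rightarrow> 'a" where
  "cev R \<theta> u = finprod R (\<lambda>v. \<theta> v [^]\<^bsub>R\<^esub> lookup u v) (keys u)"

definition cpev :: "('a, 'b) ring_scheme \<Rightarrow> ('v \<Rightarrow> 'a) \<Rightarrow> 'v zp \<Rightarrow> 'a" where
  "cpev R \<theta> p = finsum R (\<lambda>u. add_pow R (lookup p u) (cev R \<theta> u)) (keys p)"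

definition chom :: "('a, 'b) ring_scheme \<Rightarrow> ('c::comm_ring_1 \<Rightarrow> 'a) \<Rightarrow> bool" where
  "chom R F \<longleftrightarrow> (\<forall>x. F x \<in> carrier R) \<and> (\<forall>x y. F (x + y) = F x \<oplus>\<^bsub>R\<^esub> F y) \<and>
     (\<forall>x y. F (x * y) = F x \<otimes>\<^bsub>R\<^esub> F y) \<and> F 1 = \<one>\<^bsub>R\<^esub>"

lemma chomD:
  assumes "chom R F"
  shows "F x \<in> carrier R" "F (x + y) = F x \<oplus>\<^bsub>R\<^esub> F y" "F (x * y) = F x \<otimes>\<^bsub>R\<^esub> F y" "F 1 = \<one>\<^bsub>R\<^esub>"
  using assms unfolding chom_def by blast+

context cring
begin

lemma add_pow_int_0 [simp]: "add_pow R (0 :: int) x = \<zero>"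
  by (simp add: add_pow_def)

lemma cev_superset:
  assumes "finite A" "keys u \<subseteq> A" "\<And>v. \<theta> v \<in> carrier R"
  shows "cev R \<theta> u = finprod R (\<lambda>v. \<theta> v [^] lookup u v) A"
  unfolding cev_def
  by (rule finprod_mono_neutral_cong_left) (use assms in \<open>auto simp: in_keys_iff\<close>)

lemma cev_closed [simp]: "(\<And>v. \<theta> v \<in> carrier R) \<Longrightarrow> cev R \<theta> u \<in> carrier R"
  unfolding cev_def by (rule finprod_closed) auto

lemma cpev_superset:
  assumes "finite A" "keys p \<subseteq> A" "\<And>v. \<theta> v \<in> carrier R"
  shows "cpev R \<theta> p = finsum R (\<lambda>u. add_pow R (lookup p u) (cev R \<theta> u)) A"
  unfolding cpev_def
  by (rule add.finprod_mono_neutral_cong_left) (use assms in \<open>auto simp: in_keys_iff\<close>)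

lemma cev_add:
  assumes "\<And>v. \<theta> v \<in> carrier R"
  shows "cev R \<theta> (u + w) = cev R \<theta> u \<otimes> cev R \<theta> w"
proof -
  let ?A = "keys u \<union> keys w"
  have "cev R \<theta> (u + w) = finprod R (\<lambda>v. \<theta> v [^] lookup u v \<otimes> \<theta> v [^] lookup w v) ?A"
    using assms by (subst cev_superset[of ?A]) (simp_all add: keys_add_nat lookup_add nat_pow_mult)
  also have "\<dots> = finprod R (\<lambda>v. \<theta> v [^] lookup u v) ?A \<otimes> finprod R (\<lambda>v. \<theta> v [^] lookup w v) ?A"
    by (rule finprod_multf) (use assms in auto)
  also have "\<dots> = cev R \<theta> u \<otimes> cev R \<theta> w"
    using assms cev_superset[of ?A u \<theta>] cev_superset[of ?A w \<theta>] by simp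
  finally show ?thesis .
qed

lemma cpev_single:
  assumes "\<And>v. \<theta> v \<in> carrier R"
  shows "cpev R \<theta> (single u c) = add_pow R c (cev R \<theta> u)"
  using assms by (subst cpev_superset[of "{u}"]) auto

lemma cpev_closed: "(\<And>v. \<theta> v \<in> carrier R) \<Longrightarrow> cpev R \<theta> p \<in> carrier R"
  unfolding cpev_def by (rule finsum_closed) auto

lemma cpev_add:
  assumes "\<And>v. \<theta> v \<in> carrier R"
  shows "cpev R \<theta> (p + q) = cpev R \<theta> p \<oplus> cpev R \<theta> q"
proof -
  let ?A = "keys p \<union> keys q"
  have "keys (p + q) \<subseteq> ?A" by (rule Poly_Mapping.keys_add)
  then have "cpev R \<theta> (p + q) =
      finsum R (\<lambda>u. add_pow R (lookup p u) (cev R \<theta> u) \<oplus> add_pow R (lookup q u) (cev R \<theta> u)) ?A"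
    using assms by (subst cpev_superset[of ?A]) (simp_all add: lookup_add add.int_pow_mult)
  also have "\<dots> = finsum R (\<lambda>u. add_pow R (lookup p u) (cev R \<theta> u)) ?A \<oplus>
      finsum R (\<lambda>u. add_pow R (lookup q u) (cev R \<theta> u)) ?A"
    by (rule finsum_addf) (use assms in auto)
  also have "\<dots> = cpev R \<theta> p \<oplus> cpev R \<theta> q"
    using assms cpev_superset[of ?A p \<theta>] cpev_superset[of ?A q \<theta>] by simp
  finally show ?thesis .
qed

lemma chom_cpev:
  assumes \<theta>: "\<And>v. \<theta> v \<in> carrier R"
  shows "chom R (cpev R \<theta>)"
  unfolding chom_def
proof (intro conjI allI)
  note cl = cpev_closed[of \<theta>, OF \<theta>] and ce = cev_closed[of \<theta>, OF \<theta>]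
  have ss: "cpev R \<theta> (single u c * single w d) = cpev R \<theta> (single u c) \<otimes> cpev R \<theta> (single w d)" for u w c d
  proof -
    have "cpev R \<theta> (single u c) \<otimes> cpev R \<theta> (single w d) =
        add_pow R c (cev R \<theta> u \<otimes> add_pow R d (cev R \<theta> w))"
      unfolding cpev_single[of \<theta>, OF \<theta>] by (rule add_pow_ldistr_int) (use ce in auto)
    also have "cev R \<theta> u \<otimes> add_pow R d (cev R \<theta> w) = add_pow R d (cev R \<theta> u \<otimes> cev R \<theta> w)"
      by (rule add_pow_rdistr_int) (use ce in auto)
    also have "add_pow R c \<dots> = add_pow R (d * c) (cev R \<theta> u \<otimes> cev R \<theta> w)"
      by (rule add.int_pow_pow) (use ce in auto)
    finally show ?thesis
      by (simp add: mult_single cpev_single[of \<theta>, OF \<theta>] cev_add[of \<theta>, OF \<theta>] mult.commute)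
  qed
  fix p q
  show "cpev R \<theta> (p * q) = cpev R \<theta> p \<otimes> cpev R \<theta> q"
  proof (induction p rule: zp_induct)
    case (single u c)
    show ?case
      by (induction q rule: zp_induct)
         (simp_all add: ss distrib_left cpev_add[of \<theta>, OF \<theta>] r_distr cl)
  qed (simp add: distrib_right cpev_add[of \<theta>, OF \<theta>] l_distr cl)
  show "cpev R \<theta> (p + q) = cpev R \<theta> p \<oplus> cpev R \<theta> q" by (rule cpev_add[of \<theta>, OF \<theta>])
  show "cpev R \<theta> p \<in> carrier R" by (rule cl)
  have "cpev R \<theta> (single 0 1) = \<one>"
    unfolding cpev_single[of \<theta>, OF \<theta>] by (simp add: cev_def)
  then show "cpev R \<theta> 1 = \<one>" by simp
qed

lemma cpev_Var:
  assumes "\<And>v. \<theta> v \<in> carrier R"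
  shows "cpev R \<theta> (Var v) = \<theta> v"
proof -
  have "cev R \<theta> (single v 1) = \<theta> v"
    using assms by (subst cev_superset[of "{v}"]) auto
  then show ?thesis unfolding Var_def using cpev_single[of \<theta>, OF assms] assms by simp
qed

lemma cpev_cong:
  assumes "\<And>u v. u \<in> keys p \<Longrightarrow> v \<in> keys u \<Longrightarrow> \<theta> v = \<tau> v" "\<And>v. \<tau> v \<in> carrier R"
  shows "cpev R \<theta> p = cpev R \<tau> p"
proof -
  have "cev R \<theta> u = cev R \<tau> u" if "u \<in> keys p" for u
    unfolding cev_def by (rule finprod_cong') (use assms that in auto)
  then show ?thesis
    unfolding cpev_def by (intro finsum_cong') (use assms in auto)
qed

lemma chom_zero: "chom R F \<Longrightarrow> F 0 = \<zero>"
  using chomD(1)[of R F 0] chomD(2)[of R F 0 0] by (simp add: add.r_cancel_one')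

lemma chom_uminus: assumes "chom R F" shows "F (- x) = \<ominus> F x"
proof -
  have "F (- x) \<oplus> F x = \<zero>" using chomD(2)[OF assms, of "- x" x] chom_zero[OF assms] by simp
  then show ?thesis using chomD(1)[OF assms] by (simp add: minus_equality)
qed

lemma chom_of_nat: assumes "chom R F" shows "F (of_nat n * x) = add_pow R (int n) (F x)"
proof (induction n)
  case (Suc n)
  have "F (of_nat (Suc n) * x) = F x \<oplus> F (of_nat n * x)"
    using chomD(2)[OF assms] by (simp add: distrib_right)
  also have "\<dots> = add_pow R (1 + int n) (F x)"
    using chomD(1)[OF assms, of x] by (simp only: Suc add.int_pow_mult add.int_pow_1)
  finally show ?case by simp
qed (simp add: chom_zero[OF assms])

lemma chom_of_int: assumes "chom R F" shows "F (of_int c * x) = add_pow R c (F x)"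
proof (cases c rule: int_cases2)
  case (nonneg n)
  then show ?thesis using chom_of_nat[OF assms] by simp
next
  case (nonpos n)
  have "F (of_int c * x) = \<ominus> F (of_nat n * x)"
    using chom_uminus[OF assms] by (simp add: nonpos)
  then show ?thesis
    unfolding chom_of_nat[OF assms] nonpos
    using chomD(1)[OF assms, of x] by (simp add: add.int_pow_neg a_inv_def)
qed

lemma chom_power: assumes "chom R F" shows "F (x ^ n) = F x [^] n"
  by (induction n) (use chomD[OF assms] in \<open>simp_all add: m_comm\<close>)

lemma chom_prod: assumes "chom R F" shows "F (prod f A) = finprod R (\<lambda>x. F (f x)) A"
  by (induction A rule: infinite_finite_induct) (use chomD[OF assms] in simp_all)

lemma chom_sum: assumes "chom R F" shows "F (sum f A) = finsum R (\<lambda>x. F (f x)) A"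
  by (induction A rule: infinite_finite_induct)
     (use chomD[OF assms] chom_zero[OF assms] in simp_all)

lemma chom_pev:
  assumes "chom R F"
  shows "F (pev \<theta> p) = cpev R (\<lambda>v. F (\<theta> v)) p"
  unfolding pev_def cpev_def cev_def mev_def
  by (simp add: chom_sum[OF assms] chom_of_int[OF assms] chom_prod[OF assms] chom_power[OF assms])

lemma chom_eq_cpev:
  assumes "chom R F"
  shows "F p = cpev R (\<lambda>v. F (Var v)) p"
proof -
  have "pev Var p = p" using rhom_eq_pev[of "\<lambda>p. p", of p] by (simp add: rhom_def)
  then show ?thesis using chom_pev[OF assms, of Var p] by simp
qed

end

subsection \<open>The universal polynomials of the definition of special lambda-rings\<close>

text \<open>Polynomials in the sense of \<^const>\<open>is_ipoly\<close> are identified with elements of \<^typ>\<open>'w zp\<close> along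
  an injection \<open>\<rho>\<close> of the finite set \<open>V\<close> of variables that occur.\<close>

definition spread :: "('w \<Rightarrow> 'v) \<Rightarrow> 'w set \<Rightarrow> ('w \<Rightarrow>\<^sub>0 nat) \<Rightarrow> 'v \<Rightarrow> nat" where
  "spread \<rho> V \<mu> = (\<lambda>x. if x \<in> \<rho> ` V then lookup \<mu> (the_inv_into V \<rho> x) else 0)"

definition gather :: "('w \<Rightarrow> 'v) \<Rightarrow> 'w set \<Rightarrow> ('v \<Rightarrow> nat) \<Rightarrow> ('w \<Rightarrow>\<^sub>0 nat)" where
  "gather \<rho> V m = Abs_poly_mapping (\<lambda>w. if w \<in> V then m (\<rho> w) else 0)"

definition toip :: "('w \<Rightarrow> 'v) \<Rightarrow> 'w set \<Rightarrow> 'w zp \<Rightarrow> ('v \<Rightarrow> nat) \<Rightarrow> int" where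
  "toip \<rho> V q = (\<lambda>m. if {x. m x \<noteq> 0} \<subseteq> \<rho> ` V then lookup q (gather \<rho> V m) else 0)"

definition fromip :: "('w \<Rightarrow> 'v) \<Rightarrow> 'w set \<Rightarrow> (('v \<Rightarrow> nat) \<Rightarrow> int) \<Rightarrow> 'w zp" where
  "fromip \<rho> V p = Abs_poly_mapping (\<lambda>\<mu>. if keys \<mu> \<subseteq> V then p (spread \<rho> V \<mu>) else 0)"

context
  fixes \<rho> :: "'w \<Rightarrow> 'v" and V :: "'w set"
  assumes fin: "finite V" and inj: "inj_on \<rho> V"
begin

lemma spread_rho: "w \<in> V \<Longrightarrow> spread \<rho> V \<mu> (\<rho> w) = lookup \<mu> w"
  using inj by (simp add: spread_def the_inv_into_f_f)

lemma spread_out: "x \<notin> \<rho> ` V \<Longrightarrow> spread \<rho> V \<mu> x = 0"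
  by (simp add: spread_def)

lemma lookup_gather: "lookup (gather \<rho> V m) w = (if w \<in> V then m (\<rho> w) else 0)"
proof -
  have "finite {w. (if w \<in> V then m (\<rho> w) else 0) \<noteq> 0}"
    by (rule finite_subset[OF _ fin]) auto
  then show ?thesis by (simp add: gather_def)
qed

lemma gather_spread: "keys \<mu> \<subseteq> V \<Longrightarrow> gather \<rho> V (spread \<rho> V \<mu>) = \<mu>"
  by (intro poly_mapping_eqI) (auto simp: lookup_gather spread_rho in_keys_iff)

lemma spread_gather: "{x. m x \<noteq> 0} \<subseteq> \<rho> ` V \<Longrightarrow> spread \<rho> V (gather \<rho> V m) = m"
proof (rule ext)
  fix x assume "{x. m x \<noteq> 0} \<subseteq> \<rho> ` V"
  then show "spread \<rho> V (gather \<rho> V m) x = m x"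
    by (cases "x \<in> \<rho> ` V") (auto simp: spread_rho spread_out lookup_gather)
qed

lemma supp_spread: "keys \<mu> \<subseteq> V \<Longrightarrow> {x. spread \<rho> V \<mu> x \<noteq> 0} = \<rho> ` keys \<mu>"
proof (intro subset_antisym subsetI)
  fix x assume "keys \<mu> \<subseteq> V" "x \<in> {x. spread \<rho> V \<mu> x \<noteq> 0}"
  then have nz: "spread \<rho> V \<mu> x \<noteq> 0" by simp
  then have "x \<in> \<rho> ` V" using spread_out by metis
  then obtain w where "w \<in> V" "x = \<rho> w" by blast
  then show "x \<in> \<rho> ` keys \<mu>" using nz by (simp add: spread_rho in_keys_iff)
next
  fix x assume "keys \<mu> \<subseteq> V" "x \<in> \<rho> ` keys \<mu>"
  then obtain w where "w \<in> V" "w \<in> keys \<mu>" "x = \<rho> w" by blast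
  then show "x \<in> {x. spread \<rho> V \<mu> x \<noteq> 0}" by (simp add: spread_rho in_keys_iff)
qed

lemma inj_spread: "inj_on (spread \<rho> V) {\<mu>. keys \<mu> \<subseteq> V}"
  by (rule inj_on_inverseI[where g = "gather \<rho> V"]) (simp add: gather_spread)

lemma lookup_fromip:
  assumes "is_ipoly p"
  shows "lookup (fromip \<rho> V p) \<mu> = (if keys \<mu> \<subseteq> V then p (spread \<rho> V \<mu>) else 0)"
proof -
  let ?S = "{\<mu>. (if keys \<mu> \<subseteq> V then p (spread \<rho> V \<mu>) else 0) \<noteq> 0}"
  have "?S \<subseteq> gather \<rho> V ` {m. p m \<noteq> 0}"
  proof
    fix \<mu> assume "\<mu> \<in> ?S"
    then have "keys \<mu> \<subseteq> V" "p (spread \<rho> V \<mu>) \<noteq> 0" by (auto split: if_splits)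
    then show "\<mu> \<in> gather \<rho> V ` {m. p m \<noteq> 0}"
      using gather_spread by (intro image_eqI[of _ _ "spread \<rho> V \<mu>"]) auto
  qed
  then have "finite ?S" using assms unfolding is_ipoly_def by (meson finite_imageI finite_subset)
  then show ?thesis by (simp add: fromip_def)
qed

lemma keys_fromip:
  assumes "is_ipoly p"
  shows "\<mu> \<in> keys (fromip \<rho> V p) \<Longrightarrow> keys \<mu> \<subseteq> V"
  using lookup_fromip[OF assms, of \<mu>] by (auto simp: in_keys_iff split: if_splits)

lemma supp_ipoly:
  assumes "is_ipoly p" "ipoly_vars p \<subseteq> \<rho> ` V"
  shows "{m. p m \<noteq> 0} = spread \<rho> V ` keys (fromip \<rho> V p)"
proof (intro subset_antisym subsetI)
  fix m assume "m \<in> {m. p m \<noteq> 0}"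
  then have m: "p m \<noteq> 0" by simp
  then have "{x. m x \<noteq> 0} \<subseteq> \<rho> ` V" using assms(2) by (auto simp: ipoly_vars_def)
  then have *: "spread \<rho> V (gather \<rho> V m) = m" by (rule spread_gather)
  have "keys (gather \<rho> V m) \<subseteq> V" by (auto simp: in_keys_iff lookup_gather split: if_splits)
  then have "gather \<rho> V m \<in> keys (fromip \<rho> V p)"
    using m by (simp add: in_keys_iff lookup_fromip[OF assms(1)] *)
  then show "m \<in> spread \<rho> V ` keys (fromip \<rho> V p)" using * by (metis imageI)
next
  fix m assume "m \<in> spread \<rho> V ` keys (fromip \<rho> V p)"
  then obtain \<mu> where "\<mu> \<in> keys (fromip \<rho> V p)" "m = spread \<rho> V \<mu>" by blast
  then show "m \<in> {m. p m \<noteq> 0}"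
    using lookup_fromip[OF assms(1), of \<mu>] by (auto simp: in_keys_iff split: if_splits)
qed

lemma inj_spread_keys:
  "is_ipoly p \<Longrightarrow> inj_on (spread \<rho> V) (keys (fromip \<rho> V p))"
  by (rule inj_on_subset[OF inj_spread]) (use keys_fromip in blast)

lemma ieval_eq_pev:
  assumes "is_ipoly p" "ipoly_vars p \<subseteq> \<rho> ` V"
  shows "ieval s p = pev (\<lambda>w. s (\<rho> w)) (fromip \<rho> V p)"
proof -
  have prod: "(\<Prod>x\<in>{x. spread \<rho> V \<mu> x \<noteq> 0}. s x ^ spread \<rho> V \<mu> x) = mev (\<lambda>w. s (\<rho> w)) \<mu>"
    if "\<mu> \<in> keys (fromip \<rho> V p)" for \<mu>
  proof -
    have \<mu>: "keys \<mu> \<subseteq> V" by (rule keys_fromip[OF assms(1) that])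
    show ?thesis
      unfolding supp_spread[OF \<mu>] mev_def prod.reindex[OF inj_on_subset[OF inj \<mu>]]
      by (rule prod.cong) (use \<mu> in \<open>auto simp: spread_rho\<close>)
  qed
  show ?thesis
    unfolding ieval_def supp_ipoly[OF assms] sum.reindex[OF inj_spread_keys[OF assms(1)]] pev_def
  proof (rule sum.cong)
    fix \<mu> assume \<mu>: "\<mu> \<in> keys (fromip \<rho> V p)"
    then have "lookup (fromip \<rho> V p) \<mu> = p (spread \<rho> V \<mu>)"
      using lookup_fromip[OF assms(1)] keys_fromip[OF assms(1)] by simp
    then show "((\<lambda>m. p m * (\<Prod>v\<in>{v. m v \<noteq> 0}. s v ^ m v)) \<circ> spread \<rho> V) \<mu> =
        of_int (lookup (fromip \<rho> V p) \<mu>) * mev (\<lambda>w. s (\<rho> w)) \<mu>"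
      using prod[OF \<mu>] by simp
  qed simp
qed

lemma reval_eq_cpev:
  fixes R :: "('a, 'b) ring_scheme" (structure)
  assumes "is_ipoly p" "ipoly_vars p \<subseteq> \<rho> ` V" "cring R" "\<And>v. s v \<in> carrier R"
  shows "reval R s p = cpev R (\<lambda>w. s (\<rho> w)) (fromip \<rho> V p)"
proof -
  interpret cring R by fact
  have prod: "finprod R (\<lambda>x. s x [^] spread \<rho> V \<mu> x) {x. spread \<rho> V \<mu> x \<noteq> 0} = cev R (\<lambda>w. s (\<rho> w)) \<mu>"
    if "\<mu> \<in> keys (fromip \<rho> V p)" for \<mu>
  proof -
    have \<mu>: "keys \<mu> \<subseteq> V" by (rule keys_fromip[OF assms(1) that])
    have "finprod R (\<lambda>x. s x [^] spread \<rho> V \<mu> x) (\<rho> ` keys \<mu>) =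
        finprod R (\<lambda>w. s (\<rho> w) [^] spread \<rho> V \<mu> (\<rho> w)) (keys \<mu>)"
      by (rule finprod_reindex) (use assms(4) inj_on_subset[OF inj \<mu>] in auto)
    also have "\<dots> = cev R (\<lambda>w. s (\<rho> w)) \<mu>"
      unfolding cev_def by (rule finprod_cong') (use \<mu> assms(4) in \<open>auto simp: spread_rho\<close>)
    finally show ?thesis unfolding supp_spread[OF \<mu>] .
  qed
  let ?t = "\<lambda>m. add_pow R (p m) (finprod R (\<lambda>x. s x [^] m x) {x. m x \<noteq> 0})"
  have "reval R s p = finsum R (\<lambda>\<mu>. ?t (spread \<rho> V \<mu>)) (keys (fromip \<rho> V p))"
    unfolding reval_def supp_ipoly[OF assms(1,2)]
    by (rule finsum_reindex) (use assms(4) inj_spread_keys[OF assms(1)] in auto)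
  also have "\<dots> = cpev R (\<lambda>w. s (\<rho> w)) (fromip \<rho> V p)"
    unfolding cpev_def
  proof (rule finsum_cong')
    fix \<mu> assume \<mu>: "\<mu> \<in> keys (fromip \<rho> V p)"
    then have "lookup (fromip \<rho> V p) \<mu> = p (spread \<rho> V \<mu>)"
      using lookup_fromip[OF assms(1)] keys_fromip[OF assms(1)] by simp
    then show "?t (spread \<rho> V \<mu>) = add_pow R (lookup (fromip \<rho> V p) \<mu>) (cev R (\<lambda>w. s (\<rho> w)) \<mu>)"
      using prod[OF \<mu>] by simp
  qed (use assms(4) in auto)
  finally show ?thesis .
qed

lemma toip_fromip:
  assumes "is_ipoly p" "ipoly_vars p \<subseteq> \<rho> ` V"
  shows "toip \<rho> V (fromip \<rho> V p) = p"
proof (rule ext)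
  fix m
  have "keys (gather \<rho> V m) \<subseteq> V" by (auto simp: in_keys_iff lookup_gather split: if_splits)
  then show "toip \<rho> V (fromip \<rho> V p) m = p m"
    using assms(2) by (auto simp: toip_def lookup_fromip[OF assms(1)] spread_gather ipoly_vars_def)
qed

lemma toip_props:
  assumes "\<And>\<mu>. \<mu> \<in> keys q \<Longrightarrow> keys \<mu> \<subseteq> V"
  shows "is_ipoly (toip \<rho> V q)" "ipoly_vars (toip \<rho> V q) \<subseteq> \<rho> ` V" "fromip \<rho> V (toip \<rho> V q) = q"
proof -
  have "{m. toip \<rho> V q m \<noteq> 0} \<subseteq> spread \<rho> V ` keys q"
  proof
    fix m assume "m \<in> {m. toip \<rho> V q m \<noteq> 0}"
    then have "{x. m x \<noteq> 0} \<subseteq> \<rho> ` V" "lookup q (gather \<rho> V m) \<noteq> 0"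
      by (auto simp: toip_def split: if_splits)
    then show "m \<in> spread \<rho> V ` keys q"
      using spread_gather by (intro image_eqI[of _ _ "gather \<rho> V m"]) (auto simp: in_keys_iff)
  qed
  then have "finite {m. toip \<rho> V q m \<noteq> 0}" by (rule finite_subset) simp
  moreover have supp: "{x. m x \<noteq> 0} \<subseteq> \<rho> ` V" if "toip \<rho> V q m \<noteq> 0" for m
    using that by (auto simp: toip_def split: if_splits)
  ultimately show ip: "is_ipoly (toip \<rho> V q)"
    unfolding is_ipoly_def using finite_subset[OF supp] fin by blast
  show "ipoly_vars (toip \<rho> V q) \<subseteq> \<rho> ` V" unfolding ipoly_vars_def using supp by blast
  show "fromip \<rho> V (toip \<rho> V q) = q"
  proof (rule poly_mapping_eqI)
    fix \<mu>
    have sub: "{x. spread \<rho> V \<mu> x \<noteq> 0} \<subseteq> \<rho> ` V"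
      by (rule subsetI, rule ccontr) (simp add: spread_out)
    show "lookup (fromip \<rho> V (toip \<rho> V q)) \<mu> = lookup q \<mu>"
    proof (cases "keys \<mu> \<subseteq> V")
      case True
      then show ?thesis
        using lookup_fromip[OF ip, of \<mu>] sub gather_spread[OF True] by (simp add: toip_def)
    next
      case False
      then have "\<mu> \<notin> keys q" using assms by blast
      then show ?thesis using False by (simp add: lookup_fromip[OF ip] in_keys_iff)
    qed
  qed
qed

text \<open>\<open>s x\<close> is the substitution attached to the point \<open>x\<close>, and
  \<open>r x\<close> the value required there. Once values at such points detect zero, any
  \<open>q\<close> with the required values determines the polynomial described by
  \<open>THE\<close>, up to the renaming of variables.\<close>

lemma the_ipoly:
  assumes vars: "\<And>\<mu>. \<mu> \<in> keys q \<Longrightarrow> keys \<mu> \<subseteq> V"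
    and q: "\<And>x. pev (\<lambda>w. s x (\<rho> w)) q = r x"
    and unique: "\<And>q'. (\<And>\<mu>. \<mu> \<in> keys q' \<Longrightarrow> keys \<mu> \<subseteq> V) \<Longrightarrow>
       (\<And>x. pev (\<lambda>w. s x (\<rho> w)) q' = 0) \<Longrightarrow> q' = 0"
  defines "P \<equiv> THE p. is_ipoly p \<and> ipoly_vars p \<subseteq> \<rho> ` V \<and> (\<forall>x. ieval (s x) p = r x)"
  shows "is_ipoly P" "ipoly_vars P \<subseteq> \<rho> ` V" "fromip \<rho> V P = q"
proof -
  have "P = toip \<rho> V q"
    unfolding P_def
  proof (rule the_equality)
    show "is_ipoly (toip \<rho> V q) \<and> ipoly_vars (toip \<rho> V q) \<subseteq> \<rho> ` V \<and> (\<forall>x. ieval (s x) (toip \<rho> V q) = r x)"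
      using toip_props[of q, OF vars] by (simp add: ieval_eq_pev q)
  next
    fix p assume p: "is_ipoly p \<and> ipoly_vars p \<subseteq> \<rho> ` V \<and> (\<forall>x. ieval (s x) p = r x)"
    have "fromip \<rho> V p - q = 0"
    proof (rule unique)
      show "keys \<mu> \<subseteq> V" if "\<mu> \<in> keys (fromip \<rho> V p - q)" for \<mu>
        using subsetD[OF keys_diff that] keys_fromip[of p \<mu>] vars[of \<mu>] p by blast
      show "pev (\<lambda>w. s x (\<rho> w)) (fromip \<rho> V p - q) = 0" for x
        using p ieval_eq_pev[of p "s x"] q[of x] by (simp add: rhom_diff[OF rhom_pev])
    qed
    then show "p = toip \<rho> V q" using toip_fromip[of p] p by simp
  qed
  then show "is_ipoly P" "ipoly_vars P \<subseteq> \<rho> ` V" "fromip \<rho> V P = q"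
    using toip_props[of q, OF vars] by simp_all
qed

end

text \<open>\<open>P_mult\<close> and \<open>qm\<close> take the same values at elementary symmetric
  functions of integers. Hence they agree up to the names of the variables, and then also when
  evaluated in \<open>R\<close>.\<close>

lemma reval_P_mult:
  fixes R :: "('a, 'b) ring_scheme"
  assumes "cring R" "\<And>k. a k \<in> carrier R" "\<And>k. b k \<in> carrier R"
  shows "reval R (\<lambda>(c, k). if c then b k else a k) (P_mult n) =
    cpev R (\<lambda>v. if fst v = 0 then a (Suc (snd v)) else b (Suc (snd v))) (qm n)"
proof -
  define \<rho> :: "idx \<Rightarrow> bool \<times> nat" where "\<rho> v = (fst v \<noteq> 0, Suc (snd v))" for v
  define V where "V = box 2 n"
  define s :: "(nat \<Rightarrow> int) \<times> (nat \<Rightarrow> int) \<Rightarrow> bool \<times> nat \<Rightarrow> int"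
    where "s xy = (\<lambda>(b, k). if b then esym k {1..n} (snd xy) else esym k {1..n} (fst xy))" for xy
  define r :: "(nat \<Rightarrow> int) \<times> (nat \<Rightarrow> int) \<Rightarrow> int"
    where "r xy = esym n ({1..n} \<times> {1..n}) (\<lambda>(i, j). fst xy i * snd xy j)" for xy
  have fin: "finite V" by (simp add: V_def)
  have inj: "inj_on \<rho> V" by (auto simp: inj_on_def \<rho>_def V_def)
  have im: "\<rho> ` V = UNIV \<times> {1..n}"
  proof (intro subset_antisym subsetI)
    fix x :: "bool \<times> nat" assume "x \<in> UNIV \<times> {1..n}"
    then have "\<rho> (if fst x then 1 else 0, snd x - 1) = x" "(if fst x then 1 else 0, snd x - 1) \<in> V"
      by (auto simp: \<rho>_def V_def prod_eq_iff)
    then show "x \<in> \<rho> ` V" by (metis imageI)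
  qed (auto simp: \<rho>_def V_def)
  \<comment> \<open>The two sequences of a point, indexed from 1, become rows 0 and 1 of a single
    array indexed from 0.\<close>
  define pt where "pt xy p = (if fst p = 0 then fst xy (Suc (snd p)) else snd xy (Suc (snd p)) :: int)"
    for xy :: "(nat \<Rightarrow> int) \<times> (nat \<Rightarrow> int)" and p :: idx
  have s: "s xy (\<rho> v) = gesym (Suc (snd v)) {..<n} (\<lambda>j. pt xy (fst v, j))" for xy v
    unfolding s_def \<rho>_def esym_eq_gesym image_Suc_lessThan[symmetric] gesym_reindex[OF inj_Suc]
    by (simp add: pt_def)
  have P: "P_mult n = (THE p. is_ipoly p \<and> ipoly_vars p \<subseteq> \<rho> ` V \<and> (\<forall>x. ieval (s x) p = r x))"
    unfolding P_mult_def im s_def r_def split_paired_All fst_conv snd_conv ..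
  have vars: "keys \<mu> \<subseteq> V" if "\<mu> \<in> keys (qm n)" for \<mu>
    using vars_qm[OF that] by (auto simp: V_def)
  have q: "pev (\<lambda>w. s x (\<rho> w)) (qm n) = r x" for x
  proof -
    have "{1..n} \<times> {1..n} = map_prod Suc Suc ` ({..<n} \<times> {..<n})"
      unfolding image_Suc_lessThan[symmetric] by force
    then have "r x = gesym n (map_prod Suc Suc ` ({..<n} \<times> {..<n})) (\<lambda>p. fst x (fst p) * snd x (snd p))"
      by (simp only: r_def esym_eq_gesym case_prod_unfold)
    also have "\<dots> = gesym n ({..<n} \<times> {..<n}) (\<lambda>p. pt x (0, fst p) * pt x (1, snd p))"
      by (subst gesym_reindex) (auto simp: inj_on_def pt_def)
    finally show ?thesis unfolding s qm_points by (simp add: case_prod_unfold)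
  qed
  have unique: "q' = 0" if "\<And>\<mu>. \<mu> \<in> keys q' \<Longrightarrow> keys \<mu> \<subseteq> V" "\<And>x. pev (\<lambda>w. s x (\<rho> w)) q' = 0" for q'
  proof (rule poly_eq_0_by_points[of q' 2 n])
    show vq: "fst v < 2 \<and> snd v < n" if "\<mu> \<in> keys q'" "v \<in> keys \<mu>" for \<mu> v
      using that \<open>\<And>\<mu>. \<mu> \<in> keys q' \<Longrightarrow> keys \<mu> \<subseteq> V\<close> by (force simp: V_def)
    fix pos :: "idx \<Rightarrow> int"
    \<comment> \<open>Rows 0 and 1 of any array come from a pair of sequences, and \<open>q'\<close>
      contains no other rows.\<close>
    define xy where "xy = (\<lambda>k. pos (0, k - 1), \<lambda>k. pos (1, k - 1))"
    have "pev (\<lambda>v. gesym (Suc (snd v)) {..<n} (\<lambda>j. pos (fst v, j))) q' = pev (\<lambda>w. s xy (\<rho> w)) q'"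
    proof (rule pev_cong)
      fix \<mu> v assume "\<mu> \<in> keys q'" "v \<in> keys \<mu>"
      then have "fst v = 0 \<or> fst v = 1" using vq by fastforce
      then show "gesym (Suc (snd v)) {..<n} (\<lambda>j. pos (fst v, j)) = s xy (\<rho> v)"
        unfolding s by (intro gesym_cong) (auto simp: pt_def xy_def)
    qed
    then show "pev (\<lambda>v. gesym (Suc (snd v)) {..<n} (\<lambda>j. pos (fst v, j))) q' = 0"
      using \<open>\<And>x. pev (\<lambda>w. s x (\<rho> w)) q' = 0\<close> by simp
  qed
  have the: "is_ipoly (P_mult n)" "ipoly_vars (P_mult n) \<subseteq> \<rho> ` V" "fromip \<rho> V (P_mult n) = qm n"
    unfolding P by (rule the_ipoly[OF fin inj vars q unique]; blast)+
  have cl: "(case v of (c, k) \<Rightarrow> if c then b k else a k) \<in> carrier R" for v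
    using assms(2,3) by (simp split: prod.splits)
  have "reval R (\<lambda>(c, k). if c then b k else a k) (P_mult n) =
     cpev R (\<lambda>w. case \<rho> w of (c, k) \<Rightarrow> if c then b k else a k) (fromip \<rho> V (P_mult n))"
    by (rule reval_eq_cpev[OF fin inj the(1,2) assms(1)]) (rule cl)
  also have "(\<lambda>w. case \<rho> w of (c, k) \<Rightarrow> if c then b k else a k) =
      (\<lambda>v. if fst v = 0 then a (Suc (snd v)) else b (Suc (snd v)))"
    by (simp add: fun_eq_iff \<rho>_def)
  finally show ?thesis by (simp only: the(3))
qed

text \<open>The same comparison with one sequence; the row \<open>i\<close> is arbitrary because it
  only names the variables.\<close>

lemma reval_P_lam:
  fixes R :: "('a, 'b) ring_scheme"
  assumes "cring R" "\<And>k. a k \<in> carrier R"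
  shows "reval R a (P_lam m n) = cpev R (\<lambda>v. a (Suc (snd v))) (ql i m n)"
proof -
  define \<rho> :: "idx \<Rightarrow> nat" where "\<rho> v = Suc (snd v)" for v
  define N where "N = m * n"
  define V where "V = {i} \<times> {..<N}"
  define s :: "(nat \<Rightarrow> int) \<Rightarrow> nat \<Rightarrow> int" where "s x k = esym k {1..N} x" for x k
  define r :: "(nat \<Rightarrow> int) \<Rightarrow> int"
    where "r x = esym m {S. S \<subseteq> {1..N} \<and> card S = n} (\<lambda>S. \<Prod>i\<in>S. x i)" for x
  have fin: "finite V" by (simp add: V_def)
  have inj: "inj_on \<rho> V" by (auto simp: inj_on_def \<rho>_def V_def)
  have im: "\<rho> ` V = {1..N}"
  proof -
    have "\<rho> ` V = Suc ` {..<N}" by (force simp: \<rho>_def V_def)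
    then show ?thesis by (simp add: image_Suc_lessThan)
  qed
  define pt where "pt x p = (x (Suc (snd p)) :: int)" for x :: "nat \<Rightarrow> int" and p :: idx
  have s: "s x (\<rho> v) = gesym (Suc (snd v)) {..<N} (\<lambda>j. pt x (fst v, j))" for x v
    unfolding s_def \<rho>_def esym_eq_gesym image_Suc_lessThan[symmetric] gesym_reindex[OF inj_Suc]
    by (simp add: pt_def)
  have P: "P_lam m n = (THE p. is_ipoly p \<and> ipoly_vars p \<subseteq> \<rho> ` V \<and> (\<forall>x. ieval (s x) p = r x))"
    unfolding P_lam_def im s_def[abs_def] r_def N_def ..
  have vars: "keys \<mu> \<subseteq> V" if "\<mu> \<in> keys (ql i m n)" for \<mu>
    using vars_ql[OF that] by (force simp: V_def N_def)
  have q: "pev (\<lambda>w. s x (\<rho> w)) (ql i m n) = r x" for x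
  proof -
    let ?W = "{S. S \<subseteq> {..<N} \<and> card S = n}"
    have card: "card (Suc ` S) = card S" for S by (simp add: card_image)
    have "{S. S \<subseteq> {1..N} \<and> card S = n} = (`) Suc ` ?W"
    proof (intro subset_antisym subsetI)
      fix T assume T: "T \<in> {S. S \<subseteq> {1..N} \<and> card S = n}"
      then have "T \<subseteq> Suc ` {..<N}" by (simp add: image_Suc_lessThan)
      then obtain S where "S \<subseteq> {..<N}" "T = Suc ` S" by (auto simp: subset_image_iff)
      then show "T \<in> (`) Suc ` ?W" using T card by auto
    qed (auto simp: card)
    then have "r x = gesym m ((`) Suc ` ?W) (\<lambda>S. \<Prod>j\<in>S. x j)"
      by (simp add: r_def esym_eq_gesym)
    also have "\<dots> = gesym m ?W (\<lambda>S. \<Prod>j\<in>Suc ` S. x j)"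
      by (rule gesym_reindex) (auto simp: inj_on_def inj_image_eq_iff)
    also have "\<dots> = gesym m ?W (\<lambda>S. \<Prod>j\<in>S. pt x (i, j))"
      by (rule gesym_cong) (simp add: prod.reindex pt_def)
    finally show ?thesis unfolding s ql_points by simp
  qed
  have unique: "q' = 0" if "\<And>\<mu>. \<mu> \<in> keys q' \<Longrightarrow> keys \<mu> \<subseteq> V" "\<And>x. pev (\<lambda>w. s x (\<rho> w)) q' = 0" for q'
  proof (rule poly_eq_0_by_points[of q' "Suc i" N])
    have vq: "fst v = i \<and> snd v < N" if "\<mu> \<in> keys q'" "v \<in> keys \<mu>" for \<mu> v
      using that \<open>\<And>\<mu>. \<mu> \<in> keys q' \<Longrightarrow> keys \<mu> \<subseteq> V\<close> by (force simp: V_def)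
    then show "fst v < Suc i \<and> snd v < N" if "\<mu> \<in> keys q'" "v \<in> keys \<mu>" for \<mu> v
      using that by auto
    fix pos :: "idx \<Rightarrow> int"
    define x where "x = (\<lambda>k. pos (i, k - 1))"
    have "pev (\<lambda>v. gesym (Suc (snd v)) {..<N} (\<lambda>j. pos (fst v, j))) q' = pev (\<lambda>w. s x (\<rho> w)) q'"
    proof (rule pev_cong)
      fix \<mu> v assume "\<mu> \<in> keys q'" "v \<in> keys \<mu>"
      then have "fst v = i" using vq by blast
      then show "gesym (Suc (snd v)) {..<N} (\<lambda>j. pos (fst v, j)) = s x (\<rho> v)"
        unfolding s by (intro gesym_cong) (auto simp: pt_def x_def)
    qed
    then show "pev (\<lambda>v. gesym (Suc (snd v)) {..<N} (\<lambda>j. pos (fst v, j))) q' = 0"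
      using \<open>\<And>x. pev (\<lambda>w. s x (\<rho> w)) q' = 0\<close> by simp
  qed
  have the: "is_ipoly (P_lam m n)" "ipoly_vars (P_lam m n) \<subseteq> \<rho> ` V" "fromip \<rho> V (P_lam m n) = ql i m n"
    unfolding P by (rule the_ipoly[OF fin inj vars q unique]; blast)+
  have "reval R a (P_lam m n) = cpev R (\<lambda>w. a (\<rho> w)) (fromip \<rho> V (P_lam m n))"
    by (rule reval_eq_cpev[OF fin inj the(1,2) assms(1)]) (rule assms(2))
  then show ?thesis unfolding the(3) \<rho>_def .
qed

subsection \<open>Comparison with the ring of formal sums\<close>

text \<open>The variable \<open>x\<^bsub>ij\<^esub>\<close> with \<open>i, j \<ge> 1\<close> is numbered \<open>(i - 1, j - 1)\<close> in \<^typ>\<open>idx mps\<close>.\<close>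

definition upm :: "(idx \<Rightarrow>\<^sub>0 nat) \<Rightarrow> (nat \<times> nat \<Rightarrow> nat)" where
  "upm u = (\<lambda>p. if p \<in> pos_idx then lookup u (fst p - 1, snd p - 1) else 0)"

definition dnm :: "(nat \<times> nat \<Rightarrow> nat) \<Rightarrow> (idx \<Rightarrow>\<^sub>0 nat)" where
  "dnm m = Abs_poly_mapping (\<lambda>p. m (Suc (fst p), Suc (snd p)))"

definition to_mps :: "ps \<Rightarrow> idx mps" where
  "to_mps c = Mps (\<lambda>u. c (upm u))"

definition of_mps :: "idx mps \<Rightarrow> ps" where
  "of_mps f = (\<lambda>m. if is_mono m then cf f (dnm m) else 0)"

definition bounded_sym :: "idx mps \<Rightarrow> bool" where
  "bounded_sym f \<longleftrightarrow> row_sym f \<and> (\<exists>N. \<forall>m. cf f m \<noteq> 0 \<longrightarrow> wdeg m \<le> N)"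

lemma cf_to_mps: "cf (to_mps c) u = c (upm u)"
  by (simp add: to_mps_def)

lemma pos_idx_Suc: "p \<in> pos_idx \<longleftrightarrow> (\<exists>i j. p = (Suc i, Suc j))"
  by (cases p) (auto simp: pos_idx_def Suc_le_eq gr0_conv_Suc)

lemma upm_Suc [simp]: "upm u (Suc i, Suc j) = lookup u (i, j)"
  by (simp add: upm_def pos_idx_def)

lemma supp_upm: "{p. upm u p \<noteq> 0} = (\<lambda>p. (Suc (fst p), Suc (snd p))) ` keys u"
  by (force simp: upm_def pos_idx_Suc in_keys_iff image_iff split: if_splits)

lemma is_mono_upm: "is_mono (upm u)"
  unfolding is_mono_def supp_upm by (auto simp: pos_idx_def)

lemma lookup_dnm:
  assumes "is_mono m"
  shows "lookup (dnm m) p = m (Suc (fst p), Suc (snd p))"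
proof -
  have "finite ((\<lambda>p. (Suc (fst p), Suc (snd p))) -` {p. m p \<noteq> 0})"
    using assms by (intro finite_vimageI) (auto simp: is_mono_def inj_on_def prod_eq_iff)
  then show ?thesis by (simp add: dnm_def vimage_def)
qed

lemma dnm_upm [simp]: "dnm (upm u) = u"
  by (intro poly_mapping_eqI) (simp add: lookup_dnm is_mono_upm)

lemma upm_dnm: "is_mono m \<Longrightarrow> upm (dnm m) = m"
proof (rule ext)
  fix p assume m: "is_mono m"
  show "upm (dnm m) p = m p"
  proof (cases "p \<in> pos_idx")
    case True
    then show ?thesis using m by (auto simp: pos_idx_Suc lookup_dnm)
  next
    case False
    then show ?thesis using m by (auto simp: upm_def is_mono_def)
  qed
qed

lemma upm_inj: "upm u = upm w \<longleftrightarrow> u = w"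
  by (metis dnm_upm)

lemma to_of_mps [simp]: "to_mps (of_mps f) = f"
  by (rule mps_eqI) (simp add: cf_to_mps of_mps_def is_mono_upm)

lemma of_to_mps: "(\<And>m. \<not> is_mono m \<Longrightarrow> c m = 0) \<Longrightarrow> of_mps (to_mps c) = c"
  by (auto simp: of_mps_def cf_to_mps upm_dnm)

lemma mdeg_upm: "mdeg (upm u) = wdeg u"
proof -
  have inj: "inj_on (\<lambda>p. (Suc (fst p), Suc (snd p))) (keys u)"
    by (auto simp: inj_on_def prod_eq_iff)
  show ?thesis
    unfolding mdeg_def supp_upm sum.reindex[OF inj] wt_def by simp
qed

definition up_idx :: "nat \<times> nat \<Rightarrow> nat \<times> nat" where
  "up_idx p = (Suc (fst p), Suc (snd p))"

definition dn_idx :: "nat \<times> nat \<Rightarrow> nat \<times> nat" where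
  "dn_idx p = (fst p - 1, snd p - 1)"

lemma bij_up_idx: "bij_betw up_idx UNIV pos_idx"
  by (rule bij_betw_byWitness[where f' = dn_idx]) (auto simp: up_idx_def dn_idx_def pos_idx_def)

lemma bij_dn_idx: "bij_betw dn_idx pos_idx UNIV"
  by (rule bij_betw_byWitness[where f' = up_idx]) (auto simp: up_idx_def dn_idx_def pos_idx_def)

lemma row_perm_rowp:
  assumes "rowp \<pi>"
  shows "\<exists>\<tau>. row_perm \<tau> \<and> (\<forall>u. mono_perm \<tau> (upm u) = upm (map_key \<pi> u))"
proof -
  define \<tau> where "\<tau> p = up_idx (\<pi> (dn_idx p))" for p
  have "bij_betw (up_idx \<circ> (\<pi> \<circ> dn_idx)) pos_idx pos_idx"
    by (rule bij_betw_trans[OF bij_betw_trans[OF bij_dn_idx rowpD(1)[OF assms]] bij_up_idx])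
  moreover have "up_idx \<circ> (\<pi> \<circ> dn_idx) = \<tau>" by (simp add: \<tau>_def fun_eq_iff)
  moreover have "fst (\<tau> p) = fst p" if "p \<in> pos_idx" for p
    using that rowpD(3)[OF assms, of "dn_idx p"] by (auto simp: \<tau>_def up_idx_def dn_idx_def pos_idx_Suc)
  ultimately have "row_perm \<tau>" unfolding row_perm_def by metis
  moreover have "mono_perm \<tau> (upm u) = upm (map_key \<pi> u)" for u
  proof (rule ext)
    fix p
    show "mono_perm \<tau> (upm u) p = upm (map_key \<pi> u) p"
      by (cases "p \<in> pos_idx")
         (simp_all add: mono_perm_def \<tau>_def up_idx_def dn_idx_def upm_def pos_idx_def lookup_map_key[OF rowpD(2)[OF assms]])
  qed
  ultimately show ?thesis by blast
qed

text \<open>Outside \<open>pos_idx\<close> the values of a \<open>row_perm\<close> are arbitrary,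
  and \<open>mono_perm\<close> ignores them. Conjugation with the index shift therefore gives a
  genuine permutation of all pairs with the same action.\<close>

lemma rowp_row_perm:
  assumes "row_perm \<tau>"
  shows "\<exists>\<pi>. rowp \<pi> \<and> (\<forall>u. mono_perm \<tau> (upm u) = upm (map_key \<pi> u))"
proof -
  define \<pi> where "\<pi> p = dn_idx (\<tau> (up_idx p))" for p
  have \<tau>: "bij_betw \<tau> pos_idx pos_idx" "\<And>p. p \<in> pos_idx \<Longrightarrow> fst (\<tau> p) = fst p"
    using assms unfolding row_perm_def by blast+
  have "bij_betw (dn_idx \<circ> (\<tau> \<circ> up_idx)) UNIV UNIV"
    by (rule bij_betw_trans[OF bij_betw_trans[OF bij_up_idx \<tau>(1)] bij_dn_idx])
  moreover have "fst (\<pi> p) = fst p" for p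
  proof -
    have "up_idx p \<in> pos_idx" by (simp add: up_idx_def pos_idx_def)
    from \<tau>(2)[OF this] show ?thesis by (simp add: \<pi>_def dn_idx_def up_idx_def)
  qed
  ultimately have \<pi>: "rowp \<pi>"
    unfolding rowp_def \<pi>_def[abs_def] o_def by blast
  moreover have "mono_perm \<tau> (upm u) = upm (map_key \<pi> u)" for u
  proof (rule ext)
    fix p
    show "mono_perm \<tau> (upm u) p = upm (map_key \<pi> u) p"
    proof (cases "p \<in> pos_idx")
      case True
      then have "\<tau> p \<in> pos_idx" using \<tau>(1) bij_betwE by blast
      moreover have "up_idx (dn_idx p) = p" using True by (auto simp: up_idx_def dn_idx_def pos_idx_Suc)
      moreover have "upm u q = lookup u (dn_idx q)" if "q \<in> pos_idx" for u q
        using that by (simp add: upm_def dn_idx_def)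
      ultimately show ?thesis using True
        by (simp only: mono_perm_def lookup_map_key[OF rowpD(2)[OF \<pi>]] \<pi>_def if_True)
    qed (simp add: mono_perm_def upm_def)
  qed
  ultimately show ?thesis by blast
qed

text \<open>\<open>to_mps\<close> does not see the values of \<open>c\<close> at functions that are
  not monomials, so their vanishing is recorded beside the condition on the series. For the same
  reason \<open>non_mono\<close> accompanies the transport of each operation.\<close>

lemma PS_iff:
  "c \<in> PS \<longleftrightarrow> (\<forall>m. \<not> is_mono m \<longrightarrow> c m = 0) \<and> bounded_sym (to_mps c)"
proof -
  have perm: "(\<forall>\<tau>. row_perm \<tau> \<longrightarrow> (\<forall>m. is_mono m \<longrightarrow> c (mono_perm \<tau> m) = c m)) \<longleftrightarrow> row_sym (to_mps c)"
  proof
    assume c: "\<forall>\<tau>. row_perm \<tau> \<longrightarrow> (\<forall>m. is_mono m \<longrightarrow> c (mono_perm \<tau> m) = c m)"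
    show "row_sym (to_mps c)"
      unfolding row_sym_def
    proof (intro allI impI mps_eqI)
      fix \<pi> u assume "rowp \<pi>"
      then obtain \<tau> where "row_perm \<tau>" "\<forall>u. mono_perm \<tau> (upm u) = upm (map_key \<pi> u)"
        using row_perm_rowp by blast
      then show "cf (permv \<pi> (to_mps c)) u = cf (to_mps c) u"
        using c is_mono_upm by (metis cf_permv cf_to_mps)
    qed
  next
    assume c: "row_sym (to_mps c)"
    show "\<forall>\<tau>. row_perm \<tau> \<longrightarrow> (\<forall>m. is_mono m \<longrightarrow> c (mono_perm \<tau> m) = c m)"
    proof (intro allI impI)
      fix \<tau> m assume "row_perm \<tau>" and m: "is_mono m"
      then obtain \<pi> where "rowp \<pi>" "\<forall>u. mono_perm \<tau> (upm u) = upm (map_key \<pi> u)"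
        using rowp_row_perm by blast
      then show "c (mono_perm \<tau> m) = c m"
        using row_symD[OF c] upm_dnm[OF m] by (metis cf_permv cf_to_mps)
    qed
  qed
  have deg: "(\<exists>N. \<forall>m. N < mdeg m \<longrightarrow> c m = 0) \<longleftrightarrow> (\<exists>N. \<forall>u. cf (to_mps c) u \<noteq> 0 \<longrightarrow> wdeg u \<le> N)"
    if c: "\<forall>m. \<not> is_mono m \<longrightarrow> c m = 0"
  proof -
    have "(\<forall>m. N < mdeg m \<longrightarrow> c m = 0) \<longleftrightarrow> (\<forall>u. cf (to_mps c) u \<noteq> 0 \<longrightarrow> wdeg u \<le> N)" for N
    proof
      assume "\<forall>m. N < mdeg m \<longrightarrow> c m = 0"
      then show "\<forall>u. cf (to_mps c) u \<noteq> 0 \<longrightarrow> wdeg u \<le> N"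
        by (metis cf_to_mps mdeg_upm not_le)
    next
      assume "\<forall>u. cf (to_mps c) u \<noteq> 0 \<longrightarrow> wdeg u \<le> N"
      then show "\<forall>m. N < mdeg m \<longrightarrow> c m = 0"
        using c by (metis cf_to_mps mdeg_upm not_le upm_dnm)
    qed
    then show ?thesis by simp
  qed
  show ?thesis unfolding PS_def bounded_sym_def using perm deg by blast
qed

lemma of_mps_PS: "bounded_sym f \<Longrightarrow> of_mps f \<in> PS"
  by (simp add: PS_iff) (simp add: of_mps_def)

lemma bounded_sym_to_mps: "c \<in> PS \<Longrightarrow> bounded_sym (to_mps c)"
  by (simp add: PS_iff)

lemma of_to_PS: "c \<in> PS \<Longrightarrow> of_mps (to_mps c) = c"
  by (rule of_to_mps) (simp add: PS_iff)

section \<open>Transport of the ring operations and of the substitution\<close>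

lemma ps_mul_upm: "ps_mul c d (upm u) = cf (to_mps c * to_mps d) u"
  unfolding ps_mul_def cf_mult
proof (rule sum.reindex_bij_witness[where j = "\<lambda>a. (dnm a, dnm (\<lambda>p. upm u p - a p))" and i = "\<lambda>p. upm (fst p)"])
  fix a assume "a \<in> {a. \<forall>p. a p \<le> upm u p}"
  then have a: "a p \<le> upm u p" for p by blast
  \<comment> \<open>A function bounded by a monomial is a monomial, so both arguments in each term
    of the convolution come from exponents of series.\<close>
  have mono: "is_mono b" if "\<And>p. b p \<le> upm u p" for b
  proof -
    have "{p. b p \<noteq> 0} \<subseteq> {p. upm u p \<noteq> 0}" using that by (metis (mono_tags, lifting) le_zero_eq mem_Collect_eq subsetI)
    then show ?thesis using is_mono_upm[of u] finite_subset unfolding is_mono_def by (metis subset_trans)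
  qed
  have ma: "is_mono a" by (rule mono) (rule a)
  have mb: "is_mono (\<lambda>p. upm u p - a p)" by (rule mono) simp
  show "upm (fst (dnm a, dnm (\<lambda>p. upm u p - a p))) = a" by (simp add: upm_dnm ma)
  show "(dnm a, dnm (\<lambda>p. upm u p - a p)) \<in> decomp u"
    using a by (auto intro!: poly_mapping_eqI simp: lookup_add lookup_dnm ma mb) (metis le_add_diff_inverse upm_Suc)
  show "(case (dnm a, dnm (\<lambda>p. upm u p - a p)) of (a, b) \<Rightarrow> cf (to_mps c) a * cf (to_mps d) b) =
      c a * d (\<lambda>p. upm u p - a p)"
    by (simp add: cf_to_mps upm_dnm ma mb)
next
  fix p assume "p \<in> decomp u"
  then obtain x y where p: "p = (x, y)" "x + y = u" by (cases p) auto
  have "(\<lambda>p. upm u p - upm x p) = upm y"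
    unfolding p(2)[symmetric] by (auto simp: upm_def lookup_add fun_eq_iff)
  then show "(dnm (upm (fst p)), dnm (\<lambda>q. upm u q - upm (fst p) q)) = p" by (simp add: p(1))
  show "upm (fst p) \<in> {a. \<forall>p. a p \<le> upm u p}"
    unfolding p(2)[symmetric] by (auto simp: p(1) upm_def lookup_add)
qed

lemma to_mps_mul: "to_mps (ps_mul c d) = to_mps c * to_mps d"
  by (rule mps_eqI) (simp add: cf_to_mps[of "ps_mul c d"] ps_mul_upm)

lemma to_mps_add: "to_mps (ps_add c d) = to_mps c + to_mps d"
  by (rule mps_eqI) (simp add: cf_to_mps ps_add_def)

lemma upm_zero_iff: "upm u = (\<lambda>_. 0) \<longleftrightarrow> u = 0"
proof -
  have "upm 0 = (\<lambda>_. 0)" by (auto simp: upm_def)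
  then show ?thesis by (metis upm_inj)
qed

lemma to_mps_one: "to_mps ps_one = 1"
  by (rule mps_eqI) (simp add: cf_to_mps ps_one_def cf_one upm_zero_iff)

lemma to_mps_zero: "to_mps ps_zero = 0"
  by (rule mps_eqI) (simp add: cf_to_mps ps_zero_def)

lemma to_mps_psi: "to_mps (ps_psi n c) = psi n (to_mps c)"
proof (rule mps_eqI)
  fix u
  have "(\<forall>p. n dvd upm u p) \<longleftrightarrow> (\<forall>p. n dvd lookup u p)"
  proof
    assume "\<forall>p. n dvd upm u p"
    then show "\<forall>p. n dvd lookup u p" by (metis prod.collapse upm_Suc)
  qed (simp add: upm_def)
  moreover have "(\<lambda>p. upm u p div n) = upm (divm n u)" by (auto simp: upm_def)
  ultimately show "cf (to_mps (ps_psi n c)) u = cf (psi n (to_mps c)) u"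
    by (simp add: cf_to_mps ps_psi_def cf_psi)
qed

lemma to_mps_M: "to_mps (M (Suc i)) = MM i"
proof (rule mps_eqI)
  fix u
  have e: "upm (single (i, j) 1) = (\<lambda>_. 0)((Suc i, Suc j) := 1)" for j
    by (auto simp: upm_def fun_eq_iff lookup_single when_def pos_idx_def)
  have "(\<exists>j\<ge>1. upm u = (\<lambda>_. 0)((Suc i, j) := 1)) \<longleftrightarrow> (\<exists>j. upm u = (\<lambda>_. 0)((Suc i, Suc j) := 1))"
    by (metis Suc_le_D le_add1 One_nat_def plus_1_eq_Suc)
  also have "\<dots> \<longleftrightarrow> (\<exists>j. u = single (i, j) 1)"
    unfolding e[symmetric] upm_inj ..
  finally show "cf (to_mps (M (Suc i))) u = cf (MM i) u"
    by (simp add: cf_to_mps M_def cf_MM)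
qed

lemma non_mono:
  assumes "\<not> is_mono m"
  shows "c \<in> PS \<Longrightarrow> d \<in> PS \<Longrightarrow> ps_add c d m = 0" "c \<in> PS \<Longrightarrow> d \<in> PS \<Longrightarrow> ps_mul c d m = 0"
    "ps_one m = 0" "ps_zero m = 0" "c \<in> PS \<Longrightarrow> ps_psi n c m = 0" "M (Suc i) m = 0"
proof -
  show "ps_add c d m = 0" if "c \<in> PS" "d \<in> PS" using that assms by (simp add: PS_iff ps_add_def)
  show "ps_mul c d m = 0" if cd: "c \<in> PS" "d \<in> PS"
    unfolding ps_mul_def
  proof (rule sum.neutral, clarify)
    fix a assume a: "\<forall>p. a p \<le> m p"
    have "\<not> (is_mono a \<and> is_mono (\<lambda>p. m p - a p))"
    proof
      assume b: "is_mono a \<and> is_mono (\<lambda>p. m p - a p)"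
      have "{p. m p \<noteq> 0} \<subseteq> {p. a p \<noteq> 0} \<union> {p. m p - a p \<noteq> 0}"
        using a by auto
      then have "is_mono m" using b unfolding is_mono_def
        by (meson finite_UnI finite_subset le_sup_iff order_trans sup_least)
      then show False using assms by simp
    qed
    then show "c a * d (\<lambda>p. m p - a p) = 0" using cd by (auto simp: PS_iff)
  qed
  have "is_mono (\<lambda>_. 0)" by (simp add: is_mono_def)
  then show "ps_one m = 0" using assms by (auto simp: ps_one_def)
  show "ps_zero m = 0" by (simp add: ps_zero_def)
  show "ps_psi n c m = 0" if "c \<in> PS"
  proof (cases "\<forall>p. n dvd m p")
    case True
    have "\<not> is_mono (\<lambda>p. m p div n)"
    proof -
      have "m p div n = 0 \<longleftrightarrow> m p = 0" for p using spec[OF True, of p] by (rule dvd_div_eq_0_iff)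
      then have "{p. m p div n \<noteq> 0} = {p. m p \<noteq> 0}" by (simp only:)
      then show ?thesis using assms unfolding is_mono_def by simp
    qed
    then show ?thesis using that by (simp add: ps_psi_def PS_iff)
  qed (auto simp: ps_psi_def)
  show "M (Suc i) m = 0"
  proof -
    have "is_mono ((\<lambda>_. 0)((Suc i, j) := 1))" if "j \<ge> 1" for j
    proof -
      have "{p. ((\<lambda>_. 0 :: nat)((Suc i, j) := 1)) p \<noteq> 0} = {(Suc i, j)}" by auto
      then show ?thesis using that unfolding is_mono_def by (simp add: pos_idx_def)
    qed
    then show ?thesis using assms by (auto simp: M_def)
  qed
qed

subsection \<open>The isomorphism with a polynomial ring\<close>

lemma bounded_sym_Phi: "bounded_sym (Phi p)"
  unfolding bounded_sym_def using row_sym_Phi wdeg_Phi by blast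

lemma bounded_sym_ex:
  assumes "bounded_sym f"
  shows "\<exists>p. Phi p = f"
proof -
  obtain N where "\<forall>m. cf f m \<noteq> 0 \<longrightarrow> wdeg m \<le> N" using assms by (auto simp: bounded_sym_def)
  then obtain p where "Phi p = f"
    by (rule_tac Phi_surj[OF _ finite_rdeg[of N], of f]) (use assms in \<open>auto simp: bounded_sym_def\<close>)
  then show ?thesis by blast
qed

definition iPhi :: "idx mps \<Rightarrow> idx zp" where
  "iPhi f = (SOME p. Phi p = f)"

lemma Phi_iPhi: "bounded_sym f \<Longrightarrow> Phi (iPhi f) = f"
  unfolding iPhi_def using bounded_sym_ex by (rule someI_ex)

lemma bounded_sym_lam: "bounded_sym f \<Longrightarrow> bounded_sym (lam n f)"
  unfolding bounded_sym_def using row_sym_lam supp_lam_wt_le by metis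

lemma row_sym_psi: "row_sym f \<Longrightarrow> row_sym (psi n f)"
  unfolding row_sym_def using psi_permv rowpD(1) by metis

lemma wt_mulm: "wt w (mulm n u) = n * wt w u"
  by (induction n) (simp_all add: mulm_Suc wt_add)

lemma bounded_sym_psi:
  assumes "bounded_sym f" "n \<ge> 1"
  shows "bounded_sym (psi n f)"
proof -
  obtain N where N: "\<And>m. cf f m \<noteq> 0 \<Longrightarrow> wdeg m \<le> N" using assms by (auto simp: bounded_sym_def)
  have "wdeg m \<le> n * N" if "cf (psi n f) m \<noteq> 0" for m
  proof -
    obtain u where "m = mulm n u" "cf f u \<noteq> 0" using \<open>cf (psi n f) m \<noteq> 0\<close> assms(2) by (rule supp_psi)
    then show ?thesis using N by (simp add: wt_mulm)
  qed
  then show ?thesis using assms(1) row_sym_psi unfolding bounded_sym_def by blast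
qed

text \<open>\<open>FF\<close> is the isomorphism sending \<open>Var (i, k)\<close> to \<open>\<lambda>\<^bsub>k+1\<^esub>(M\<^bsub>i+1\<^esub>)\<close>; \<open>Lz\<close> and \<open>Pz\<close> are
  \<open>\<lambda>\<^bsub>n\<^esub>\<close> and \<open>\<psi>\<^bsub>n\<^esub>\<close> transported along it.\<close>

definition FF :: "idx zp \<Rightarrow> ps" where
  "FF p = of_mps (Phi p)"

definition Lz :: "nat \<Rightarrow> idx zp \<Rightarrow> idx zp" where
  "Lz n p = iPhi (lam n (Phi p))"

definition Pz :: "nat \<Rightarrow> idx zp \<Rightarrow> idx zp" where
  "Pz n p = iPhi (psi n (Phi p))"

lemma Phi_Lz: "Phi (Lz n p) = lam n (Phi p)"
  unfolding Lz_def by (intro Phi_iPhi bounded_sym_lam bounded_sym_Phi)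

lemma Phi_Pz: "n \<ge> 1 \<Longrightarrow> Phi (Pz n p) = psi n (Phi p)"
  unfolding Pz_def by (intro Phi_iPhi bounded_sym_psi bounded_sym_Phi)

lemma FF_PS: "FF p \<in> PS"
  unfolding FF_def by (intro of_mps_PS bounded_sym_Phi)

lemma to_mps_FF [simp]: "to_mps (FF p) = Phi p"
  by (simp add: FF_def)

lemma FF_inj: "FF p = FF q \<longleftrightarrow> p = q"
  by (metis Phi_inj to_mps_FF)

lemma FF_surj: "c \<in> PS \<Longrightarrow> \<exists>p. c = FF p"
  unfolding FF_def by (metis bounded_sym_ex bounded_sym_to_mps of_to_PS)

lemma eq_FF: "(\<And>m. \<not> is_mono m \<Longrightarrow> c m = 0) \<Longrightarrow> to_mps c = Phi p \<Longrightarrow> c = FF p"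
  unfolding FF_def by (metis of_to_mps)

lemma FF_add: "ps_add (FF p) (FF q) = FF (p + q)"
  by (rule eq_FF) (simp_all add: non_mono FF_PS to_mps_add pev_add)

lemma FF_mult: "ps_mul (FF p) (FF q) = FF (p * q)"
  by (rule eq_FF) (simp_all add: non_mono FF_PS to_mps_mul rhom_mult[OF rhom_pev])

lemma FF_one: "ps_one = FF 1"
  by (rule eq_FF) (simp_all add: non_mono to_mps_one rhom_one[OF rhom_pev])

lemma FF_zero: "ps_zero = FF 0"
  by (rule eq_FF) (simp_all add: non_mono to_mps_zero rhom_zero[OF rhom_pev])

lemma FF_psi: "n \<ge> 1 \<Longrightarrow> ps_psi n (FF p) = FF (Pz n p)"
  by (rule eq_FF) (simp_all add: non_mono FF_PS to_mps_psi Phi_Pz)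

lemma FF_M: "M (Suc i) = FF (Var (i, 0))"
  by (rule eq_FF) (simp_all add: non_mono to_mps_M ee_def)

lemma PS_ring_simps [simp]:
  "carrier PS_ring = PS" "x \<oplus>\<^bsub>PS_ring\<^esub> y = ps_add x y" "x \<otimes>\<^bsub>PS_ring\<^esub> y = ps_mul x y"
  "\<one>\<^bsub>PS_ring\<^esub> = ps_one" "\<zero>\<^bsub>PS_ring\<^esub> = ps_zero"
  by (simp_all add: PS_ring_def)

lemma cring_PS: "cring PS_ring"
proof (rule cringI)
  show "abelian_group PS_ring"
  proof (rule abelian_groupI)
    fix x assume "x \<in> carrier PS_ring"
    then obtain p where p: "x = FF p" using FF_surj by auto
    show "\<exists>y\<in>carrier PS_ring. y \<oplus>\<^bsub>PS_ring\<^esub> x = \<zero>\<^bsub>PS_ring\<^esub>"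
      by (rule bexI[of _ "FF (- p)"]) (simp_all add: p FF_add FF_zero FF_PS)
  qed (auto dest!: FF_surj simp: FF_add FF_zero FF_PS add_ac)
  show "Group.comm_monoid PS_ring"
    by (rule comm_monoidI) (auto dest!: FF_surj simp: FF_mult FF_one FF_PS mult_ac)
qed (auto dest!: FF_surj simp: FF_mult FF_add FF_PS distrib_right)

lemma chom_FF: "chom PS_ring FF"
  by (simp add: chom_def FF_PS FF_add FF_mult FF_one)

subsection \<open>The lambda-structure\<close>

lemma Lz_0: "Lz 0 p = 1"
  by (rule Phi_inj) (simp add: Phi_Lz rhom_one[OF rhom_pev])

lemma Lz_1: "Lz (Suc 0) p = p"
  by (rule Phi_inj) (simp add: Phi_Lz)

lemma Lz_add: "Lz n (p + q) = (\<Sum>k=0..n. Lz k p * Lz (n - k) q)"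
  by (rule Phi_inj) (simp add: Phi_Lz lam_add pev_add rhom_sum[OF rhom_pev] rhom_mult[OF rhom_pev])

lemma Lz_mult: "Lz n (p * q) = pev (\<lambda>v. Lz (Suc (snd v)) (if fst v = 0 then p else q)) (qm n)"
  by (rule Phi_inj)
     (simp add: Phi_Lz rhom_mult[OF rhom_pev] lam_mult rhom_pev_comp[OF rhom_pev] if_distrib cong: if_cong)

lemma Lz_Var: "Lz n (Var v) = ql (fst v) n (Suc (snd v))"
  by (rule Phi_inj) (simp add: Phi_Lz Phi_ql ee_def)

lemma Lz_one: "Lz (Suc (Suc n)) 1 = 0"
proof (rule Phi_inj)
  have "lam (Suc (Suc n)) (xmon (0 :: idx \<Rightarrow>\<^sub>0 nat)) = 0" by (rule lam_xmon_Suc_Suc)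
  then show "Phi (Lz (Suc (Suc n)) 1) = Phi 0"
    by (simp add: Phi_Lz rhom_one[OF rhom_pev] rhom_zero[OF rhom_pev])
qed

lemma newton_Lz: "newton (\<lambda>n. Lz n p) (\<lambda>n. Pz n p)"
  unfolding newton_def
proof (intro allI impI, rule Phi_inj)
  fix n :: nat assume n: "1 \<le> n"
  have "(\<Sum>k<n. (-1) ^ k * (lam k (Phi p) * Phi (Pz (n - k) p))) =
      (\<Sum>k<n. (-1) ^ k * (lam k (Phi p) * psi (n - k) (Phi p)))"
    by (rule sum.cong) (simp_all add: Phi_Pz)
  then show "Phi ((\<Sum>k<n. (-1) ^ k * (Lz k p * Pz (n - k) p)) + (-1) ^ n * (of_nat n * Lz n p)) = Phi 0"
    using newtonD[OF newton_lam n, of "Phi p"] by (simp add: rhom_simps[OF rhom_pev] Phi_Lz)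
qed

text \<open>The restriction fixes the values off the carrier, so that uniqueness can be stated as
  equality of functions.\<close>

definition lamPS :: "nat \<Rightarrow> ps \<Rightarrow> ps" where
  "lamPS n = (\<lambda>c\<in>PS. of_mps (lam n (to_mps c)))"

lemma lamPS_FF: "lamPS n (FF p) = FF (Lz n p)"
  by (simp add: lamPS_def FF_PS) (simp add: FF_def Phi_Lz)

lemma lambda_ring_PS: "lambda_ring PS_ring lamPS"
  unfolding lambda_ring_def
proof (intro conjI ballI allI)
  interpret cring PS_ring by (rule cring_PS)
  show "cring PS_ring" by (rule cring_PS)
  fix c assume "c \<in> carrier PS_ring"
  then obtain p where p: "c = FF p" using FF_surj by auto
  show "lamPS 0 c = \<one>\<^bsub>PS_ring\<^esub>" "lamPS 1 c = c" "lamPS n c \<in> carrier PS_ring" for n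
    by (simp_all add: p lamPS_FF Lz_0 Lz_1 FF_one FF_PS)
  fix d n assume "d \<in> carrier PS_ring"
  then obtain q where q: "d = FF q" using FF_surj by auto
  show "lamPS n (c \<oplus>\<^bsub>PS_ring\<^esub> d) =
      finsum PS_ring (\<lambda>k. lamPS k c \<otimes>\<^bsub>PS_ring\<^esub> lamPS (n - k) d) {0..n}"
    by (simp add: p q FF_add lamPS_FF Lz_add chom_sum[OF chom_FF] FF_mult)
qed

abbreviation adams_sum :: "(nat \<Rightarrow> ps) \<Rightarrow> ps \<Rightarrow> nat \<Rightarrow> ps" where
  "adams_sum L c n \<equiv>
    finsum PS_ring (\<lambda>k. add_pow PS_ring ((-1::int) ^ k) (L k \<otimes>\<^bsub>PS_ring\<^esub> ps_psi (n - k) c)) {0..<n}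
    \<oplus>\<^bsub>PS_ring\<^esub> add_pow PS_ring ((-1::int) ^ n * int n) (L n)"

lemma adams_FF:
  assumes "n \<ge> 1"
  shows "adams_sum (\<lambda>k. FF (a k)) (FF p) n =
     FF ((\<Sum>k<n. (-1) ^ k * (a k * Pz (n - k) p)) + (-1) ^ n * (of_nat n * a n))"
proof -
  interpret cring PS_ring by (rule cring_PS)
  have "finsum PS_ring (\<lambda>k. add_pow PS_ring ((-1::int) ^ k) (FF (a k) \<otimes>\<^bsub>PS_ring\<^esub> ps_psi (n - k) (FF p))) {0..<n} =
      finsum PS_ring (\<lambda>k. FF ((-1) ^ k * (a k * Pz (n - k) p))) {0..<n}"
  proof (rule finsum_cong')
    fix k assume "k \<in> {0..<n}"
    then have "ps_psi (n - k) (FF p) = FF (Pz (n - k) p)" by (simp add: FF_psi)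
    then show "add_pow PS_ring ((-1::int) ^ k) (FF (a k) \<otimes>\<^bsub>PS_ring\<^esub> ps_psi (n - k) (FF p)) =
        FF ((-1) ^ k * (a k * Pz (n - k) p))"
      using chom_of_int[OF chom_FF, of "(-1) ^ k" "a k * Pz (n - k) p"] by (simp add: FF_mult)
  qed (simp_all add: FF_PS)
  also have "\<dots> = FF (\<Sum>k<n. (-1) ^ k * (a k * Pz (n - k) p))"
    by (simp add: chom_sum[OF chom_FF] lessThan_atLeast0)
  finally have 1: "finsum PS_ring (\<lambda>k. add_pow PS_ring ((-1::int) ^ k) (FF (a k) \<otimes>\<^bsub>PS_ring\<^esub> ps_psi (n - k) (FF p))) {0..<n} =
      FF (\<Sum>k<n. (-1) ^ k * (a k * Pz (n - k) p))" .
  have 2: "add_pow PS_ring ((-1::int) ^ n * int n) (FF (a n)) = FF ((-1) ^ n * (of_nat n * a n))"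
    using chom_of_int[OF chom_FF, of "(-1) ^ n * int n" "a n"] by (simp add: mult.assoc)
  show ?thesis unfolding 1 2 by (simp add: FF_add)
qed

lemma adams_ops_PS: "adams_ops PS_ring lamPS ps_psi"
  unfolding adams_ops_def
proof (intro ballI allI impI)
  fix c n assume "c \<in> carrier PS_ring" and n: "1 \<le> (n :: nat)"
  then obtain p where p: "c = FF p" using FF_surj by auto
  show "ps_psi n c \<in> carrier PS_ring \<and>
    adams_sum (\<lambda>k. lamPS k c) c n = \<zero>\<^bsub>PS_ring\<^esub>"
    unfolding p lamPS_FF adams_FF[OF n, of "\<lambda>k. Lz k p"] newtonD[OF newton_Lz n]
    using n by (simp add: FF_psi FF_PS FF_zero)
qed

text \<open>Transported to polynomials, a competing structure solves the Newton relation with the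
  same \<open>Pz\<close>. Its image under \<open>Phi\<close> lies in the torsion-free ring of
  series, where the solution is unique.\<close>

lemma adams_ops_PS_unique:
  assumes "lambda_ring PS_ring lam'" "adams_ops PS_ring lam' ps_psi" "c \<in> PS"
  shows "lam' n c = lamPS n c"
proof -
  obtain p where p: "c = FF p" using FF_surj assms(3) by auto
  have "lam' n c \<in> PS" for n using assms(1,3) by (simp add: lambda_ring_def)
  then have "\<exists>q. lam' n c = FF q" for n using FF_surj by blast
  then obtain a where a: "\<And>n. lam' n c = FF (a n)" by metis
  have "lam' 0 c = ps_one" using assms(1,3) by (simp add: lambda_ring_def)
  then have a0: "a 0 = 1" using a[of 0] by (simp add: FF_one FF_inj)
  have "newton a (\<lambda>n. Pz n p)"
    unfolding newton_def
  proof (intro allI impI)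
    fix n :: nat assume n: "1 \<le> n"
    have "adams_sum (\<lambda>k. FF (a k)) (FF p) n = \<zero>\<^bsub>PS_ring\<^esub>"
      unfolding a[symmetric] p[symmetric] using assms(2,3) n by (simp add: adams_ops_def)
    then show "(\<Sum>k<n. (-1) ^ k * (a k * Pz (n - k) p)) + (-1) ^ n * (of_nat n * a n) = 0"
      unfolding adams_FF[OF n] by (simp add: FF_zero FF_inj)
  qed
  from newton_rhom[OF rhom_pev[of ee] this] newton_rhom[OF rhom_pev[of ee] newton_Lz[of p]]
  have "Phi (a n) = Phi (Lz n p)"
    by (rule newton_unique) (simp add: a0 Lz_0)
  then have "a n = Lz n p" by (rule Phi_inj)
  then show ?thesis unfolding a unfolding p lamPS_FF by (simp only:)
qed

subsection \<open>The grading\<close>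

lemma PS_grade_FF:
  "FF p \<in> PS_grade d \<longleftrightarrow> (\<forall>u. cf (Phi p) u \<noteq> 0 \<longrightarrow> wdeg u = d)"
proof -
  have "(\<forall>m. FF p m \<noteq> 0 \<longrightarrow> mdeg m = d) \<longleftrightarrow> (\<forall>u. cf (Phi p) u \<noteq> 0 \<longrightarrow> wdeg u = d)"
  proof
    assume "\<forall>m. FF p m \<noteq> 0 \<longrightarrow> mdeg m = d"
    then show "\<forall>u. cf (Phi p) u \<noteq> 0 \<longrightarrow> wdeg u = d"
      by (metis cf_to_mps mdeg_upm to_mps_FF)
  next
    assume *: "\<forall>u. cf (Phi p) u \<noteq> 0 \<longrightarrow> wdeg u = d"
    show "\<forall>m. FF p m \<noteq> 0 \<longrightarrow> mdeg m = d"
    proof (intro allI impI)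
      fix m assume nz: "FF p m \<noteq> 0"
      then have "is_mono m" using FF_PS[of p] unfolding PS_iff by blast
      then have m: "upm (dnm m) = m" by (rule upm_dnm)
      then have "cf (Phi p) (dnm m) \<noteq> 0" using nz cf_to_mps[of "FF p" "dnm m"] by simp
      then show "mdeg m = d" using * mdeg_upm[of "dnm m"] m by simp
    qed
  qed
  then show ?thesis using FF_PS by (simp add: PS_grade_def)
qed

text \<open>\<open>Phi_surj\<close>, applied with the row degrees of total degree \<open>d\<close>,
  yields a preimage all of whose terms have degree \<open>d\<close>; by injectivity it is
  \<open>p\<close>. Thus the grading of formal sums becomes a weighting of the polynomial
  generators.\<close>

lemma keys_homogeneous:
  assumes "FF p \<in> PS_grade d" "\<mu> \<in> keys p"
  shows "wdeg (lead \<mu>) = d"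
proof -
  let ?A = "rdeg ` {m. wdeg m = d}"
  have fin: "finite ?A" by (rule finite_subset[OF _ finite_rdeg[of d]]) auto
  obtain q where q: "Phi q = Phi p" "\<And>\<mu>. \<mu> \<in> keys q \<Longrightarrow> rdeg (lead \<mu>) \<in> ?A"
    using Phi_surj[OF row_sym_Phi fin, of p] assms(1) unfolding PS_grade_FF by blast
  have "q = p" by (rule Phi_inj[OF q(1)])
  then obtain m where "rdeg (lead \<mu>) = rdeg m" "wdeg m = d" using q(2) assms(2) by auto
  then show ?thesis by (simp add: wdeg_rdeg)
qed

lemma finsum_PS_apply:
  "finite A \<Longrightarrow> c \<in> A \<rightarrow> PS \<Longrightarrow> finsum PS_ring c A m = (\<Sum>d\<in>A. c d m)"
proof (induction A rule: finite_induct)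
  case empty
  interpret cring PS_ring by (rule cring_PS)
  show ?case by (simp add: ps_zero_def)
next
  case (insert d A)
  interpret cring PS_ring by (rule cring_PS)
  have "c \<in> A \<rightarrow> carrier PS_ring" "c d \<in> carrier PS_ring" using insert.prems by auto
  then show ?case using insert by (simp add: finsum_insert ps_add_def)
qed

lemma wdeg_map_key:
  assumes "rowp \<pi>"
  shows "wdeg (map_key \<pi> u) = wdeg u"
proof -
  note inj = rowpD(2)[OF assms]
  have "surj \<pi>" using rowpD(1)[OF assms] by (rule bij_is_surj)
  then have "wdeg u = (\<Sum>q\<in>\<pi> ` (\<pi> -` keys u). Suc (fst q) * lookup u q)"
    by (simp add: wt_def surj_image_vimage_eq)
  also have "\<dots> = (\<Sum>p\<in>\<pi> -` keys u. Suc (fst (\<pi> p)) * lookup u (\<pi> p))"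
    by (subst sum.reindex[OF inj_on_subset[OF inj subset_UNIV]]) (simp only: o_def)
  also have "\<dots> = wdeg (map_key \<pi> u)"
    by (simp add: wt_def keys_map_key[OF inj] lookup_map_key[OF inj] rowpD(3)[OF assms])
  finally show ?thesis ..
qed

text \<open>Row permutations preserve the degree, so a homogeneous part of an invariant sum is again
  invariant.\<close>

lemma FF_component: "\<exists>q. FF q = (\<lambda>m. if mdeg m = d then FF p m else 0)"
proof -
  define f where "f = Mps (\<lambda>u. if wdeg u = d then cf (Phi p) u else 0)"
  have cf: "cf f u = (if wdeg u = d then cf (Phi p) u else 0)" for u by (simp add: f_def)
  have "row_sym f"
    unfolding row_sym_def
  proof (intro allI impI mps_eqI)
    fix \<pi> u assume \<pi>: "rowp \<pi>"
    have "wdeg (map_key \<pi> u) = wdeg u" by (rule wdeg_map_key[OF \<pi>])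
    moreover have "cf (Phi p) (map_key \<pi> u) = cf (Phi p) u"
      using row_symD[OF row_sym_Phi \<pi>] by (metis cf_permv)
    ultimately show "cf (permv \<pi> f) u = cf f u" by (simp add: cf_permv cf)
  qed
  moreover have "\<forall>u. cf f u \<noteq> 0 \<longrightarrow> wdeg u \<le> d" by (simp add: cf)
  ultimately have "bounded_sym f" unfolding bounded_sym_def by blast
  then obtain q where q: "Phi q = f" using bounded_sym_ex by blast
  have "FF q = (\<lambda>m. if mdeg m = d then FF p m else 0)"
  proof (rule eq_FF[symmetric])
    show "(if mdeg m = d then FF p m else 0) = 0" if "\<not> is_mono m" for m
      using that FF_PS[of p] unfolding PS_iff by simp
    show "to_mps (\<lambda>m. if mdeg m = d then FF p m else 0) = Phi q"
      by (rule mps_eqI) (simp add: cf_to_mps q cf mdeg_upm flip: cf_to_mps[of "FF p"])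
  qed
  then show ?thesis ..
qed

lemma graded_PS: "graded_ring PS_ring PS_grade"
  unfolding graded_ring_def
proof (intro conjI allI ballI)
  interpret cring PS_ring by (rule cring_PS)
  have ex: "\<exists>p. x = FF p \<and> FF p \<in> PS_grade d" if "x \<in> PS_grade d" for x d
    using that FF_surj[of x] by (auto simp: PS_grade_def)
  fix d e :: nat
  show "PS_grade d \<subseteq> carrier PS_ring" by (auto simp: PS_grade_def)
  show "\<zero>\<^bsub>PS_ring\<^esub> \<in> PS_grade d" by (simp add: FF_zero PS_grade_FF rhom_zero[OF rhom_pev])
  fix x assume "x \<in> PS_grade d"
  then obtain p where p: "x = FF p" "\<forall>u. cf (Phi p) u \<noteq> 0 \<longrightarrow> wdeg u = d"
    using ex PS_grade_FF by blast
  {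
    fix y assume "y \<in> PS_grade d"
    then obtain q where q: "y = FF q" "\<forall>u. cf (Phi q) u \<noteq> 0 \<longrightarrow> wdeg u = d"
      using ex PS_grade_FF by blast
    have "wdeg u = d" if "cf (Phi (p + q)) u \<noteq> 0" for u
    proof -
      have "cf (Phi p) u \<noteq> 0 \<or> cf (Phi q) u \<noteq> 0" using that by (auto simp: pev_add)
      then show ?thesis using p(2) q(2) by blast
    qed
    then show "x \<oplus>\<^bsub>PS_ring\<^esub> y \<in> PS_grade d"
      by (simp add: p(1) q(1) FF_add PS_grade_FF)
    have "\<ominus>\<^bsub>PS_ring\<^esub> x = FF (- p)" using chom_uminus[OF chom_FF, of p] by (simp add: p(1))
    then show "\<ominus>\<^bsub>PS_ring\<^esub> x \<in> PS_grade d"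
      using p(2) by (simp add: PS_grade_FF rhom_uminus[OF rhom_pev])
  next
    fix y assume "y \<in> PS_grade e"
    then obtain q where q: "y = FF q" "\<forall>u. cf (Phi q) u \<noteq> 0 \<longrightarrow> wdeg u = e"
      using ex PS_grade_FF by blast
    have "wdeg u = d + e" if nz: "cf (Phi p * Phi q) u \<noteq> 0" for u
    proof -
      obtain a b where ab: "u = a + b" "cf (Phi p) a \<noteq> 0" "cf (Phi q) b \<noteq> 0"
        using nz by (rule supp_mult)
      then show ?thesis using p(2) q(2) by (simp only: wt_add) blast
    qed
    then show "x \<otimes>\<^bsub>PS_ring\<^esub> y \<in> PS_grade (d + e)"
      by (simp add: p(1) q(1) FF_mult PS_grade_FF rhom_mult[OF rhom_pev])
  }
next
  fix r assume "r \<in> carrier PS_ring"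
  then have r: "r \<in> PS" by simp
  define c where "c d = (\<lambda>m. if mdeg m = d then r m else 0)" for d
  obtain p where p: "r = FF p" using FF_surj r by blast
  obtain N where N: "\<And>m. N < mdeg m \<Longrightarrow> r m = 0" using r by (auto simp: PS_def)
  have c: "c d \<in> PS_grade d" for d
  proof -
    obtain q where "FF q = c d" using FF_component[of d p] unfolding c_def p by blast
    then show ?thesis using FF_PS[of q] by (simp add: PS_grade_def) (simp add: c_def)
  qed
  have zero: "c d = ps_zero" if "d > N" for d
    using N that by (auto simp: c_def ps_zero_def)
  have fin: "finite {d. c d \<noteq> ps_zero}"
    by (rule finite_subset[of _ "{..N}"]) (use zero not_le in auto)
  \<comment> \<open>At \<open>m\<close> only the summand of index \<open>mdeg m\<close> can be
    nonzero; existence and uniqueness of the decomposition both follow from this.\<close>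
  have sum: "finsum PS_ring c' {d. c' d \<noteq> ps_zero} m = c' (mdeg m) m"
    if c': "\<forall>d. c' d \<in> PS_grade d" "finite {d. c' d \<noteq> ps_zero}" for c' m
  proof -
    have nz: "c' d m = (if d = mdeg m then c' d m else 0)" for d
      using c'(1) by (auto simp: PS_grade_def)
    have "finsum PS_ring c' {d. c' d \<noteq> ps_zero} m = (\<Sum>d\<in>{d. c' d \<noteq> ps_zero}. c' d m)"
      using c' by (intro finsum_PS_apply) (auto simp: PS_grade_def)
    also have "\<dots> = (\<Sum>d\<in>{d. c' d \<noteq> ps_zero}. if d = mdeg m then c' d m else 0)"
      by (rule sum.cong[OF refl nz])
    also have "\<dots> = c' (mdeg m) m" using c'(2) by (auto simp: ps_zero_def)
    finally show ?thesis .
  qed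
  show "\<exists>!c. (\<forall>d. c d \<in> PS_grade d) \<and> finite {d. c d \<noteq> \<zero>\<^bsub>PS_ring\<^esub>} \<and>
      r = finsum PS_ring c {d. c d \<noteq> \<zero>\<^bsub>PS_ring\<^esub>}"
  proof (rule ex1I[of _ c])
    show "(\<forall>d. c d \<in> PS_grade d) \<and> finite {d. c d \<noteq> \<zero>\<^bsub>PS_ring\<^esub>} \<and>
      r = finsum PS_ring c {d. c d \<noteq> \<zero>\<^bsub>PS_ring\<^esub>}"
      using c fin sum[of c] by (auto simp: fun_eq_iff c_def)
  next
    fix c' assume c': "(\<forall>d. c' d \<in> PS_grade d) \<and> finite {d. c' d \<noteq> \<zero>\<^bsub>PS_ring\<^esub>} \<and>
      r = finsum PS_ring c' {d. c' d \<noteq> \<zero>\<^bsub>PS_ring\<^esub>}"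
    then have r': "r m = c' (mdeg m) m" for m using sum[of c' m] by simp
    have "c' d m = c d m" for d m
      using c' r'[of m] by (cases "mdeg m = d") (auto simp: c_def PS_grade_def)
    then show "c' = c" by (simp add: fun_eq_iff)
  qed
qed

lemma graded_lambda_PS: "graded_lambda_ring PS_ring PS_grade lamPS"
  unfolding graded_lambda_ring_def
proof (intro conjI allI ballI lambda_ring_PS graded_PS)
  fix n d c assume c: "c \<in> PS_grade d"
  then obtain p where p: "c = FF p" using FF_surj by (auto simp: PS_grade_def)
  then have "\<forall>u. cf (Phi p) u \<noteq> 0 \<longrightarrow> wdeg u = d" using c PS_grade_FF by blast
  then show "lamPS n c \<in> PS_grade (n * d)"
    unfolding p lamPS_FF PS_grade_FF Phi_Lz using supp_lam_wt by blast
qed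

subsection \<open>Homomorphisms\<close>

lemma finsum_last:
  fixes R :: "('a, 'b) ring_scheme" (structure)
  assumes "cring R" "f \<in> {0..n} \<rightarrow> carrier R"
  shows "finsum R f {0..n::nat} = f n \<oplus> finsum R f {0..<n}"
proof -
  interpret cring R by fact
  have "{0..n} = insert n {0..<n}" by auto
  then show ?thesis using assms(2) by (auto intro!: finsum_insert)
qed

context
  fixes R :: "('a, 'b) ring_scheme" (structure) and lamR :: "nat \<Rightarrow> 'a \<Rightarrow> 'a"
    and h :: "idx zp \<Rightarrow> 'a"
  assumes special: "special_lambda_ring R lamR" and h: "chom R h"
    and h_Var: "\<And>n v. h (Var v) = lamR (Suc (snd v)) (h (Var (fst v, 0)))"
begin

lemma lambda_R: "lambda_ring R lamR"
  using special unfolding special_lambda_ring_def by blast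

lemma cring_R: "cring R"
  using lambda_R unfolding lambda_ring_def by blast

lemma lamR_0: "x \<in> carrier R \<Longrightarrow> lamR 0 x = \<one>"
  and lamR_closed: "x \<in> carrier R \<Longrightarrow> lamR n x \<in> carrier R"
  and lamR_add: "x \<in> carrier R \<Longrightarrow> y \<in> carrier R \<Longrightarrow>
     lamR n (x \<oplus> y) = finsum R (\<lambda>k. lamR k x \<otimes> lamR (n - k) y) {0..n}"
  using lambda_R unfolding lambda_ring_def by blast+

definition good :: "idx zp set" where
  "good = {p. \<forall>n. h (Lz n p) = lamR n (h p)}"

lemma goodD: "p \<in> good \<Longrightarrow> h (Lz n p) = lamR n (h p)"
  by (simp add: good_def)

lemma h_Lz_add:
  "h (Lz n (p + q)) = finsum R (\<lambda>k. h (Lz k p) \<otimes> h (Lz (n - k) q)) {0..n}"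
proof -
  interpret cring R by (rule cring_R)
  show ?thesis by (simp add: Lz_add chom_sum[OF h] chomD(3)[OF h])
qed

lemma good_add: "p \<in> good \<Longrightarrow> q \<in> good \<Longrightarrow> p + q \<in> good"
  unfolding good_def by (auto simp: h_Lz_add chomD(2)[OF h] lamR_add chomD(1)[OF h])

text \<open>In the addition formula the top term is lambda_n(p) lambda_0(q) = lambda_n(p), and the
  others involve lower operations on \<open>p\<close>; so lambda_n(p) can be solved for by induction
  on n. Applied to sums equal to 1 and to 0, this supplies zero and negatives.\<close>

lemma good_cancel:
  assumes "p + q \<in> good" "q \<in> good"
  shows "p \<in> good"
proof -
  interpret cring R by (rule cring_R)
  have "h (Lz n p) = lamR n (h p)" for n
  proof (induction n rule: less_induct)
    case (less n)
    let ?f = "\<lambda>k. h (Lz k p) \<otimes> h (Lz (n - k) q)" and ?g = "\<lambda>k. lamR k (h p) \<otimes> lamR (n - k) (h q)"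
    have cl: "?f k \<in> carrier R" "?g k \<in> carrier R" for k
      using chomD(1)[OF h] lamR_closed by auto
    have "finsum R ?f {0..n} = finsum R ?g {0..n}"
      using goodD[OF assms(1), of n] by (simp add: h_Lz_add chomD(2)[OF h] lamR_add chomD(1)[OF h])
    moreover have "finsum R ?f {0..<n} = finsum R ?g {0..<n}"
      by (rule finsum_cong') (use less cl goodD[OF assms(2)] in auto)
    moreover have "finsum R ?f {0..n} = ?f n \<oplus> finsum R ?f {0..<n}"
      "finsum R ?g {0..n} = ?g n \<oplus> finsum R ?g {0..<n}"
      by (rule finsum_last[OF cring_R]; use cl in auto)+
    ultimately have "?f n \<oplus> finsum R ?g {0..<n} = ?g n \<oplus> finsum R ?g {0..<n}" by simp
    moreover have "finsum R ?g {0..<n} \<in> carrier R" by (rule finsum_closed) (use cl in auto)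
    ultimately have "?f n = ?g n" using iffD1[OF add.right_cancel] cl by blast
    then show ?case
      using chomD(1,4)[OF h] lamR_closed by (simp add: Lz_0 lamR_0)
  qed
  then show ?thesis by (simp add: good_def)
qed

text \<open>Both sides amount to lambda_t(1) = 1 + t: in \<open>R\<close> by the unit clause of
  speciality, in the polynomial ring because 1 is a monomial.\<close>

lemma good_one: "1 \<in> good"
proof -
  have "lamR n \<one> = witt_one R n" for n
    using special unfolding special_lambda_ring_def by (metis)
  moreover have "h (Lz n 1) = witt_one R n" for n
  proof -
    interpret cring R by (rule cring_R)
    consider "n = 0" | "n = 1" | k where "n = Suc (Suc k)" by (metis One_nat_def not0_implies_Suc)
    then show ?thesis
      by cases (simp_all add: witt_one_def Lz_0 Lz_1 Lz_one chomD(4)[OF h] chom_zero[OF h])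
  qed
  ultimately show ?thesis by (simp add: good_def chomD(4)[OF h])
qed

lemma good_zero: "0 \<in> good"
  by (rule good_cancel[of 0 1]) (simp_all add: good_one)

lemma good_uminus: "p \<in> good \<Longrightarrow> - p \<in> good"
  by (rule good_cancel[of "- p" p]) (simp_all add: good_zero)

text \<open>Both sides evaluate \<open>qm n\<close> at the lambda-operations of the two factors: in
  the polynomial ring by \<open>Lz_mult\<close>, in \<open>R\<close> by speciality once
  \<open>P_mult\<close> has been replaced by \<open>qm\<close>.\<close>

lemma good_mult:
  assumes "p \<in> good" "q \<in> good"
  shows "p * q \<in> good"
proof -
  interpret cring R by (rule cring_R)
  have cl: "h p \<in> carrier R" "h q \<in> carrier R" using chomD(1)[OF h] by auto
  have "h (Lz n (p * q)) = lamR n (h (p * q))" for n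
  proof (cases n)
    case 0
    then show ?thesis using chomD(1,4)[OF h] by (simp add: Lz_0 lamR_0)
  next
    case (Suc k)
    have "lamR n (h p \<otimes> h q) = witt_mult R (\<lambda>n. lamR n (h p)) (\<lambda>n. lamR n (h q)) n"
    proof (rule fun_cong[where x = n])
      show "(\<lambda>n. lamR n (h p \<otimes> h q)) = witt_mult R (\<lambda>n. lamR n (h p)) (\<lambda>n. lamR n (h q))"
        using special cl unfolding special_lambda_ring_def by blast
    qed
    also have "\<dots> = reval R (\<lambda>(c, k). if c then lamR k (h q) else lamR k (h p)) (P_mult n)"
      by (simp add: witt_mult_def Suc)
    also have "\<dots> = cpev R (\<lambda>v. if fst v = 0 then lamR (Suc (snd v)) (h p) else lamR (Suc (snd v)) (h q)) (qm n)"
      by (rule reval_P_mult[OF cring_R]) (use cl lamR_closed in auto)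
    also have "\<dots> = cpev R (\<lambda>v. h (Lz (Suc (snd v)) (if fst v = 0 then p else q))) (qm n)"
      using goodD[OF assms(1)] goodD[OF assms(2)]
      by (intro arg_cong2[of _ _ _ _ "cpev R"]) (auto simp: fun_eq_iff)
    also have "\<dots> = h (Lz n (p * q))"
      by (simp add: Lz_mult chom_pev[OF h])
    finally show ?thesis by (simp add: chomD(3)[OF h])
  qed
  then show ?thesis by (simp add: good_def)
qed

text \<open>Since \<open>h (Var (i, k))\<close> is itself lambda_(k+1) of x =
  \<open>h (Var (i, 0))\<close>, speciality expresses lambda_n of it through \<open>P_lam\<close> in
  the lambda_j(x). These are again values of \<open>h\<close> at variables of row i, the only ones
  occurring in \<open>ql i\<close>.\<close>

lemma good_Var: "Var v \<in> good"
proof -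
  interpret cring R by (rule cring_R)
  define x where "x = h (Var (fst v, 0))"
  have x: "x \<in> carrier R" unfolding x_def by (rule chomD(1)[OF h])
  have "h (Lz n (Var v)) = lamR n (h (Var v))" for n
  proof (cases n)
    case 0
    then show ?thesis using chomD(1,4)[OF h] by (simp add: Lz_0 lamR_0)
  next
    case (Suc k)
    have "lamR n (lamR (Suc (snd v)) x) = witt_lam R (Suc (snd v)) (\<lambda>n. lamR n x) n"
    proof (rule fun_cong[where x = n])
      show "(\<lambda>n. lamR n (lamR (Suc (snd v)) x)) = witt_lam R (Suc (snd v)) (\<lambda>n. lamR n x)"
        using special x unfolding special_lambda_ring_def by blast
    qed
    also have "\<dots> = reval R (\<lambda>n. lamR n x) (P_lam n (Suc (snd v)))"
      by (simp add: witt_lam_def Suc)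
    also have "\<dots> = cpev R (\<lambda>w. lamR (Suc (snd w)) x) (ql (fst v) n (Suc (snd v)))"
      by (rule reval_P_lam[OF cring_R]) (use x lamR_closed in auto)
    also have "\<dots> = cpev R (\<lambda>w. h (Var w)) (ql (fst v) n (Suc (snd v)))"
    proof (rule cpev_cong)
      fix u w assume "u \<in> keys (ql (fst v) n (Suc (snd v)))" "w \<in> keys u"
      then have "fst w = fst v" using vars_ql by blast
      then show "lamR (Suc (snd w)) x = h (Var w)" using h_Var[of w] by (simp add: x_def)
    qed (rule chomD(1)[OF h])
    also have "\<dots> = h (Lz n (Var v))"
      using chom_eq_cpev[OF h, of "ql (fst v) n (Suc (snd v))"] by (simp add: Lz_Var)
    finally show ?thesis using h_Var[of v] by (simp add: x_def)
  qed
  then show ?thesis by (simp add: good_def)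
qed

lemma good_all: "p \<in> good"
proof (induction p rule: zp_induct)
  case (single u c)
  have nat: "of_nat n \<in> good" for n
    by (induction n) (auto simp: good_zero good_one good_add)
  have int: "of_int c \<in> good" for c
    by (cases c rule: int_cases2) (auto simp: nat good_uminus)
  have power: "x ^ n \<in> good" if "x \<in> good" for x n
    by (induction n) (auto simp: that good_one good_mult)
  have prod: "prod f A \<in> good" if "\<And>x. x \<in> A \<Longrightarrow> f x \<in> good" for f :: "idx \<Rightarrow> idx zp" and A
    using that by (induction A rule: infinite_finite_induct) (auto simp: good_one good_mult)
  have "mev Var u \<in> good"
    unfolding mev_def by (intro prod power good_Var)
  then have "of_int c * mev Var u \<in> good" by (intro good_mult int)
  then show ?case by (simp only: mev_Var of_int_zp)
qed (rule good_add)

lemma h_Lz: "h (Lz n p) = lamR n (h p)"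
  using goodD[OF good_all] .

end

definition iFF :: "ps \<Rightarrow> idx zp" where
  "iFF c = iPhi (to_mps c)"

lemma iFF_FF [simp]: "iFF (FF p) = p"
  unfolding iFF_def to_mps_FF by (rule Phi_inj) (simp add: Phi_iPhi bounded_sym_Phi)

text \<open>Each variable (i, k) is weighted by (i + 1)(k + 1), the degree of lambda_(k+1) of an
  element of degree i + 1.\<close>

lemma wt_lead_ge: "wdeg (lead \<mu>) = (\<Sum>v\<in>keys \<mu>. lookup \<mu> v * (Suc (snd v) * Suc (fst v)))"
proof -
  have "wdeg (sq i {..k}) = Suc k * Suc i" for i k
    by (simp add: sq_def wt_sum)
  then show ?thesis by (simp add: lead_def wt_sum wt_mulm)
qed

text \<open>By \<open>keys_homogeneous\<close> every monomial of \<open>p\<close> has weight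
  \<open>d\<close>, and the weights of the variables are the degrees of the elements substituted for
  them.\<close>

lemma graded_eval:
  fixes R :: "('a, 'b) ring_scheme" (structure)
  assumes "graded_lambda_ring R G lamR" "\<And>i. x i \<in> G (Suc i)" "FF p \<in> PS_grade d"
  shows "cpev R (\<lambda>v. lamR (Suc (snd v)) (x (fst v))) p \<in> G d"
proof -
  have R: "lambda_ring R lamR" and gr: "graded_ring R G"
    and lamG: "\<And>n d r. r \<in> G d \<Longrightarrow> lamR n r \<in> G (n * d)"
    using assms(1) unfolding graded_lambda_ring_def by blast+
  have "cring R" using R unfolding lambda_ring_def by blast
  then interpret cring R .
  have G: "G d \<subseteq> carrier R" "\<zero> \<in> G d" "y \<in> G d \<Longrightarrow> z \<in> G d \<Longrightarrow> y \<oplus> z \<in> G d"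
    "y \<in> G d \<Longrightarrow> \<ominus> y \<in> G d" "y \<in> G d \<Longrightarrow> z \<in> G e \<Longrightarrow> y \<otimes> z \<in> G (d + e)" for d e y z
    using gr unfolding graded_ring_def by blast+
  \<comment> \<open>The unit lies in \<open>G 0\<close>, being the value of lambda_0 at an element
    of \<open>G 0\<close>.\<close>
  have "lamR 0 \<zero> = \<one>" using R unfolding lambda_ring_def by blast
  then have one: "\<one> \<in> G 0" using lamG[OF G(2), of 0 0] by simp
  have pow: "y [^] n \<in> G (n * d)" if "y \<in> G d" for y n d
  proof (induction n)
    case (Suc n)
    from G(5)[OF Suc that] show ?case by (simp add: add.commute)
  qed (simp add: one)
  have prod: "finprod R f A \<in> G (\<Sum>v\<in>A. e v)" if "finite A" "\<And>v. v \<in> A \<Longrightarrow> f v \<in> G (e v)"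
    for f :: "idx \<Rightarrow> 'a" and A e
    using that
  proof (induction A rule: finite_induct)
    case (insert v A)
    then have "f \<in> A \<rightarrow> carrier R" "f v \<in> carrier R" using G(1) by blast+
    then show ?case using insert G(5) by (simp add: finprod_insert)
  qed (simp add: one)
  have mult: "add_pow R (c :: int) y \<in> G d" if y: "y \<in> G d" for c y
  proof -
    have nat: "add_pow R (int n) y \<in> G d" for n
    proof (induction n)
      case (Suc n)
      have "y \<in> carrier R" using y G(1) by blast
      then have "add_pow R (1 + int n) y = y \<oplus> add_pow R (int n) y"
        by (simp only: add.int_pow_mult add.int_pow_1)
      then show ?case using G(3)[OF y Suc] by simp
    qed (simp add: G(2))
    show ?thesis
    proof (cases c rule: int_cases2)
      case (nonpos n)
      have "y \<in> carrier R" using y G(1) by blast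
      then have "add_pow R c y = \<ominus> add_pow R (int n) y"
        by (simp add: nonpos add.int_pow_neg a_inv_def)
      then show ?thesis using G(4)[OF nat] by simp
    qed (simp add: nat)
  qed
  have sum: "finsum R f A \<in> G d" if "finite A" "\<And>v. v \<in> A \<Longrightarrow> f v \<in> G d"
    for f :: "(idx \<Rightarrow>\<^sub>0 nat) \<Rightarrow> 'a" and A
    using that
  proof (induction A rule: finite_induct)
    case (insert v A)
    then have "f \<in> A \<rightarrow> carrier R" "f v \<in> carrier R" using G(1) by blast+
    then show ?case using insert G(3) by (simp add: finsum_insert)
  qed (simp add: G(2))
  have "cev R (\<lambda>v. lamR (Suc (snd v)) (x (fst v))) \<mu> \<in> G d" if \<mu>: "\<mu> \<in> keys p" for \<mu>
    unfolding cev_def keys_homogeneous[OF assms(3) \<mu>, symmetric] wt_lead_ge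
    by (intro prod pow lamG assms(2)) simp
  then show ?thesis unfolding cpev_def by (intro sum mult) simp
qed

lemma chom_hom_FF:
  assumes "cring R" "\<phi> \<in> ring_hom PS_ring R"
  shows "chom R (\<lambda>p. \<phi> (FF p))"
proof -
  have "\<phi> (FF p) \<in> carrier R" for p
    using ring_hom_closed[OF assms(2)] FF_PS by simp
  moreover have "\<phi> (FF (p + q)) = \<phi> (FF p) \<oplus>\<^bsub>R\<^esub> \<phi> (FF q)" for p q
    using ring_hom_add[OF assms(2), of "FF p" "FF q"] FF_PS by (simp add: FF_add)
  moreover have "\<phi> (FF (p * q)) = \<phi> (FF p) \<otimes>\<^bsub>R\<^esub> \<phi> (FF q)" for p q
    using ring_hom_mult[OF assms(2), of "FF p" "FF q"] FF_PS by (simp add: FF_mult)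
  moreover have "\<phi> (FF 1) = \<one>\<^bsub>R\<^esub>"
    using ring_hom_one[OF assms(2)] by (simp add: FF_one)
  ultimately show ?thesis by (simp add: chom_def)
qed

lemma FF_Var: "FF (Var v) = lamPS (Suc (snd v)) (M (Suc (fst v)))"
proof -
  have "Lz (Suc (snd v)) (Var (fst v, 0)) = Var v"
    by (rule Phi_inj) (simp add: Phi_Lz ee_def)
  then show ?thesis by (simp add: FF_M lamPS_FF)
qed

lemma M_grade: "M (Suc i) \<in> PS_grade (Suc i)"
proof -
  have "wdeg u = Suc i" if "cf (MM i) u \<noteq> 0" for u
    using that by (auto simp: cf_MM split: if_splits)
  then show ?thesis unfolding FF_M PS_grade_FF by (simp add: ee_def)
qed

lemma bij_hom:
  fixes R :: "('a, 'b) ring_scheme"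
  assumes special: "special_lambda_ring R lamR" and graded: "graded_lambda_ring R G lamR"
  shows "bij_betw (\<lambda>\<phi>. \<lambda>d\<in>{1..}. \<phi> (M d))
     {\<phi>. \<phi> \<in> extensional PS \<and> graded_lambda_hom PS_ring PS_grade lamPS R G lamR \<phi>}
     (Pi\<^sub>E {1..} G)"
proof (rule bij_betw_imageI)
  let ?H = "{\<phi>. \<phi> \<in> extensional PS \<and> graded_lambda_hom PS_ring PS_grade lamPS R G lamR \<phi>}"
  let ?f = "\<lambda>\<phi>. \<lambda>d\<in>{1..}. \<phi> (M d)"
  have R: "lambda_ring R lamR" using special unfolding special_lambda_ring_def by blast
  then have cring: "cring R" unfolding lambda_ring_def by blast
  interpret cring R by (rule cring)
  have homD: "chom R (\<lambda>p. \<phi> (FF p))" "\<And>d. \<phi> ` PS_grade d \<subseteq> G d"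
    "\<And>n c. c \<in> PS \<Longrightarrow> \<phi> (lamPS n c) = lamR n (\<phi> c)" "\<phi> \<in> extensional PS" if "\<phi> \<in> ?H" for \<phi>
    using that chom_hom_FF[OF cring] unfolding graded_lambda_hom_def by auto
  show "inj_on ?f ?H"
  proof (rule inj_onI)
    fix \<phi> \<psi> assume \<phi>: "\<phi> \<in> ?H" and \<psi>: "\<psi> \<in> ?H" and eq: "?f \<phi> = ?f \<psi>"
    have M: "\<phi> (M (Suc i)) = \<psi> (M (Suc i))" for i
      using fun_cong[OF eq, of "Suc i"] by simp
    have PS_M: "M (Suc i) \<in> PS" for i using FF_PS by (simp add: FF_M)
    \<comment> \<open>Both maps commute with the lambda-operations and every generator is lambda_k
      of some \<open>M d\<close>, so agreement on the \<open>M d\<close> spreads to all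
      generators.\<close>
    have "\<phi> (FF (Var v)) = \<psi> (FF (Var v))" for v
      unfolding FF_Var homD(3)[OF \<phi> PS_M] homD(3)[OF \<psi> PS_M] M ..
    then have "\<phi> (FF p) = \<psi> (FF p)" for p
      using chom_eq_cpev[OF homD(1)[OF \<phi>], of p] chom_eq_cpev[OF homD(1)[OF \<psi>], of p] by simp
    then have "\<phi> c = \<psi> c" if "c \<in> PS" for c
      using FF_surj[OF that] by blast
    then show "\<phi> = \<psi>" using extensionalityI[OF homD(4)[OF \<phi>] homD(4)[OF \<psi>]] by blast
  qed
  show "?f ` ?H = Pi\<^sub>E {1..} G"
  proof (intro subset_antisym subsetI)
    fix x assume "x \<in> ?f ` ?H"
    then obtain \<phi> where \<phi>: "\<phi> \<in> ?H" "x = ?f \<phi>" by blast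
    have "\<phi> (M d) \<in> G d" if "d \<ge> 1" for d
    proof -
      obtain i where "d = Suc i" using \<open>d \<ge> 1\<close> by (cases d) auto
      then show ?thesis using homD(2)[OF \<phi>(1), of d] M_grade by blast
    qed
    then show "x \<in> Pi\<^sub>E {1..} G" unfolding \<phi>(2) by auto
  next
    fix x assume x: "x \<in> Pi\<^sub>E {1..} G"
    then have xG: "x (Suc i) \<in> G (Suc i)" for i by auto
    have "graded_ring R G" using graded unfolding graded_lambda_ring_def by blast
    then have GR: "G d \<subseteq> carrier R" for d unfolding graded_ring_def by blast
    have xR: "x (Suc i) \<in> carrier R" for i using xG GR by blast
    have lamR: "lamR n y \<in> carrier R" "lamR (Suc 0) y = y" if "y \<in> carrier R" for n y
      using R that unfolding lambda_ring_def One_nat_def by blast+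
    \<comment> \<open>Compatibility with the lambda-operations forces this choice: generator (i, k)
      must go to lambda_(k+1) of the prescribed image of M_(i+1).\<close>
    define \<theta> where "\<theta> v = lamR (Suc (snd v)) (x (Suc (fst v)))" for v :: idx
    define h where "h = cpev R \<theta>"
    have \<theta>: "\<theta> v \<in> carrier R" for v unfolding \<theta>_def by (intro lamR xR)
    have h: "chom R h" unfolding h_def by (rule chom_cpev[of \<theta>, OF \<theta>])
    have hV: "h (Var v) = \<theta> v" for v unfolding h_def by (rule cpev_Var[of \<theta>, OF \<theta>])
    have h_M: "h (Var (i, 0)) = x (Suc i)" for i
      by (simp add: hV \<theta>_def lamR(2)[OF xR])
    have h_Var: "h (Var v) = lamR (Suc (snd v)) (h (Var (fst v, 0)))" for v
    proof -
      have "h (Var v) = lamR (Suc (snd v)) (x (Suc (fst v)))" by (simp only: hV \<theta>_def)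
      then show ?thesis by (simp only: h_M)
    qed
    define \<phi> where "\<phi> = (\<lambda>c\<in>PS. h (iFF c))"
    have \<phi>: "\<phi> (FF p) = h p" for p by (simp add: \<phi>_def FF_PS)
    have "\<phi> \<in> ring_hom PS_ring R"
    proof (rule ring_hom_memI)
      fix c assume "c \<in> carrier PS_ring"
      then obtain p where p: "c = FF p" using FF_surj by auto
      show "\<phi> c \<in> carrier R" by (simp add: p \<phi> chomD(1)[OF h])
      fix d assume "d \<in> carrier PS_ring"
      then obtain q where q: "d = FF q" using FF_surj by auto
      show "\<phi> (c \<otimes>\<^bsub>PS_ring\<^esub> d) = \<phi> c \<otimes>\<^bsub>R\<^esub> \<phi> d"
        by (simp add: p q FF_mult \<phi> chomD(3)[OF h])
      show "\<phi> (c \<oplus>\<^bsub>PS_ring\<^esub> d) = \<phi> c \<oplus>\<^bsub>R\<^esub> \<phi> d"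
        by (simp add: p q FF_add \<phi> chomD(2)[OF h])
    qed (simp add: FF_one \<phi> chomD(4)[OF h])
    moreover have "\<phi> ` PS_grade d \<subseteq> G d" for d
    proof
      fix y assume "y \<in> \<phi> ` PS_grade d"
      then obtain c where c: "c \<in> PS_grade d" "y = \<phi> c" by blast
      then obtain p where "c = FF p" using FF_surj by (auto simp: PS_grade_def)
      then show "y \<in> G d"
        using graded_eval[of R G lamR "\<lambda>i. x (Suc i)", OF graded xG, of p d] c
        by (simp add: \<phi> h_def \<theta>_def[abs_def])
    qed
    moreover have "\<phi> (lamPS n c) = lamR n (\<phi> c)" if "c \<in> PS" for n c
    proof -
      obtain p where p: "c = FF p" using FF_surj \<open>c \<in> PS\<close> by blast
      show ?thesis unfolding p lamPS_FF \<phi> by (rule h_Lz[OF special h h_Var])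
    qed
    ultimately have "\<phi> \<in> ?H" by (simp add: graded_lambda_hom_def \<phi>_def)
    moreover have "?f \<phi> = x"
    proof (rule extensionalityI)
      show "x \<in> extensional {1..}" using x by (simp add: PiE_def)
      fix d :: nat assume "d \<in> {1..}"
      then obtain i where "d = Suc i" by (cases d) auto
      then show "?f \<phi> d = x d" by (simp add: FF_M \<phi> h_M)
    qed simp
    ultimately show "x \<in> ?f ` ?H" by blast
  qed
qed

theorem theorem2:
  shows "(\<exists>!lam. (\<forall>n. lam n \<in> extensional PS) \<and> lambda_ring PS_ring lam \<and>
                adams_ops PS_ring lam ps_psi)
    \<and> graded_lambda_ring PS_ring PS_grade
        (THE lam. (\<forall>n. lam n \<in> extensional PS) \<and> lambda_ring PS_ring lam \<and>
                  adams_ops PS_ring lam ps_psi)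
    \<and> (\<forall>(R :: ('r, 'z) ring_scheme) G lamR.
          special_lambda_ring R lamR \<and> graded_lambda_ring R G lamR \<longrightarrow>
          bij_betw (\<lambda>\<phi>. \<lambda>d\<in>{1..}. \<phi> (M d))
            {\<phi>. \<phi> \<in> extensional PS \<and>
                 graded_lambda_hom PS_ring PS_grade
                   (THE lam. (\<forall>n. lam n \<in> extensional PS) \<and> lambda_ring PS_ring lam \<and>
                             adams_ops PS_ring lam ps_psi)
                   R G lamR \<phi>}
            (Pi\<^sub>E {1..} G))"
proof -
  let ?P = "\<lambda>lam. (\<forall>n. lam n \<in> extensional PS) \<and> lambda_ring PS_ring lam \<and>
                adams_ops PS_ring lam ps_psi"
  have P: "?P lamPS"
    using lambda_ring_PS adams_ops_PS by (simp add: lamPS_def)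
  \<comment> \<open>Off the carrier the functions agree by extensionality, on it by uniqueness of
    solutions of the Newton relation.\<close>
  have unique: "lam' = lamPS" if "?P lam'" for lam'
  proof (rule ext)
    fix n
    show "lam' n = lamPS n"
      using that P adams_ops_PS_unique[of lam' _ n] by (intro extensionalityI[of _ PS]) auto
  qed
  have ex: "\<exists>!lam. ?P lam" using P unique by blast
  have the: "(THE lam. ?P lam) = lamPS" by (rule the_equality[where P = ?P]) (fact P, fact unique)
  show ?thesis
    unfolding the
  proof (intro conjI allI impI)
    fix R :: "('r, 'z) ring_scheme" and G lamR
    assume "special_lambda_ring R lamR \<and> graded_lambda_ring R G lamR"
    then show "bij_betw (\<lambda>\<phi>. \<lambda>d\<in>{1..}. \<phi> (M d))
        {\<phi>. \<phi> \<in> extensional PS \<and> graded_lambda_hom PS_ring PS_grade lamPS R G lamR \<phi>}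
        (Pi\<^sub>E {1..} G)"
      using bij_hom by blast
  qed (fact ex, fact graded_lambda_PS)
qed

end
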